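(* Consider an irreducible absorbing discrete-time Markov chain over a finite state space $S$, and let $Q$ be the matrix of transition probabilities over the $m$ non-absorbing states. Let $\mu_0$ be a probability vector over the non-absorbing states. Then there exists a unique quasi-stationary distribution $\mu$ satisfying $$\mu'Q=\lambda\mu',\qquad \mu'\mathbf 1=1,\qquad \mu\ge0.$$ Let $(\mu_n)$ be the iterates of the projection algorithm described in the context, with positive step sizes satisfying $\epsilon_n\downarrow 0$, $\sum_n\epsilon_n=\infty$, $\sum_n\epsilon_n^2<\infty$ and $\epsilon_n=\Theta\left(\frac1{n^\alpha}\right)$ for some $0.5<\alpha<1$. Then the averaged sequence $$\nu_n=\frac1n\sum_{k=1}^n\mu_k$$ converges to $\mu$ with probability $1$. Furthermore, $\sqrt n\,(\nu_n-\mu)$ converges in distribution to $N(0,V)$ for some covariance matrix $V$.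
   Context: Setting: a discrete-time Markov chain on a finite state space $S$, with set of transient (non-absorbing) states $\mathcal T\subsetneq S$, $|\mathcal T|=m$ (all absorbing states may be merged into one). $Q$ is the $m\times m$ substochastic matrix of transition probabilities among the states of $\mathcal T$. "Irreducible absorbing" means that $Q$ is irreducible (not necessarily aperiodic) and that the chain can be absorbed (some row sum of $Q$ is less than $1$). A prime denotes transpose, $\mathbf 1$ is the all-ones vector, $\mathbb I$ is an indicator, and inequalities between vectors are entrywise. Projection algorithm: let $H=\{x\in\mathbb R^m: x\ge0,\ \sum_i x_i=1\}$ and let $\Theta_H$ denote the $L_2$ (Euclidean) projection onto $H$. Start from $\mu_0\in H$. For each $n\ge0$, run a copy $(X^{(n+1)}_k)_{k\ge0}$ of the Markov chain with initial distribution $\mu_n$ (conditionally independent of the past given $\mu_n$) until the absorption time $\tau^{(n+1)}=\min\{k\ge0:X^{(n+1)}_k\notin\mathcal T\}$, and set $$\mu_{n+1}=\Theta_H\left[\mu_n+\epsilon_n\sum_{k=0}^{\tau^{(n+1)}-1}\left(\mathbb I(X^{(n+1)}_k=\cdot)-\mu_n\right)\right].$$ *)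

theory Defs
  imports "HOL-Probability.Probability" "HOL-Library.Landau_Symbols"
begin

text \<open>
  The state space is the finite type \<open>'s\<close>, with transition matrix \<open>P\<close>. The non-absorbing states
  form the set \<open>T\<close>; they are enumerated by \<open>idx :: 'm \<Rightarrow> 's\<close>, so that vectors and matrices over
  \<open>T\<close> become elements of \<open>real^'m\<close> and \<open>real^'m^'m\<close>, with \<open>CARD('m) = card T\<close>.
\<close>

definition stochastic_matrix :: "real^'s^'s \<Rightarrow> bool" where
  "stochastic_matrix P \<longleftrightarrow> (\<forall>x y. 0 \<le> P $ x $ y) \<and> (\<forall>x. (\<Sum>y\<in>UNIV. P $ x $ y) = 1)"

definition restrict_matrix :: "real^'s^'s \<Rightarrow> ('m \<Rightarrow> 's) \<Rightarrow> real^'m^'m" where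
  "restrict_matrix P idx = (\<chi> i j. P $ idx i $ idx j)"

text \<open>Every state leads to every other one. Paths of length 0 are allowed, which matters only for
  a single state.\<close>

definition irreducible_matrix :: "real^'m^'m \<Rightarrow> bool" where
  "irreducible_matrix Q \<longleftrightarrow> (\<forall>i j. (i, j) \<in> {(k, l). 0 < Q $ k $ l}\<^sup>*)"

definition irreducible_absorbing_chain ::
    "real^'s^'s \<Rightarrow> 's set \<Rightarrow> ('m::finite \<Rightarrow> 's) \<Rightarrow> bool" where
  "irreducible_absorbing_chain P T idx \<longleftrightarrow>
     stochastic_matrix P \<and>
     T \<subset> UNIV \<and> bij_betw idx UNIV T \<and>
     (\<forall>x. x \<notin> T \<longrightarrow> P $ x $ x = 1) \<and>
     irreducible_matrix (restrict_matrix P idx) \<and>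
     (\<exists>i. (\<Sum>j\<in>UNIV. restrict_matrix P idx $ i $ j) < 1)"

definition prob_simplex :: "(real^'m) set" where
  "prob_simplex = {x. (\<forall>i. 0 \<le> x $ i) \<and> (\<Sum>i\<in>UNIV. x $ i) = 1}"

definition quasi_stationary :: "real^'m^'m \<Rightarrow> real^'m \<Rightarrow> bool" where
  "quasi_stationary Q \<mu> \<longleftrightarrow>
     (\<exists>l::real. \<mu> v* Q = l *\<^sub>R \<mu>) \<and> (\<Sum>i\<in>UNIV. \<mu> $ i) = 1 \<and> (\<forall>i. 0 \<le> \<mu> $ i)"

definition extend_distribution :: "('m \<Rightarrow> 's) \<Rightarrow> real^'m \<Rightarrow> 's \<Rightarrow> real" where
  "extend_distribution idx v x = (\<Sum>i | idx i = x. v $ i)"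

text \<open>Probability that the chain started from \<open>init\<close> has initial path \<open>s 0, \<dots>, s k\<close>.\<close>

definition path_prob :: "real^'s^'s \<Rightarrow> ('s \<Rightarrow> real) \<Rightarrow> nat \<Rightarrow> (nat \<Rightarrow> 's) \<Rightarrow> real" where
  "path_prob P init k s = init (s 0) * (\<Prod>j<k. P $ s j $ s (Suc j))"

text \<open>If the path never leaves \<open>T\<close>, this is an arbitrary number; such paths have probability 0
  in the situation considered here.\<close>

definition absorption_time :: "'s set \<Rightarrow> (nat \<Rightarrow> 's) \<Rightarrow> nat" where
  "absorption_time T x = (LEAST k. x k \<notin> T)"

definition projection_step ::
    "'s set \<Rightarrow> ('m \<Rightarrow> 's) \<Rightarrow> real \<Rightarrow> (nat \<Rightarrow> 's) \<Rightarrow> real^'m \<Rightarrow> real^'m" where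
  "projection_step T idx \<epsilon> x v =
     closest_point prob_simplex
       (v + \<epsilon> *\<^sub>R (\<Sum>k<absorption_time T x. ((\<chi> i. of_bool (x k = idx i)) - v)))"

text \<open>The information generated by the first \<open>n\<close> runs; run \<open>j \<ge> 1\<close> is \<open>X j\<close>.\<close>

definition past ::
    "'w measure \<Rightarrow> (nat \<Rightarrow> nat \<Rightarrow> 'w \<Rightarrow> 's) \<Rightarrow> (nat \<Rightarrow> 'w \<Rightarrow> real^'m) \<Rightarrow> nat \<Rightarrow> 'w measure" where
  "past M X \<mu> n = sigma (space M)
     ({X j k -` {x} \<inter> space M | j k x. 1 \<le> j \<and> j \<le> n} \<union>
      {\<mu> j -` B \<inter> space M | j B. j \<le> n \<and> B \<in> sets borel})"

text \<open>In the last clause, the conditional law of run \<open>n + 1\<close> given the past is the law of the chain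
  started from \<open>\<mu> n\<close>: its law given \<open>\<mu> n\<close> is that of the chain with initial distribution \<open>\<mu> n\<close>, and
  it is conditionally independent of the past given \<open>\<mu> n\<close>.\<close>

definition projection_algorithm ::
    "real^'s^'s \<Rightarrow> 's set \<Rightarrow> ('m \<Rightarrow> 's) \<Rightarrow> (nat \<Rightarrow> real) \<Rightarrow> real^'m \<Rightarrow> 'w measure \<Rightarrow>
     (nat \<Rightarrow> nat \<Rightarrow> 'w \<Rightarrow> 's) \<Rightarrow> (nat \<Rightarrow> 'w \<Rightarrow> real^'m) \<Rightarrow> bool" where
  "projection_algorithm P T idx \<epsilon> \<mu>\<^sub>0 M X \<mu> \<longleftrightarrow>
     prob_space M \<and>
     (\<forall>n k. X (Suc n) k \<in> M \<rightarrow>\<^sub>M count_space UNIV) \<and>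
     (\<forall>n. \<mu> n \<in> borel_measurable M) \<and>
     (AE \<omega> in M. \<mu> 0 \<omega> = \<mu>\<^sub>0) \<and>
     (\<forall>n. AE \<omega> in M.
        \<mu> (Suc n) \<omega> = projection_step T idx (\<epsilon> n) (\<lambda>k. X (Suc n) k \<omega>) (\<mu> n \<omega>)) \<and>
     (\<forall>n k s. AE \<omega> in M.
        real_cond_exp M (past M X \<mu> n)
          (indicator {\<omega> \<in> space M. \<forall>j\<le>k. X (Suc n) j \<omega> = s j}) \<omega> =
        path_prob P (extend_distribution idx (\<mu> n \<omega>)) k s)"

definition admissible_steps :: "(nat \<Rightarrow> real) \<Rightarrow> bool" where
  "admissible_steps \<epsilon> \<longleftrightarrow>
     (\<forall>n. 0 < \<epsilon> n) \<and> decseq \<epsilon> \<and> \<epsilon> \<longlonglongrightarrow> 0 \<and>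
     \<not> summable \<epsilon> \<and> summable (\<lambda>n. (\<epsilon> n)\<^sup>2) \<and>
     (\<exists>\<alpha>::real. 1 / 2 < \<alpha> \<and> \<alpha> < 1 \<and> \<epsilon> \<in> \<Theta>(\<lambda>n. 1 / real n powr \<alpha>))"

definition averaged_iterates :: "(nat \<Rightarrow> 'w \<Rightarrow> real^'m) \<Rightarrow> nat \<Rightarrow> 'w \<Rightarrow> real^'m" where
  "averaged_iterates \<mu> n \<omega> = (1 / real n) *\<^sub>R (\<Sum>k=1..n. \<mu> k \<omega>)"

definition covariance_matrix :: "real^'m^'m \<Rightarrow> bool" where
  "covariance_matrix V \<longleftrightarrow> transpose V = V \<and> (\<forall>t. 0 \<le> t \<bullet> (V *v t))"

definition normal_law :: "real \<Rightarrow> real \<Rightarrow> real measure" where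
  "normal_law m v =
     (if v = 0 then return borel m else density lborel (\<lambda>x. ennreal (normal_density m (sqrt v) x)))"

text \<open>Possibly degenerate Gaussian laws: every linear functional is normally distributed.
  Degenerate covariance matrices cannot be excluded: in the application below the vectors take
  values in the hyperplane of coordinate sum 0.\<close>

definition multivariate_normal :: "(real^'m) measure \<Rightarrow> real^'m \<Rightarrow> real^'m^'m \<Rightarrow> bool" where
  "multivariate_normal N a V \<longleftrightarrow>
     prob_space N \<and> sets N = sets borel \<and> covariance_matrix V \<and>
     (\<forall>t. distr N borel (\<lambda>x. t \<bullet> x) = normal_law (t \<bullet> a) (t \<bullet> (V *v t)))"

definition converges_in_distribution ::
    "'w measure \<Rightarrow> (nat \<Rightarrow> 'w \<Rightarrow> real^'m) \<Rightarrow> (real^'m) measure \<Rightarrow> bool" where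
  "converges_in_distribution M Y N \<longleftrightarrow>
     (\<forall>f::real^'m \<Rightarrow> real. continuous_on UNIV f \<and> bounded (range f) \<longrightarrow>
        (\<lambda>n. \<integral>\<omega>. f (Y n \<omega>) \<partial>M) \<longlonglongrightarrow> (\<integral>x. f x \<partial>N))"

end

theory Submission
  imports Defs "HOL-Real_Asymp.Real_Asymp"
begin

text \<open>
  Let \<open>R = (I - Q)\<inverse>\<close>, an entrywise positive matrix with left and right Perron vectors \<open>qsd\<close> and \<open>w\<close>.
  Given \<open>\<mu> n = x\<close>, the update direction has mean \<open>drift x = x v* R - c x\<close>, with \<open>c\<close> the coordinate sum of
  \<open>x v* R\<close>. In coordinate \<open>i\<close> the direction is at least \<open>- \<tau> x\<^sub>i\<close>, where \<open>\<tau>\<close> is the absorption time, so the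
  projection acts only if \<open>\<epsilon> n * \<tau> > 1\<close>; as \<open>\<tau>\<close> has geometric tails, this is negligible.

  The function \<open>(\<Sum>i. w\<^sub>i x\<^sub>i\<^sup>2 / qsd\<^sub>i) / (w \<bullet> x)\<^sup>2\<close> is a global Lyapunov function: its excess over 1 is comparable
  to \<open>|x - qsd|\<^sup>2\<close> and is contracted by the drift at a linear rate. Hence \<open>E |\<mu> n - qsd|\<^sup>2 = O(\<epsilon> n)\<close>, which gives
  the almost sure convergence of the averages by Kronecker's lemma.

  For the limit law, sum the linearised recursion divided by \<open>\<epsilon> n\<close> (Polyak and Juditsky): the sum of the errors
  is a linear image of a martingale, up to terms that are \<open>o(sqrt n)\<close> in mean. The quadratic remainder is of this
  order because \<open>\<alpha> > 1/2\<close>, the boundary terms of the summation by parts because \<open>\<alpha> < 1\<close>. The expectations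
  \<open>E (cos (t \<bullet> Y + \<beta>))\<close> of the normalised martingale converge by a one-step Taylor expansion, and for a
  tight sequence they determine convergence in distribution.
\<close>

section \<open>Nonnegative matrices and the quasi-stationary distribution\<close>

text \<open>The Lyapunov function comes from a Doob transform. The weights
  \<open>w $ i * qsd $ i\<close> form the stationary law of the kernel
  \<open>R $ i $ j * w $ j / (\<theta> * w $ i)\<close>. With \<open>u = x / qsd\<close> the
  function is the second moment of \<open>u\<close> under these weights over the square of its mean,
  so its excess over 1 is a relative variance. It is homogeneous of degree 0, hence blind to the
  radial term \<open>- c x\<close> of the drift, and only the linear map \<open>x v* R\<close> has
  to contract. Passing from \<open>Q\<close> to \<open>R\<close> makes periodic chains harmless: all
  path lengths are summed, so a Doeblin-type lower bound holds at once. As the contraction holds on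
  the whole simplex, the mean-square rate follows without prior almost sure convergence of the
  iterates. The conditional law of a run is given on cylinder events only; conditional moments are
  therefore written as identities between integrals against a factor \<open>Z\<close> measurable for
  the past. The projected point itself is never analysed: on a long run
  \<open>1 \<le> \<epsilon> n * \<tau>\<close>, so any bounded discrepancy is paid for by
  \<open>(\<epsilon> n * \<tau>)\<^sup>2\<close>.\<close>

lemma vector_matrix_nth: "(x v* Q) $ j = (\<Sum>i\<in>UNIV. x $ i * Q $ i $ j)" for Q :: "real^'m::finite^'n::finite"
  by (simp add: vector_matrix_mult_def mult.commute)

lemma matrix_matrix_nth: "(X ** Y) $ i $ j = (\<Sum>k\<in>UNIV. X $ i $ k * Y $ k $ j)"
  by (simp add: matrix_matrix_mult_def)

lemma matrix_vector_nth: "(X *v y) $ i = (\<Sum>k\<in>UNIV. X $ i $ k * y $ k)"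
  by (simp add: matrix_vector_mult_def)

lemma vector_matrix_scaleR: "(c *\<^sub>R x) v* A = c *\<^sub>R (x v* A)" for A :: "real^'a::finite^'b::finite"
  by (simp add: vec_eq_iff vector_matrix_nth sum_distrib_left mult_ac)

lemma vector_matrix_add: "(x + y) v* A = x v* A + y v* A" for A :: "real^'a::finite^'b::finite"
  by (simp add: vec_eq_iff vector_matrix_nth sum.distrib algebra_simps)

lemma continuous_on_vector_matrix[continuous_intros]:
  fixes A :: "real^'a::finite^'b::finite"
  shows "continuous_on S f \<Longrightarrow> continuous_on S (\<lambda>y. f y v* A)"
  unfolding vector_matrix_mult_def by (intro continuous_intros continuous_on_vec_lambda)

lemma borel_measurable_nth[measurable]: "(\<lambda>y::real^'m::finite. y $ i) \<in> borel_measurable borel"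
  by (intro borel_measurable_continuous_onI continuous_intros)

lemma integrable_mult_bounded:
  fixes Z g :: "'a \<Rightarrow> real"
  assumes "integrable M Z" and [measurable]: "g \<in> borel_measurable M" and "AE \<omega> in M. \<bar>g \<omega>\<bar> \<le> B"
  shows "integrable M (\<lambda>\<omega>. Z \<omega> * g \<omega>)"
proof (rule Bochner_Integration.integrable_bound)
  show "integrable M (\<lambda>\<omega>. B * Z \<omega>)" using assms(1) by simp
  show "(\<lambda>\<omega>. Z \<omega> * g \<omega>) \<in> borel_measurable M" using assms(1) by measurable
  show "AE \<omega> in M. norm (Z \<omega> * g \<omega>) \<le> norm (B * Z \<omega>)"
    using assms(3)
  proof eventually_elim
    case (elim \<omega>)
    then have "\<bar>g \<omega>\<bar> * \<bar>Z \<omega>\<bar> \<le> \<bar>B\<bar> * \<bar>Z \<omega>\<bar>" by (intro mult_right_mono) auto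
    then show ?case by (simp add: abs_mult mult.commute)
  qed
qed

lemma simplex_nth_le1: "x \<in> prob_simplex \<Longrightarrow> x $ i \<le> 1"
  unfolding prob_simplex_def using member_le_sum[of i UNIV "\<lambda>i. x $ i"] by auto

lemma compact_prob_simplex: "compact (prob_simplex :: (real^'m::finite) set)"
proof -
  have "prob_simplex = (\<Inter>i. {x::real^'m. 0 \<le> x $ i}) \<inter> {x. (\<Sum>i\<in>UNIV. x $ i) = 1}"
    by (auto simp: prob_simplex_def)
  moreover have "closed ((\<Inter>i. {x::real^'m. 0 \<le> x $ i}) \<inter> {x. (\<Sum>i\<in>UNIV. x $ i) = 1})"
    by (intro closed_Int closed_INT ballI closed_Collect_le closed_Collect_eq continuous_intros)
  ultimately have "closed (prob_simplex :: (real^'m) set)" by simp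
  moreover have "(prob_simplex :: (real^'m) set) \<subseteq> cbox 0 1"
    by (auto simp: mem_box_cart simplex_nth_le1) (auto simp: prob_simplex_def)
  ultimately show ?thesis
    using bounded_cbox bounded_subset compact_eq_bounded_closed by blast
qed

lemma convex_prob_simplex: "convex (prob_simplex :: (real^'m::finite) set)"
  unfolding convex_def prob_simplex_def
  by (auto simp: sum.distrib sum_distrib_left[symmetric])

lemma axis_in_simplex: "axis i 1 \<in> (prob_simplex :: (real^'m::finite) set)"
  by (auto simp: prob_simplex_def axis_def)

text \<open>Brouwer's theorem on the simplex. Normalising \<open>x v* Q\<close> alone fails where
  that vector vanishes; adding \<open>x\<close> first keeps the denominator at least 1, and a fixed
  point of the modified map is still an eigenvector, with eigenvalue \<open>s x\<close>.\<close>

lemma nonneg_matrix_eigenvector: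
  fixes Q :: "real^'m::finite^'m"
  assumes nn: "\<And>i j. 0 \<le> Q $ i $ j"
  obtains x l where "x \<in> prob_simplex" "0 \<le> l" "x v* Q = l *\<^sub>R x"
proof -
  define s where "s = (\<lambda>x::real^'m. \<Sum>j\<in>UNIV. (x v* Q) $ j)"
  define f where "f = (\<lambda>x. (1 / (1 + s x)) *\<^sub>R (x + x v* Q))"
  have vnn: "0 \<le> (x v* Q) $ j" if "x \<in> prob_simplex" for x j
    using that nn by (auto simp: vector_matrix_nth prob_simplex_def intro!: sum_nonneg)
  have snn: "0 \<le> s x" if "x \<in> prob_simplex" for x
    using vnn[OF that] by (auto simp: s_def intro!: sum_nonneg)
  have "continuous_on prob_simplex f"
    unfolding f_def s_def vector_matrix_mult_def
    apply (intro continuous_intros continuous_on_vec_lambda)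
    using snn unfolding s_def vector_matrix_mult_def by (smt (verit, best))
  moreover have "f \<in> prob_simplex \<rightarrow> prob_simplex"
  proof
    fix x assume x: "x \<in> (prob_simplex :: (real^'m) set)"
    have "(\<Sum>i\<in>UNIV. f x $ i) = (1 / (1 + s x)) * (\<Sum>i\<in>UNIV. x $ i + (x v* Q) $ i)"
      by (simp add: f_def sum_distrib_left)
    also have "\<dots> = 1"
      using x snn[OF x] by (simp add: sum.distrib prob_simplex_def s_def)
    finally show "f x \<in> prob_simplex"
      using x snn[OF x] vnn[OF x] by (auto simp: prob_simplex_def f_def)
  qed
  moreover have "(prob_simplex :: (real^'m) set) \<noteq> {}"
    using axis_in_simplex by blast
  ultimately obtain x where x: "x \<in> prob_simplex" "f x = x"
    using brouwer[OF compact_prob_simplex convex_prob_simplex] by metis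
  have "x v* Q = s x *\<^sub>R x"
  proof -
    have "(1 + s x) *\<^sub>R x = x + x v* Q"
      using x(2) snn[OF x(1)] unfolding f_def
      by (metis (no_types, lifting) add_nonneg_pos div_by_1 divideR_right
          less_irrefl scaleR_one zero_less_one add.commute divide_inverse mult_1 scaleR_scaleR inverse_eq_divide)
    then show ?thesis by (simp add: scaleR_left_distrib)
  qed
  then show ?thesis using that x(1) snn by blast
qed

text \<open>The support of a nonnegative left (super-)eigenvector is closed under the transitions.\<close>

lemma irreducible_eigenvector_pos:
  fixes Q :: "real^'m::finite^'m"
  assumes nn: "\<And>i j. 0 \<le> Q $ i $ j" and irr: "irreducible_matrix Q"
    and x: "\<And>i. 0 \<le> x $ i" "x \<noteq> 0" and ev: "\<And>j. (x v* Q) $ j \<le> l * x $ j"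
  shows "0 < x $ i"
proof -
  obtain k where "x $ k \<noteq> 0" using x(2) by (metis vec_eq_iff zero_index)
  then have k: "0 < x $ k" using x(1)[of k] by simp
  have "(k, i) \<in> {(k, l). 0 < Q $ k $ l}\<^sup>*"
    using irr by (auto simp: irreducible_matrix_def)
  then show ?thesis
  proof (induction rule: rtrancl_induct)
    case base then show ?case by (rule k)
  next
    case (step y z)
    have "0 < x $ y * Q $ y $ z" using step by simp
    also have "\<dots> \<le> (x v* Q) $ z"
      unfolding vector_matrix_nth using nn x by (intro member_le_sum) auto
    also have "\<dots> \<le> l * x $ z" by (rule ev)
    finally show ?case using x(1)[of z] by (metis less_eq_real_def mult_zero_right less_irrefl)
  qed
qed

lemma irreducible_transpose:
  assumes "irreducible_matrix Q" shows "irreducible_matrix (transpose Q)"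
proof -
  have "{(k, l). 0 < transpose Q $ k $ l} = {(k, l). 0 < Q $ k $ l}\<inverse>"
    by (auto simp: transpose_def)
  then show ?thesis using assms by (auto simp: irreducible_matrix_def rtrancl_converse)
qed

text \<open>Subtracting the largest admissible multiple of \<open>y\<close> from \<open>x\<close> leaves a nonnegative eigenvector with a
  zero entry.\<close>

lemma irreducible_eigenvector_unique:
  fixes Q :: "real^'m::finite^'m"
  assumes nn: "\<And>i j. 0 \<le> Q $ i $ j" and irr: "irreducible_matrix Q"
    and y: "\<And>i. 0 < y $ i" "y v* Q = l *\<^sub>R y" and x: "x v* Q = l *\<^sub>R x"
  shows "\<exists>c. x = c *\<^sub>R y"
proof -
  define c where "c = Min (range (\<lambda>i. x $ i / y $ i))"
  have le: "c \<le> x $ i / y $ i" for i unfolding c_def by (intro Min_le) auto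
  have "c \<in> range (\<lambda>i. x $ i / y $ i)" unfolding c_def by (intro Min_in) auto
  then obtain k where k: "c = x $ k / y $ k" by auto
  define z where "z = x - c *\<^sub>R y"
  have z: "0 \<le> z $ i" for i using le[of i] y(1)[of i] by (simp add: z_def field_simps)
  have zk: "z $ k = 0" using k y(1)[of k] by (simp add: z_def)
  have "z v* Q = l *\<^sub>R z"
  proof -
    have "z v* Q = x v* Q - c *\<^sub>R (y v* Q)"
      by (simp add: z_def vec_eq_iff vector_matrix_nth sum_subtractf sum_distrib_left algebra_simps)
    then show ?thesis using x y(2) by (simp add: z_def algebra_simps)
  qed
  then have "(z v* Q) $ j \<le> l * z $ j" for j by simp
  from irreducible_eigenvector_pos[OF nn irr z _ this, of k] zk have "z = 0" by auto
  then show ?thesis by (auto simp: z_def)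
qed


section \<open>Perron data of the chain, powers of \<open>Q\<close> and the potential matrix\<close>

primrec matrix_power :: "real^'m::finite^'m \<Rightarrow> nat \<Rightarrow> real^'m^'m" where
  "matrix_power Q 0 = mat 1"
| "matrix_power Q (Suc k) = matrix_power Q k ** Q"

lemma mat_1_nonneg: "0 \<le> (mat 1 :: real^'m::finite^'m) $ i $ j"
  by (simp add: mat_def)

text \<open>The normalisation \<open>w \<bullet> qsd = 1\<close> turns
  \<open>w $ i * qsd $ i\<close> into probability weights. The eigenvalue \<open>l\<close> is 0 when
  the only transient state is left at once, so estimates are arranged without dividing by
  \<open>l\<close>.\<close>

locale perron_chain =
  fixes P :: "real^'s::finite^'s" and T :: "'s set" and idx :: "'m::finite \<Rightarrow> 's"
    and Q :: "real^'m^'m" and w qsd :: "real^'m" and l :: real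
  assumes chain: "irreducible_absorbing_chain P T idx"
    and Q_eq: "Q = restrict_matrix P idx"
    and w_pos: "\<And>i. 0 < w $ i" and w_eigen: "Q *v w = l *\<^sub>R w"
    and qsd_pos: "\<And>i. 0 < qsd $ i" and qsd_eigen: "qsd v* Q = l *\<^sub>R qsd"
    and qsd_sum: "(\<Sum>i\<in>UNIV. qsd $ i) = 1" and w_qsd: "w \<bullet> qsd = 1"
    and l_nn: "0 \<le> l" and l_less1: "l < 1"

lemma chain_nonneg:
  assumes "irreducible_absorbing_chain P T idx"
  shows "0 \<le> restrict_matrix P idx $ i $ j"
  using assms by (simp add: irreducible_absorbing_chain_def stochastic_matrix_def restrict_matrix_def)

lemma chain_row_le1:
  assumes "irreducible_absorbing_chain P T idx"
  shows "(\<Sum>j\<in>UNIV. restrict_matrix P idx $ i $ j) \<le> 1"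
proof -
  have bij: "bij_betw idx UNIV T" and st: "stochastic_matrix P"
    using assms by (auto simp: irreducible_absorbing_chain_def)
  have "(\<Sum>j\<in>UNIV. restrict_matrix P idx $ i $ j) = (\<Sum>y\<in>T. P $ idx i $ y)"
    unfolding restrict_matrix_def by (simp add: sum.reindex_bij_betw[OF bij])
  also have "\<dots> \<le> (\<Sum>y\<in>UNIV. P $ idx i $ y)"
    using st by (intro sum_mono2) (auto simp: stochastic_matrix_def)
  also have "\<dots> = 1" using st by (auto simp: stochastic_matrix_def)
  finally show ?thesis .
qed

text \<open>The left and right eigenvalues agree because pairing the two positive eigenvectors
  through \<open>Q\<close> gives \<open>l * (x \<bullet> y) = l' * (x \<bullet> y)\<close>. The
  bound \<open>l < 1\<close> holds because \<open>l\<close> is the average of the row sums of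
  \<open>Q\<close> under the positive weights \<open>x\<close>, and one row sum is below 1.\<close>

lemma perron_chain_exists:
  fixes P :: "real^'s::finite^'s" and idx :: "'m::finite \<Rightarrow> 's"
  assumes ch: "irreducible_absorbing_chain P T idx"
  defines "Q \<equiv> restrict_matrix P idx"
  obtains w qsd l where "perron_chain P T idx Q w qsd l"
proof -
  have nn: "0 \<le> Q $ i $ j" for i j unfolding Q_def by (rule chain_nonneg[OF ch])
  have irr: "irreducible_matrix Q" using ch by (auto simp: Q_def irreducible_absorbing_chain_def)
  obtain x l where x: "x \<in> prob_simplex" "0 \<le> l" "x v* Q = l *\<^sub>R x"
    using nonneg_matrix_eigenvector[of Q] nn by blast
  have x0: "x \<noteq> 0" "\<And>i. 0 \<le> x $ i" "(\<Sum>i\<in>UNIV. x $ i) = 1"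
    using x(1) by (auto simp: prob_simplex_def)
  have xpos: "0 < x $ i" for i
    using irreducible_eigenvector_pos[OF nn irr x0(2,1), of l] x(3) by simp
  have nnt: "0 \<le> transpose Q $ i $ j" for i j using nn by (simp add: transpose_def)
  obtain y l' where y: "y \<in> prob_simplex" "0 \<le> l'" "y v* transpose Q = l' *\<^sub>R y"
    using nonneg_matrix_eigenvector[of "transpose Q"] nnt by blast
  have y0: "y \<noteq> 0" "\<And>i. 0 \<le> y $ i" using y(1) by (auto simp: prob_simplex_def)
  have ypos: "0 < y $ i" for i
    using irreducible_eigenvector_pos[OF nnt irreducible_transpose[OF irr] y0(2,1), of l'] y(3) by simp
  have yQ: "Q *v y = l' *\<^sub>R y" using y(3) by simp
  have xy: "0 < x \<bullet> y"
    using xpos ypos by (auto simp: inner_vec_def intro!: sum_pos)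
  have "l * (x \<bullet> y) = (x v* Q) \<bullet> y" using x(3) by simp
  also have "\<dots> = x \<bullet> (Q *v y)"
    by (simp add: dot_lmul_matrix)
  also have "\<dots> = l' * (x \<bullet> y)" using yQ by simp
  finally have ll: "l' = l" using xy by simp
  have "l = (\<Sum>j\<in>UNIV. (x v* Q) $ j)" using x(3) x0(3) by (simp add: sum_distrib_left[symmetric])
  also have "\<dots> = (\<Sum>i\<in>UNIV. x $ i * (\<Sum>j\<in>UNIV. Q $ i $ j))"
    unfolding vector_matrix_nth by (subst sum.swap) (simp add: sum_distrib_left)
  also have "\<dots> < (\<Sum>i\<in>UNIV. x $ i)"
  proof (rule sum_strict_mono_ex1)
    show "\<forall>i\<in>UNIV. x $ i * (\<Sum>j\<in>UNIV. Q $ i $ j) \<le> x $ i"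
      using chain_row_le1[OF ch] xpos by (auto simp: Q_def mult_left_le less_imp_le)
    obtain i where "(\<Sum>j\<in>UNIV. Q $ i $ j) < 1"
      using ch by (auto simp: Q_def irreducible_absorbing_chain_def)
    then show "\<exists>i\<in>UNIV. x $ i * (\<Sum>j\<in>UNIV. Q $ i $ j) < x $ i"
      using xpos[of i] by (intro bexI[of _ i]) auto
  qed simp
  finally have l1: "l < 1" using x0(3) by simp
  have "perron_chain P T idx Q ((1 / (x \<bullet> y)) *\<^sub>R y) x l"
    using ch xpos ypos x yQ ll l1 x0(3) xy
    by unfold_locales
      (auto simp: Q_def inner_commute matrix_vector_mult_scaleR mult.commute)
  then show ?thesis by (rule that)
qed

context perron_chain
begin

lemma Q_nn: "0 \<le> Q $ i $ j" unfolding Q_eq by (rule chain_nonneg[OF chain])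

lemma Q_irr: "irreducible_matrix Q" using chain Q_eq by (auto simp: irreducible_absorbing_chain_def)

lemma qsd_simplex: "qsd \<in> prob_simplex"
  using qsd_pos qsd_sum by (auto simp: prob_simplex_def less_imp_le)

lemma quasi_stationary_qsd: "quasi_stationary Q qsd"
  using qsd_eigen qsd_sum qsd_pos by (auto simp: quasi_stationary_def less_imp_le)

text \<open>The eigenvalue in \<open>quasi_stationary\<close> is arbitrary, so pairing with
  \<open>w\<close> identifies it with \<open>l\<close> before uniqueness up to scaling applies; the
  coordinate sum then fixes the scale.\<close>

lemma quasi_stationary_unique:
  assumes "quasi_stationary Q m" shows "m = qsd"
proof -
  obtain k where k: "m v* Q = k *\<^sub>R m" and s: "(\<Sum>i\<in>UNIV. m $ i) = 1" and nn: "\<And>i. 0 \<le> m $ i"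
    using assms by (auto simp: quasi_stationary_def)
  have m0: "m \<noteq> 0" using s by auto
  have pos: "0 < m $ i" for i
    using irreducible_eigenvector_pos[OF Q_nn Q_irr nn m0, of k] k by simp
  have mw: "0 < m \<bullet> w"
    using pos w_pos by (auto simp: inner_vec_def intro!: sum_pos)
  have "k * (m \<bullet> w) = (m v* Q) \<bullet> w" using k by simp
  also have "\<dots> = m \<bullet> (Q *v w)"
    by (simp add: dot_lmul_matrix)
  also have "\<dots> = l * (m \<bullet> w)" using w_eigen by simp
  finally have "k = l" using mw by simp
  with k have "m v* Q = l *\<^sub>R m" by simp
  from irreducible_eigenvector_unique[OF Q_nn Q_irr qsd_pos qsd_eigen this]
  obtain c where c: "m = c *\<^sub>R qsd" by blast
  then have "c = 1" using s qsd_sum by (simp add: sum_distrib_left[symmetric])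
  then show ?thesis using c by simp
qed

abbreviation Qk where "Qk \<equiv> matrix_power Q"

lemma Qk_nn: "0 \<le> Qk k $ i $ j"
  by (induction k arbitrary: i j) (auto simp: mat_def matrix_matrix_nth Q_nn intro!: sum_nonneg)

lemma Qk_w: "Qk k *v w = l ^ k *\<^sub>R w"
  by (induction k) (auto simp: matrix_vector_mul_assoc[symmetric] w_eigen matrix_vector_mult_scaleR)

lemma qsd_Qk: "qsd v* Qk k = l ^ k *\<^sub>R qsd"
proof (induction k)
  case (Suc k)
  have "qsd v* Qk (Suc k) = (qsd v* Qk k) v* Q" by (simp add: vector_matrix_mul_assoc)
  then show ?case using Suc by (simp add: scaleR_vector_matrix_assoc qsd_eigen)
qed simp

text \<open>A crude common bound for all ratios \<open>w $ i / w $ j\<close>.\<close>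

definition spread :: real where "spread = (\<Sum>i\<in>UNIV. w $ i) * (\<Sum>i\<in>UNIV. 1 / w $ i)"

lemma spread_nn: "0 \<le> spread"
  unfolding spread_def using w_pos by (auto intro!: mult_nonneg_nonneg sum_nonneg simp: less_imp_le)

text \<open>A single entry times \<open>w $ j\<close> is at most the whole row sum against
  \<open>w\<close>, which equals \<open>l ^ k * w $ i\<close>. The positive right eigenvector thus
  gives geometric decay at the exact rate \<open>l\<close>.\<close>

lemma Qk_bound: "Qk k $ i $ j \<le> spread * l ^ k"
proof -
  have "Qk k $ i $ j * w $ j \<le> (Qk k *v w) $ i"
    unfolding matrix_vector_nth using Qk_nn w_pos by (intro member_le_sum) (auto simp: less_imp_le)
  also have "\<dots> = l ^ k * w $ i" by (simp add: Qk_w)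
  finally have "Qk k $ i $ j \<le> l ^ k * (w $ i * (1 / w $ j))"
    using w_pos[of j] by (simp add: field_simps)
  also have "\<dots> \<le> l ^ k * spread"
    unfolding spread_def using w_pos l_nn
    by (intro mult_left_mono mult_mono member_le_sum) (auto simp: less_imp_le intro!: sum_nonneg)
  finally show ?thesis by (simp add: mult.commute)
qed

text \<open>Written as a Neumann series because this is how expected visit counts arise: entry
  \<open>i j\<close> sums over time the probability of being in state \<open>j\<close> when the run
  starts in \<open>i\<close>.\<close>

definition R :: "real^'m^'m" where "R = (\<chi> i j. \<Sum>k. Qk k $ i $ j)"

lemma Qk_summable: "summable (\<lambda>k. Qk k $ i $ j)"
proof (rule summable_comparison_test)
  show "\<exists>N. \<forall>n\<ge>N. norm (Qk n $ i $ j) \<le> spread * l ^ n"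
    using Qk_nn Qk_bound by simp
  show "summable (\<lambda>k. spread * l ^ k)"
    using l_nn l_less1 by (intro summable_mult summable_geometric) simp
qed

lemma R_sums: "(\<lambda>k. Qk k $ i $ j) sums (R $ i $ j)"
  unfolding R_def using Qk_summable by (simp add: summable_sums)

lemma R_partial_le: "(\<Sum>k<K. Qk k $ i $ j) \<le> R $ i $ j"
  unfolding R_def by (simp add: sum_le_suminf Qk_summable Qk_nn)

lemma Qk_le_R: "Qk k $ i $ j \<le> R $ i $ j"
  using R_partial_le[of i j "Suc k"] sum_nonneg[of "{..<k}" "\<lambda>k. Qk k $ i $ j"] Qk_nn by simp

text \<open>Irreducibility makes some power of \<open>Q\<close> positive at each entry; the power
  may vary with the entry, which is why the sum over all powers is positive even for a periodic
  chain. The power 0 covers the diagonal.\<close>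

lemma R_pos: "0 < R $ i $ j"
proof -
  have "(i, j) \<in> {(k, l). 0 < Q $ k $ l}\<^sup>*"
    using Q_irr by (auto simp: irreducible_matrix_def)
  then have "\<exists>k. 0 < Qk k $ i $ j"
  proof (induction rule: rtrancl_induct)
    case base
    have "0 < Qk 0 $ i $ i" by (simp add: mat_def)
    then show ?case by blast
  next
    case (step y z)
    then obtain k where k: "0 < Qk k $ i $ y" by blast
    then have "0 < Qk k $ i $ y * Q $ y $ z" using step by simp
    also have "\<dots> \<le> Qk (Suc k) $ i $ z"
      using Qk_nn Q_nn by (auto simp: matrix_matrix_nth intro!: member_le_sum)
    finally show ?case by blast
  qed
  then show ?thesis using Qk_le_R less_le_trans by blast
qed

text \<open>The Perron eigenvalue of \<open>R\<close>, which is also the mean run length when the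
  initial law is \<open>qsd\<close>.\<close>

definition \<theta> :: real where "\<theta> = 1 / (1 - l)"

lemma \<theta>_pos: "0 < \<theta>" unfolding \<theta>_def using l_less1 by simp

lemma geometric_l_sums: "(\<lambda>k. l ^ k) sums \<theta>"
  unfolding \<theta>_def using l_nn l_less1 by (intro geometric_sums) simp

lemma R_left_sums: "(\<lambda>k. (x v* Qk k) $ j) sums ((x v* R) $ j)"
  unfolding vector_matrix_nth by (intro sums_sum sums_mult R_sums)

lemma qsd_R: "qsd v* R = \<theta> *\<^sub>R qsd"
proof (simp add: vec_eq_iff, rule allI)
  fix j
  have "(\<lambda>k. l ^ k * qsd $ j) sums ((qsd v* R) $ j)"
    using R_left_sums[of qsd j] by (simp add: qsd_Qk)
  moreover have "(\<lambda>k. l ^ k * qsd $ j) sums (\<theta> * qsd $ j)"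
    by (intro sums_mult2 geometric_l_sums)
  ultimately show "(qsd v* R) $ j = \<theta> * qsd $ j" by (rule sums_unique2)
qed

lemma R_w: "R *v w = \<theta> *\<^sub>R w"
proof (simp add: vec_eq_iff, rule allI)
  fix j
  have "(\<lambda>k. (Qk k *v w) $ j) sums ((R *v w) $ j)"
    unfolding matrix_vector_nth by (intro sums_sum sums_mult2 R_sums)
  then have "(\<lambda>k. l ^ k * w $ j) sums ((R *v w) $ j)" by (simp add: Qk_w)
  moreover have "(\<lambda>k. l ^ k * w $ j) sums (\<theta> * w $ j)"
    by (intro sums_mult2 geometric_l_sums)
  ultimately show "(R *v w) $ j = \<theta> * w $ j" by (rule sums_unique2)
qed

text \<open>The conditional second moments of the visit counts, given the starting state, as limits of
  the moments of the counts up to time \<open>K\<close>.\<close>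

definition visits_cov_upto :: "nat \<Rightarrow> 'm \<Rightarrow> 'm \<Rightarrow> 'm \<Rightarrow> real" where
  "visits_cov_upto K m i j = (\<Sum>a<K. \<Sum>b<K.
     if a \<le> b then Qk a $ m $ i * Qk (b - a) $ i $ j else Qk b $ m $ j * Qk (a - b) $ j $ i)"

lemma shifted_partial_le: "(\<Sum>b<K. if a \<le> b then Qk (b - a) $ i $ j else 0) \<le> R $ i $ j"
proof -
  have "(\<Sum>b<K. if a \<le> b then Qk (b - a) $ i $ j else 0) = (\<Sum>b\<in>{a..<K}. Qk (b - a) $ i $ j)"
    by (rule sum.mono_neutral_cong_right) auto
  also have "\<dots> = (\<Sum>d<K-a. Qk d $ i $ j)"
    by (subst sum.atLeastLessThan_shift_0) (simp add: lessThan_atLeast0)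
  finally show ?thesis using R_partial_le by simp
qed

lemma ordered_pairs_le:
  "(\<Sum>a<K. \<Sum>b<K. if a \<le> b then Qk a $ m $ i * Qk (b - a) $ i $ j else 0) \<le> R $ m $ i * R $ i $ j"
proof -
  have "(\<Sum>a<K. \<Sum>b<K. if a \<le> b then Qk a $ m $ i * Qk (b - a) $ i $ j else 0)
      = (\<Sum>a<K. Qk a $ m $ i * (\<Sum>b<K. if a \<le> b then Qk (b - a) $ i $ j else 0))"
    by (simp add: sum_distrib_left if_distrib cong: if_cong)
  also have "\<dots> \<le> (\<Sum>a<K. Qk a $ m $ i * R $ i $ j)"
    by (intro sum_mono mult_left_mono shifted_partial_le Qk_nn)
  also have "\<dots> = (\<Sum>a<K. Qk a $ m $ i) * R $ i $ j" by (simp add: sum_distrib_right)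
  also have "\<dots> \<le> R $ m $ i * R $ i $ j"
    by (intro mult_right_mono R_partial_le less_imp_le[OF R_pos])
  finally show ?thesis .
qed

lemma visits_cov_upto_le: "visits_cov_upto K m i j \<le> R $ m $ i * R $ i $ j + R $ m $ j * R $ j $ i"
proof -
  \<comment> \<open>The diagonal \<open>a = b\<close> is counted in both ordered sums, which is
    harmless for an upper bound.\<close>
  have "visits_cov_upto K m i j \<le>
     (\<Sum>a<K. \<Sum>b<K. (if a \<le> b then Qk a $ m $ i * Qk (b - a) $ i $ j else 0)
        + (if b \<le> a then Qk b $ m $ j * Qk (a - b) $ j $ i else 0))"
    unfolding visits_cov_upto_def by (intro sum_mono) (auto simp: Qk_nn mat_1_nonneg)
  also have "\<dots> = (\<Sum>a<K. \<Sum>b<K. if a \<le> b then Qk a $ m $ i * Qk (b - a) $ i $ j else 0)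
     + (\<Sum>b<K. \<Sum>a<K. if b \<le> a then Qk b $ m $ j * Qk (a - b) $ j $ i else 0)"
    by (subst (3) sum.swap) (simp add: sum.distrib)
  also have "\<dots> \<le> R $ m $ i * R $ i $ j + R $ m $ j * R $ j $ i"
    by (intro add_mono ordered_pairs_le)
  finally show ?thesis .
qed

definition visits_cov :: "'m \<Rightarrow> 'm \<Rightarrow> 'm \<Rightarrow> real" where
  "visits_cov m i j = lim (\<lambda>K. visits_cov_upto K m i j)"

lemma visits_cov_limit: "(\<lambda>K. visits_cov_upto K m i j) \<longlonglongrightarrow> visits_cov m i j"
proof -
  have "incseq (\<lambda>K. visits_cov_upto K m i j)"
    unfolding visits_cov_upto_def
    by (intro incseq_SucI order_trans[OF sum_mono sum_mono2[of "{..<Suc _}"]] sum_mono2)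
       (auto intro!: sum_nonneg add_nonneg_nonneg mult_nonneg_nonneg Qk_nn mat_1_nonneg)
  then have "convergent (\<lambda>K. visits_cov_upto K m i j)"
    using visits_cov_upto_le incseq_convergent[of "\<lambda>K. visits_cov_upto K m i j"]
    by (metis convergentI)
  then show ?thesis unfolding visits_cov_def by (simp add: convergent_LIMSEQ_iff)
qed

end


section \<open>A Lyapunov function for the mean drift\<close>

lemma simplex_nonneg: "x \<in> prob_simplex \<Longrightarrow> 0 \<le> x $ i"
  and simplex_sum: "x \<in> prob_simplex \<Longrightarrow> (\<Sum>i\<in>UNIV. x $ i) = 1"
  by (auto simp: prob_simplex_def)

lemma simplex_norm_le1: "x \<in> prob_simplex \<Longrightarrow> norm x \<le> 1"
  using norm_le_l1_cart[of x] by (simp add: simplex_nonneg simplex_sum)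

text \<open>To be read with \<open>v\<close> the vector of visit counts, whose coordinate sum is the
  run length: the update direction is at most twice as long as the run.\<close>

lemma visits_norm_le:
  assumes "x \<in> prob_simplex" "\<And>i. 0 \<le> v $ i"
  shows "norm (v - (\<Sum>i\<in>UNIV. v $ i) *\<^sub>R x) \<le> 2 * (\<Sum>i\<in>UNIV. v $ i)"
proof -
  have "norm v \<le> (\<Sum>i\<in>UNIV. v $ i)" using norm_le_l1_cart[of v] assms(2) by simp
  moreover have "norm ((\<Sum>i\<in>UNIV. v $ i) *\<^sub>R x) \<le> (\<Sum>i\<in>UNIV. v $ i) * 1"
    using simplex_norm_le1[OF assms(1)] assms(2)
    by (simp add: sum_nonneg mult_left_le)
  ultimately show ?thesis using norm_triangle_ineq4[of v "(\<Sum>i\<in>UNIV. v $ i) *\<^sub>R x"] by simp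
qed

text \<open>The noise is multiplicative near the boundary, so only exceptionally long runs can push an
  iterate out of the simplex.\<close>

lemma short_run_stays_in_simplex:
  assumes x: "x \<in> prob_simplex" and v: "\<And>i. 0 \<le> v $ i" and e: "0 \<le> \<epsilon>" "\<epsilon> * (\<Sum>i\<in>UNIV. v $ i) \<le> 1"
  shows "x + \<epsilon> *\<^sub>R (v - (\<Sum>i\<in>UNIV. v $ i) *\<^sub>R x) \<in> prob_simplex"
proof -
  define \<tau> where "\<tau> = (\<Sum>i\<in>UNIV. v $ i)"
  have "0 \<le> x $ i + \<epsilon> * (v $ i - \<tau> * x $ i)" for i
  proof -
    have "0 \<le> (1 - \<epsilon> * \<tau>) * x $ i + \<epsilon> * v $ i"
      using e v[of i] simplex_nonneg[OF x, of i] by (auto simp: \<tau>_def)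
    then show ?thesis by (simp add: algebra_simps)
  qed
  moreover have "(\<Sum>i\<in>UNIV. x $ i + \<epsilon> * (v $ i - \<tau> * x $ i)) = 1"
    by (simp add: sum.distrib sum_subtractf simplex_sum[OF x] flip: sum_distrib_left \<tau>_def)
  ultimately show ?thesis by (simp add: prob_simplex_def \<tau>_def)
qed

section \<open>The Lyapunov function and its change in one step\<close>

context perron_chain
begin

text \<open>The inner product of \<open>x / qsd\<close> and \<open>y / qsd\<close> under the weights
  \<open>w $ i * qsd $ i\<close>.\<close>

definition wform :: "real^'m \<Rightarrow> real^'m \<Rightarrow> real" where
  "wform x y = (\<Sum>i\<in>UNIV. w $ i * x $ i * y $ i / qsd $ i)"

definition lyap :: "real^'m \<Rightarrow> real" where "lyap x = wform x x / (w \<bullet> x)\<^sup>2"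

text \<open>The derivative of \<open>lyap\<close> at \<open>x\<close> in direction \<open>y\<close>,
  after replacing \<open>wform x x\<close> by \<open>lyap x * (w \<bullet> x)\<^sup>2\<close> in the
  quotient rule.\<close>

definition lyap_deriv :: "real^'m \<Rightarrow> real^'m \<Rightarrow> real" where
  "lyap_deriv x y = 2 * (wform x y - lyap x * (w \<bullet> x) * (w \<bullet> y)) / (w \<bullet> x)\<^sup>2"

definition drift :: "real^'m \<Rightarrow> real^'m" where
  "drift x = x v* R - (\<Sum>i\<in>UNIV. (x v* R) $ i) *\<^sub>R x"

lemma wform_add: "wform x (y + z) = wform x y + wform x z"
  and wform_diff: "wform x (y - z) = wform x y - wform x z"
  and wform_scale: "wform x (c *\<^sub>R y) = c * wform x y"
  and wform_commute: "wform x y = wform y x"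
  by (simp_all add: wform_def sum.distrib sum_subtractf sum_distrib_left add_divide_distrib
      diff_divide_distrib algebra_simps)

definition wform_bound :: real where "wform_bound = (\<Sum>i\<in>UNIV. w $ i / qsd $ i)"

lemma wform_bound_nn: "0 \<le> wform_bound"
  unfolding wform_bound_def using w_pos qsd_pos by (auto intro!: sum_nonneg simp: less_imp_le)

lemma wform_le: "\<bar>wform x y\<bar> \<le> wform_bound * (norm x * norm y)"
proof -
  have "\<bar>wform x y\<bar> \<le> (\<Sum>i\<in>UNIV. \<bar>w $ i * x $ i * y $ i / qsd $ i\<bar>)"
    unfolding wform_def by (rule sum_abs)
  also have "\<dots> \<le> (\<Sum>i\<in>UNIV. w $ i / qsd $ i * (norm x * norm y))"
  proof (rule sum_mono)
    fix i
    have "\<bar>w $ i * x $ i * y $ i / qsd $ i\<bar> = w $ i / qsd $ i * (\<bar>x $ i\<bar> * \<bar>y $ i\<bar>)"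
      using w_pos[of i] qsd_pos[of i] by (simp add: abs_mult)
    also have "\<dots> \<le> w $ i / qsd $ i * (norm x * norm y)"
      using w_pos[of i] qsd_pos[of i]
      by (intro mult_left_mono mult_mono component_le_norm_cart) auto
    finally show "\<bar>w $ i * x $ i * y $ i / qsd $ i\<bar> \<le> w $ i / qsd $ i * (norm x * norm y)" .
  qed
  finally show ?thesis by (simp add: wform_bound_def sum_distrib_right)
qed

lemma wform_nn: "0 \<le> wform x x"
  unfolding wform_def using w_pos qsd_pos
  by (intro sum_nonneg) (auto simp: less_imp_le mult.assoc)

definition w_min :: real where "w_min = Min (range (\<lambda>i. w $ i))"

lemma w_min_pos: "0 < w_min"
  unfolding w_min_def using w_pos by (subst Min_gr_iff) auto

lemma w_min_le: "x \<in> prob_simplex \<Longrightarrow> w_min \<le> w \<bullet> x"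
proof -
  assume x: "x \<in> prob_simplex"
  have "w_min = (\<Sum>i\<in>UNIV. w_min * x $ i)" using simplex_sum[OF x] by (simp flip: sum_distrib_left)
  also have "\<dots> \<le> (\<Sum>i\<in>UNIV. w $ i * x $ i)"
    unfolding w_min_def by (intro sum_mono mult_right_mono simplex_nonneg[OF x] Min_le) auto
  finally show ?thesis by (simp add: inner_vec_def)
qed

lemma w_le_norm: "x \<in> prob_simplex \<Longrightarrow> w \<bullet> x \<le> norm w"
  using norm_cauchy_schwarz[of w x] simplex_norm_le1[of x]
  by (meson mult_left_le norm_ge_zero order_trans)

definition lyap_bound :: real where "lyap_bound = wform_bound / w_min\<^sup>2"

lemma lyap_le: assumes x: "x \<in> prob_simplex" shows "lyap x \<le> lyap_bound"
proof -
  have "wform x x \<le> wform_bound * (norm x * norm x)" using wform_le[of x x] by simp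
  also have "\<dots> \<le> wform_bound * 1"
    using simplex_norm_le1[OF x] by (intro mult_left_mono wform_bound_nn) (simp add: mult_le_one)
  finally show ?thesis unfolding lyap_def lyap_bound_def
    using w_min_pos w_min_le[OF x] wform_bound_nn by (intro frac_le power_mono) auto
qed

lemma lyap_nn: "0 \<le> lyap x" unfolding lyap_def using wform_nn by simp

definition lyap_deriv_bound :: real where
  "lyap_deriv_bound = 2 * (wform_bound + lyap_bound * norm w * norm w) / w_min\<^sup>2"

lemma lyap_deriv_le:
  assumes x: "x \<in> prob_simplex" shows "\<bar>lyap_deriv x y\<bar> \<le> lyap_deriv_bound * norm y"
proof -
  have sx: "0 < w \<bullet> x" "w_min \<le> w \<bullet> x" "w \<bullet> x \<le> norm w"
    using w_min_pos w_min_le[OF x] w_le_norm[OF x] by auto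
  have "\<bar>wform x y\<bar> \<le> wform_bound * norm y"
    using wform_le[of x y] simplex_norm_le1[OF x] wform_bound_nn
    by (smt (verit, best) mult_left_mono mult_right_mono mult_left_le_one_le norm_ge_zero)
  moreover have "\<bar>lyap x * (w \<bullet> x) * (w \<bullet> y)\<bar> \<le> lyap_bound * norm w * (norm w * norm y)"
    unfolding abs_mult using lyap_le[OF x] lyap_nn[of x] sx Cauchy_Schwarz_ineq2[of w y]
    by (intro mult_mono) auto
  ultimately have "\<bar>2 * (wform x y - lyap x * (w \<bullet> x) * (w \<bullet> y))\<bar>
      \<le> 2 * (wform_bound + lyap_bound * norm w * norm w) * norm y"
    by (simp add: algebra_simps)
  moreover have "w_min\<^sup>2 \<le> (w \<bullet> x)\<^sup>2" using sx w_min_pos by (intro power_mono) auto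
  ultimately have "\<bar>2 * (wform x y - lyap x * (w \<bullet> x) * (w \<bullet> y))\<bar> / (w \<bullet> x)\<^sup>2
     \<le> (2 * (wform_bound + lyap_bound * norm w * norm w) * norm y) / w_min\<^sup>2"
    using w_min_pos by (intro frac_le) auto
  then show ?thesis unfolding lyap_deriv_def lyap_deriv_bound_def by simp
qed

lemma lyap_deriv_bound_nn: "0 \<le> lyap_deriv_bound"
  unfolding lyap_deriv_bound_def lyap_bound_def using wform_bound_nn by (auto intro!: divide_nonneg_nonneg)

definition lyap_hess_bound :: real where
  "lyap_hess_bound = (wform_bound + norm w * (2 * norm w) * lyap_deriv_bound) / w_min\<^sup>2"

lemma lyap_hess_bound_nn: "0 \<le> lyap_hess_bound"
  unfolding lyap_hess_bound_def using lyap_deriv_bound_nn wform_bound_nn by auto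

text \<open>A quotient of two quadratic functions has an exact remainder with denominator
  \<open>(w \<bullet> (x + d))\<^sup>2\<close>. As both end points lie in the simplex, this
  denominator is at least \<open>w_min\<^sup>2\<close>, and the constant is uniform.\<close>

lemma lyap_taylor:
  assumes x: "x \<in> prob_simplex" and z: "x + d \<in> prob_simplex"
  shows "lyap (x + d) \<le> lyap x + lyap_deriv x d + lyap_hess_bound * (norm d)\<^sup>2"
proof -
  define s \<eta> L where "s = w \<bullet> x" and "\<eta> = w \<bullet> d" and "L = lyap_deriv x d"
  have s: "0 < s" "s \<le> norm w" using w_min_pos w_min_le[OF x] w_le_norm[OF x] by (auto simp: s_def)
  have se: "w_min \<le> s + \<eta>" "s + \<eta> \<le> norm w" "0 < s + \<eta>"
    using w_min_pos w_min_le[OF z] w_le_norm[OF z] by (auto simp: s_def \<eta>_def inner_add_right)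
  have a: "wform x x = lyap x * s\<^sup>2" using s by (simp add: lyap_def s_def)
  have b: "2 * wform x d = s\<^sup>2 * L + 2 * lyap x * s * \<eta>"
    using s unfolding L_def lyap_deriv_def by (simp add: field_simps flip: s_def \<eta>_def)
  have "lyap (x + d) = (lyap x * s\<^sup>2 + (s\<^sup>2 * L + 2 * lyap x * s * \<eta>) + wform d d) / (s + \<eta>)\<^sup>2"
    unfolding a[symmetric] b[symmetric] lyap_def[of "x+d"]
    by (simp add: wform_add wform_commute[of "x+d"] inner_add_right s_def \<eta>_def wform_commute[of d x])
  also have "\<dots> = lyap x + L + (wform d d - lyap x * \<eta>\<^sup>2 - \<eta> * (2 * s + \<eta>) * L) / (s + \<eta>)\<^sup>2"
  proof -
    \<comment> \<open>Subtracting \<open>(lyap x + L) * (s + \<eta>)\<^sup>2\<close> removes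
      everything of order 0 and 1 in \<open>d\<close>.\<close>
    have num: "lyap x * s\<^sup>2 + (s\<^sup>2 * L + 2 * lyap x * s * \<eta>) + wform d d
       = (lyap x + L) * (s + \<eta>)\<^sup>2 + (wform d d - lyap x * \<eta>\<^sup>2 - \<eta> * (2 * s + \<eta>) * L)"
      by (simp add: algebra_simps power2_eq_square)
    show ?thesis unfolding num add_divide_distrib using se by simp
  qed
  also have "\<dots> \<le> lyap x + L + ((wform_bound + norm w * (2 * norm w) * lyap_deriv_bound) * (norm d)\<^sup>2) / w_min\<^sup>2"
  proof -
    have "\<bar>\<eta> * (2 * s + \<eta>) * L\<bar> \<le> (norm w * norm d) * (2 * norm w) * (lyap_deriv_bound * norm d)"
      unfolding abs_mult L_def \<eta>_def
      using Cauchy_Schwarz_ineq2[of w d] lyap_deriv_le[OF x, of d] s se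
      by (intro mult_mono) (auto simp: \<eta>_def)
    moreover have "wform d d \<le> wform_bound * (norm d)\<^sup>2"
      using wform_le[of d d] by (simp add: power2_eq_square)
    moreover have "0 \<le> lyap x * \<eta>\<^sup>2" by (simp add: lyap_nn)
    ultimately have "wform d d - lyap x * \<eta>\<^sup>2 - \<eta> * (2 * s + \<eta>) * L
        \<le> (wform_bound + norm w * (2 * norm w) * lyap_deriv_bound) * (norm d)\<^sup>2"
      by (simp add: algebra_simps power2_eq_square)
    then show ?thesis using se w_min_pos lyap_deriv_bound_nn wform_bound_nn
      by (intro add_left_mono frac_le power_mono) auto
  qed
  finally show ?thesis by (simp add: L_def lyap_hess_bound_def)
qed

text \<open>The first summand pays for the Taylor remainder of a short run, where the displacement
  is at most \<open>2 * \<epsilon> * \<tau>\<close>, hence the 4. The other two pay for a long run: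
  the value of \<open>lyap\<close> after it, and the first-order term that appears in the bound
  although the step was not taken.\<close>

definition lyap_step_bound :: real where
  "lyap_step_bound = 4 * lyap_hess_bound + lyap_bound + 2 * lyap_deriv_bound"

lemma lyap_step_bound_nn: "0 \<le> lyap_step_bound"
  unfolding lyap_step_bound_def lyap_bound_def
  using lyap_hess_bound_nn wform_bound_nn lyap_deriv_bound_nn by simp

lemma lyap_deriv_scale: "lyap_deriv x (c *\<^sub>R y) = c * lyap_deriv x y"
  unfolding lyap_deriv_def by (simp add: wform_scale algebra_simps)

lemma lyap_deriv_diff: "lyap_deriv x (y - z) = lyap_deriv x y - lyap_deriv x z"
  unfolding lyap_deriv_def diff_divide_distrib[symmetric]
  by (simp add: wform_diff inner_diff_right algebra_simps)

text \<open>After a long run nothing is assumed about \<open>z\<close> beyond membership in the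
  simplex: there \<open>1 \<le> \<epsilon> * \<tau>\<close>, so constants and multiples of
  \<open>\<epsilon> * \<tau>\<close> are absorbed by
  \<open>\<epsilon>\<^sup>2 * \<tau>\<^sup>2\<close>.\<close>

lemma lyap_step:
  assumes x: "x \<in> prob_simplex" and z: "z \<in> prob_simplex" and v: "\<And>i. 0 \<le> v $ i" and e: "0 < \<epsilon>"
  defines "\<tau> \<equiv> \<Sum>i\<in>UNIV. v $ i"
  assumes step: "\<epsilon> * \<tau> \<le> 1 \<Longrightarrow> z = x + \<epsilon> *\<^sub>R (v - \<tau> *\<^sub>R x)"
  shows "lyap z \<le> lyap x + \<epsilon> * lyap_deriv x (v - \<tau> *\<^sub>R x) + lyap_step_bound * \<epsilon>\<^sup>2 * \<tau>\<^sup>2"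
proof -
  have \<tau>: "0 \<le> \<tau>" unfolding \<tau>_def using v by (intro sum_nonneg) auto
  have n: "norm (v - \<tau> *\<^sub>R x) \<le> 2 * \<tau>" unfolding \<tau>_def by (rule visits_norm_le[OF x v])
  show ?thesis
  proof (cases "\<epsilon> * \<tau> \<le> 1")
    case True
    have "lyap z \<le> lyap x + lyap_deriv x (\<epsilon> *\<^sub>R (v - \<tau> *\<^sub>R x)) + lyap_hess_bound * (norm (\<epsilon> *\<^sub>R (v - \<tau> *\<^sub>R x)))\<^sup>2"
      using lyap_taylor[OF x, of "\<epsilon> *\<^sub>R (v - \<tau> *\<^sub>R x)"] z step[OF True] by simp
    also have "\<dots> \<le> lyap x + \<epsilon> * lyap_deriv x (v - \<tau> *\<^sub>R x) + lyap_hess_bound * (\<epsilon> * (2 * \<tau>))\<^sup>2"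
      using n e lyap_hess_bound_nn unfolding lyap_deriv_scale
      by (intro add_mono mult_left_mono power_mono) (auto intro!: mult_left_mono)
    also have "\<dots> \<le> lyap x + \<epsilon> * lyap_deriv x (v - \<tau> *\<^sub>R x) + lyap_step_bound * (\<epsilon>\<^sup>2 * \<tau>\<^sup>2)"
      unfolding lyap_step_bound_def
      using lyap_deriv_bound_nn wform_bound_nn by (simp add: lyap_bound_def power_mult_distrib algebra_simps)
    finally show ?thesis by (simp add: mult.assoc)
  next
    case False
    then have one: "1 \<le> \<epsilon> * \<tau>" by simp
    then have sq: "\<epsilon> * \<tau> \<le> \<epsilon>\<^sup>2 * \<tau>\<^sup>2" "1 \<le> \<epsilon>\<^sup>2 * \<tau>\<^sup>2"
      using self_le_power[OF one, of 2] one_le_power[OF one, of 2] by (simp_all add: power_mult_distrib)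
    have "- (\<epsilon> * lyap_deriv x (v - \<tau> *\<^sub>R x)) \<le> \<epsilon> * (lyap_deriv_bound * (2 * \<tau>))"
    proof -
      have "\<bar>lyap_deriv x (v - \<tau> *\<^sub>R x)\<bar> \<le> lyap_deriv_bound * (2 * \<tau>)"
        using lyap_deriv_le[OF x] n lyap_deriv_bound_nn by (meson mult_left_mono order_trans)
      then have "- lyap_deriv x (v - \<tau> *\<^sub>R x) \<le> lyap_deriv_bound * (2 * \<tau>)" by linarith
      from mult_left_mono[OF this, of \<epsilon>] e show ?thesis by simp
    qed
    also have "\<dots> \<le> 2 * lyap_deriv_bound * (\<epsilon>\<^sup>2 * \<tau>\<^sup>2)"
      using mult_left_mono[OF sq(1), of "2 * lyap_deriv_bound"] lyap_deriv_bound_nn by (simp add: algebra_simps)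
    finally have "- (\<epsilon> * lyap_deriv x (v - \<tau> *\<^sub>R x)) \<le> 2 * lyap_deriv_bound * (\<epsilon>\<^sup>2 * \<tau>\<^sup>2)" .
    moreover have "lyap z \<le> lyap_bound * (\<epsilon>\<^sup>2 * \<tau>\<^sup>2)"
    proof -
      have "lyap_bound * 1 \<le> lyap_bound * (\<epsilon>\<^sup>2 * \<tau>\<^sup>2)"
        using sq(2) wform_bound_nn by (intro mult_left_mono) (auto simp: lyap_bound_def)
      then show ?thesis using lyap_le[OF z] by simp
    qed
    moreover have "0 \<le> 4 * lyap_hess_bound * (\<epsilon>\<^sup>2 * \<tau>\<^sup>2)" using lyap_hess_bound_nn by simp
    ultimately have "lyap z \<le> lyap x + \<epsilon> * lyap_deriv x (v - \<tau> *\<^sub>R x) + lyap_step_bound * (\<epsilon>\<^sup>2 * \<tau>\<^sup>2)"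
      using lyap_nn[of x] unfolding lyap_step_bound_def by (simp add: algebra_simps)
    then show ?thesis by (simp add: mult.assoc)
  qed
qed

section \<open>Contraction of the Lyapunov function along the drift\<close>

lemma w_left_R: "w \<bullet> (x v* R) = \<theta> * (w \<bullet> x)"
proof -
  have "w \<bullet> (x v* R) = (x v* R) \<bullet> w" by (rule inner_commute)
  also have "\<dots> = x \<bullet> (R *v w)" by (rule dot_lmul_matrix)
  finally show ?thesis by (simp add: R_w inner_commute)
qed

text \<open>Both sides are the variance of \<open>x / qsd\<close> under the weights
  \<open>w $ i * qsd $ i\<close>, whose total mass is 1 and under which the mean is
  \<open>w \<bullet> x\<close>.\<close>

lemma wform_variance:
  "wform x x - (w \<bullet> x)\<^sup>2 = (\<Sum>i\<in>UNIV. w $ i / qsd $ i * (x $ i - (w \<bullet> x) * qsd $ i)\<^sup>2)"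
proof -
  define s where "s = w \<bullet> x"
  have "(\<Sum>i\<in>UNIV. w $ i / qsd $ i * (x $ i - s * qsd $ i)\<^sup>2)
     = (\<Sum>i\<in>UNIV. w $ i * x $ i * x $ i / qsd $ i - 2 * s * (w $ i * x $ i) + s\<^sup>2 * (w $ i * qsd $ i))"
    using qsd_pos by (intro sum.cong refl) (simp add: field_simps power2_eq_square less_imp_neq[symmetric])
  also have "\<dots> = wform x x - 2 * s * (w \<bullet> x) + s\<^sup>2 * (w \<bullet> qsd)"
    by (simp add: sum.distrib sum_subtractf sum_distrib_left[symmetric] wform_def inner_vec_def)
  also have "\<dots> = wform x x - s\<^sup>2" by (simp add: w_qsd s_def power2_eq_square)
  finally show ?thesis by (simp add: s_def)
qed

lemma lyap_ge1: "x \<in> prob_simplex \<Longrightarrow> 1 \<le> lyap x"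
proof -
  assume x: "x \<in> prob_simplex"
  have "0 \<le> wform x x - (w \<bullet> x)\<^sup>2"
    unfolding wform_variance using w_pos qsd_pos by (intro sum_nonneg) (auto simp: less_imp_le)
  moreover have "0 < w \<bullet> x" using w_min_pos w_min_le[OF x] by simp
  ultimately show ?thesis by (simp add: lyap_def)
qed

text \<open>A Doeblin constant: the largest factor for which \<open>R\<close> dominates the rank-one
  matrix with entries \<open>w $ j * qsd $ i\<close>. That matrix corresponds to independent
  sampling, whose Dirichlet form is the variance.\<close>

definition gap :: real where
  "gap = Min (range (\<lambda>(i, j). R $ j $ i / (w $ j * qsd $ i)))"

lemma gap_pos: "0 < gap"
  unfolding gap_def using w_pos qsd_pos R_pos by (subst Min_gr_iff) auto

lemma gap_le: "gap * (w $ j * qsd $ i) \<le> R $ j $ i"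
proof -
  have "gap \<le> R $ j $ i / (w $ j * qsd $ i)"
    unfolding gap_def by (intro Min_le) (auto intro!: image_eqI[of _ _ "(i, j)"])
  then show ?thesis using w_pos[of j] qsd_pos[of i] by (simp add: field_simps)
qed

text \<open>With \<open>K i j = w i * qsd j * R j i\<close>, whose marginals are both \<open>\<theta> * w i * qsd i\<close>, the dissipation
  is the Dirichlet form of \<open>K\<close> at \<open>x / qsd\<close>; it dominates a multiple of the variance because \<open>R\<close> is
  entrywise positive.\<close>

lemma wform_dissipation:
  "gap * (wform x x - (w \<bullet> x)\<^sup>2) \<le> \<theta> * wform x x - wform x (x v* R)"
proof -
  define u where "u = (\<lambda>i. x $ i / qsd $ i)"
  have xu: "x $ i = qsd $ i * u i" for i using qsd_pos[of i] by (simp add: u_def less_imp_neq[symmetric])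
  have a: "wform x x = (\<Sum>i\<in>UNIV. w $ i * qsd $ i * (u i)\<^sup>2)"
    unfolding wform_def using qsd_pos
    by (intro sum.cong refl) (simp add: xu field_simps power2_eq_square less_imp_neq[symmetric])
  have b: "w \<bullet> x = (\<Sum>i\<in>UNIV. w $ i * qsd $ i * u i)"
    unfolding inner_vec_def by (simp add: xu mult.assoc)
  have c: "wform x (x v* R) = (\<Sum>i\<in>UNIV. \<Sum>j\<in>UNIV. w $ i * qsd $ j * R $ j $ i * (u i * u j))"
    unfolding wform_def vector_matrix_nth using qsd_pos
    by (intro sum.cong refl)
       (simp add: xu sum_distrib_left sum_divide_distrib field_simps less_imp_neq[symmetric])
  have m1: "(\<Sum>j\<in>UNIV. w $ i * qsd $ j * R $ j $ i) = \<theta> * w $ i * qsd $ i" for i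
  proof -
    have "(\<Sum>j\<in>UNIV. w $ i * qsd $ j * R $ j $ i) = w $ i * (qsd v* R) $ i"
      by (simp add: vector_matrix_nth sum_distrib_left mult.assoc)
    then show ?thesis by (simp add: qsd_R)
  qed
  have m2: "(\<Sum>i\<in>UNIV. w $ i * qsd $ j * R $ j $ i) = \<theta> * w $ j * qsd $ j" for j
  proof -
    have "(\<Sum>i\<in>UNIV. w $ i * qsd $ j * R $ j $ i) = qsd $ j * (R *v w) $ j"
      by (simp add: matrix_vector_nth sum_distrib_left mult_ac)
    then show ?thesis by (simp add: R_w)
  qed
  have d1: "(\<Sum>i\<in>UNIV. \<Sum>j\<in>UNIV. w $ i * qsd $ j * R $ j $ i * (u i)\<^sup>2) = \<theta> * wform x x"
    unfolding sum_distrib_right[symmetric] m1 by (simp add: a sum_distrib_left mult_ac)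
  have d2: "(\<Sum>i\<in>UNIV. \<Sum>j\<in>UNIV. w $ i * qsd $ j * R $ j $ i * (u j)\<^sup>2) = \<theta> * wform x x"
    by (subst sum.swap, unfold sum_distrib_right[symmetric] m2) (simp add: a sum_distrib_left mult_ac)
  have D: "(\<Sum>i\<in>UNIV. \<Sum>j\<in>UNIV. w $ i * qsd $ j * R $ j $ i * (u i - u j)\<^sup>2)
      = 2 * (\<theta> * wform x x - wform x (x v* R))"
  proof -
    have "(\<Sum>i\<in>UNIV. \<Sum>j\<in>UNIV. w $ i * qsd $ j * R $ j $ i * (u i - u j)\<^sup>2)
      = (\<Sum>i\<in>UNIV. \<Sum>j\<in>UNIV. w $ i * qsd $ j * R $ j $ i * (u i)\<^sup>2
          + w $ i * qsd $ j * R $ j $ i * (u j)\<^sup>2 - 2 * (w $ i * qsd $ j * R $ j $ i * (u i * u j)))"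
      by (intro sum.cong refl) (simp add: power2_eq_square algebra_simps)
    also have "\<dots> = \<theta> * wform x x + \<theta> * wform x x - 2 * wform x (x v* R)"
      by (simp add: sum.distrib sum_subtractf d1 d2 c sum_distrib_left)
    finally show ?thesis by simp
  qed
  \<comment> \<open>For the product kernel the double sum is twice the variance, as for the squared
    difference of two independent copies.\<close>
  have E: "(\<Sum>i\<in>UNIV. \<Sum>j\<in>UNIV. (w $ i * qsd $ i) * (w $ j * qsd $ j) * (u i - u j)\<^sup>2)
      = 2 * (wform x x - (w \<bullet> x)\<^sup>2)"
  proof -
    have 1: "(\<Sum>i\<in>UNIV. w $ i * qsd $ i) = 1" using w_qsd by (simp add: inner_vec_def)
    have "(\<Sum>i\<in>UNIV. \<Sum>j\<in>UNIV. (w $ i * qsd $ i) * (w $ j * qsd $ j) * (u i - u j)\<^sup>2)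
      = (\<Sum>i\<in>UNIV. \<Sum>j\<in>UNIV. (w $ i * qsd $ i * (u i)\<^sup>2) * (w $ j * qsd $ j)
          + (w $ i * qsd $ i) * (w $ j * qsd $ j * (u j)\<^sup>2)
          - 2 * ((w $ i * qsd $ i * u i) * (w $ j * qsd $ j * u j)))"
      by (intro sum.cong refl) (simp add: power2_eq_square algebra_simps)
    also have "\<dots> = wform x x * 1 + 1 * wform x x - 2 * ((w \<bullet> x) * (w \<bullet> x))"
      unfolding a b 1[symmetric] sum.distrib sum_subtractf sum_product
      by (simp add: sum_distrib_left)
    finally show ?thesis by (simp add: power2_eq_square)
  qed
  \<comment> \<open>Entrywise comparison of the two kernels: multiplying \<open>gap_le\<close> by
    \<open>w $ i * qsd $ j\<close> bounds the product kernel by the one built from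
    \<open>R\<close>.\<close>
  have "gap * (\<Sum>i\<in>UNIV. \<Sum>j\<in>UNIV. (w $ i * qsd $ i) * (w $ j * qsd $ j) * (u i - u j)\<^sup>2)
     \<le> (\<Sum>i\<in>UNIV. \<Sum>j\<in>UNIV. w $ i * qsd $ j * R $ j $ i * (u i - u j)\<^sup>2)"
    unfolding sum_distrib_left
  proof (intro sum_mono)
    fix i j
    have "(w $ i * qsd $ j * (u i - u j)\<^sup>2) * (gap * (w $ j * qsd $ i))
       \<le> (w $ i * qsd $ j * (u i - u j)\<^sup>2) * R $ j $ i"
      using w_pos[of i] qsd_pos[of j] by (intro mult_left_mono gap_le) auto
    then show "gap * ((w $ i * qsd $ i) * (w $ j * qsd $ j) * (u i - u j)\<^sup>2)
       \<le> w $ i * qsd $ j * R $ j $ i * (u i - u j)\<^sup>2" by (simp add: mult_ac)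
  qed
  then have "2 * (gap * (wform x x - (w \<bullet> x)\<^sup>2)) \<le> 2 * (\<theta> * wform x x - wform x (x v* R))"
    unfolding D E by (simp only: mult.left_commute)
  then show ?thesis by (rule mult_left_le_imp_le) simp
qed

text \<open>The radial part of the drift does not change \<open>lyap\<close>, so only
  \<open>x v* R\<close> contributes. Its contribution is minus twice the dissipation over
  \<open>(w \<bullet> x)\<^sup>2\<close>, and dividing the variance by the same square gives
  \<open>lyap x - 1\<close>.\<close>

lemma lyap_drift:
  assumes x: "x \<in> prob_simplex"
  shows "lyap_deriv x (drift x) \<le> - (2 * gap) * (lyap x - 1)"
proof -
  have s: "0 < w \<bullet> x" using w_min_pos w_min_le[OF x] by simp
  have f: "lyap x * (w \<bullet> x) * (w \<bullet> x) = wform x x" using s by (simp add: lyap_def power2_eq_square)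
  have "lyap_deriv x x = 0" by (simp add: lyap_deriv_def f)
  then have "lyap_deriv x (drift x) = lyap_deriv x (x v* R)"
    by (simp add: drift_def lyap_deriv_diff lyap_deriv_scale)
  also have "\<dots> = - 2 * (\<theta> * wform x x - wform x (x v* R)) / (w \<bullet> x)\<^sup>2"
    unfolding lyap_deriv_def w_left_R f[symmetric] by (simp add: algebra_simps)
  also have "\<dots> \<le> - 2 * (gap * (wform x x - (w \<bullet> x)\<^sup>2)) / (w \<bullet> x)\<^sup>2"
    using wform_dissipation[of x] by (intro divide_right_mono) auto
  also have "\<dots> = - (2 * gap) * (lyap x - 1)"
    using s by (simp add: lyap_def field_simps)
  finally show ?thesis .
qed

text \<open>The relative variance directly controls only the deviation \<open>\<delta>\<close> of
  \<open>x\<close> from a multiple of \<open>qsd\<close>, with factor \<open>w \<bullet> x\<close>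
  that may differ from 1. The coordinate sum of \<open>\<delta>\<close> measures by how much the
  factor is off, so \<open>\<delta>\<close> also controls the full distance.\<close>

lemma lyap_dist: "\<exists>C>0. \<forall>x\<in>prob_simplex. (norm (x - qsd))\<^sup>2 \<le> C * (lyap x - 1)"
proof -
  define c where "c = (\<Sum>i\<in>UNIV. qsd $ i / w $ i)"
  have c: "0 < c" unfolding c_def using w_pos qsd_pos by (intro sum_pos) auto
  define m where "m = real CARD('m)"
  have m: "0 < m" by (simp add: m_def)
  define C where "C = 4 * (m * (m * (c * (norm w)\<^sup>2))) + 1"
  have "(norm (x - qsd))\<^sup>2 \<le> C * (lyap x - 1)" if x: "x \<in> prob_simplex" for x
  proof -
    define s where "s = w \<bullet> x"
    have s: "0 < s" "s \<le> norm w" using w_min_pos w_min_le[OF x] w_le_norm[OF x] by (auto simp: s_def)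
    define V where "V = wform x x - s\<^sup>2"
    define \<delta> where "\<delta> = x - s *\<^sub>R qsd"
    have \<delta>: "(\<delta> $ i)\<^sup>2 \<le> c * V" for i
    proof -
      have "w $ i / qsd $ i * (\<delta> $ i)\<^sup>2 \<le> V"
        unfolding V_def s_def wform_variance \<delta>_def using w_pos qsd_pos
        by (simp, intro member_le_sum) (auto simp: less_imp_le)
      then have "(\<delta> $ i)\<^sup>2 \<le> qsd $ i / w $ i * V"
        using w_pos[of i] qsd_pos[of i] by (simp add: field_simps)
      also have "\<dots> \<le> c * V"
      proof (rule mult_right_mono)
        show "qsd $ i / w $ i \<le> c"
          unfolding c_def using w_pos qsd_pos by (intro member_le_sum) (auto simp: less_imp_le)
        show "0 \<le> V" unfolding V_def s_def wform_variance
          using w_pos qsd_pos by (intro sum_nonneg) (auto simp: less_imp_le)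
      qed
      finally show ?thesis .
    qed
    have sum\<delta>: "(\<Sum>i\<in>UNIV. \<delta> $ i) = 1 - s"
      using simplex_sum[OF x] qsd_sum by (simp add: \<delta>_def sum_subtractf flip: sum_distrib_left)
    define S where "S = (\<Sum>i\<in>UNIV. \<bar>\<delta> $ i\<bar>)"
    \<comment> \<open>Both points have coordinate sum 1, so moving the total mass of
      \<open>\<delta>\<close> onto \<open>qsd\<close> corrects the factor.\<close>
    have "x - qsd = \<delta> - (\<Sum>i\<in>UNIV. \<delta> $ i) *\<^sub>R qsd"
      unfolding sum\<delta> by (simp add: \<delta>_def algebra_simps)
    then have "norm (x - qsd) \<le> norm \<delta> + \<bar>\<Sum>i\<in>UNIV. \<delta> $ i\<bar> * norm qsd"
      using norm_triangle_ineq4[of \<delta> "(\<Sum>i\<in>UNIV. \<delta> $ i) *\<^sub>R qsd"] by simp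
    also have "\<dots> \<le> S + S * 1"
      using norm_le_l1_cart[of \<delta>] simplex_norm_le1[OF qsd_simplex]
      by (intro add_mono mult_mono) (auto simp: S_def intro!: sum_nonneg)
    finally have n: "norm (x - qsd) \<le> 2 * S" by simp
    have "S\<^sup>2 \<le> (\<Sum>i\<in>UNIV. \<bar>\<delta> $ i\<bar>\<^sup>2) * m"
      unfolding S_def m_def by (rule sum_squared_le_sum_of_squares)
    also have "(\<Sum>i\<in>UNIV. \<bar>\<delta> $ i\<bar>\<^sup>2) \<le> (\<Sum>i\<in>(UNIV::'m set). c * V)"
      using \<delta> by (intro sum_mono) simp
    also have "\<dots> = m * (c * V)" by (simp add: m_def)
    finally have S2: "S\<^sup>2 \<le> m * (c * V) * m" using m by simp
    have V: "V = s\<^sup>2 * (lyap x - 1)" using s by (simp add: V_def lyap_def s_def[symmetric] field_simps)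
    have L: "0 \<le> lyap x - 1" using lyap_ge1[OF x] by simp
    have "(norm (x - qsd))\<^sup>2 \<le> (2 * S)\<^sup>2" using n by (intro power_mono) auto
    also have "\<dots> \<le> 4 * (m * (c * V) * m)" using S2 by (simp add: power_mult_distrib)
    also have "\<dots> = 4 * (m * (m * (c * s\<^sup>2))) * (lyap x - 1)" by (simp add: V mult_ac)
    also have "\<dots> \<le> C * (lyap x - 1)"
    proof (rule mult_right_mono[OF _ L])
      have "m * (m * (c * s\<^sup>2)) \<le> m * (m * (c * (norm w)\<^sup>2))"
        using s c m by (intro mult_left_mono power_mono) auto
      then show "4 * (m * (m * (c * s\<^sup>2))) \<le> C" by (simp add: C_def)
    qed
    finally show ?thesis .
  qed
  moreover have "0 < C" unfolding C_def using m c by (simp add: add_nonneg_pos)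
  ultimately show ?thesis by blast
qed

text \<open>The linearisation of \<open>drift\<close> at \<open>qsd\<close>, modified off the hyperplane of coordinate sum 0 so that it
  becomes invertible on the whole space.\<close>

definition jacobian :: "real^'m \<Rightarrow> real^'m" where
  "jacobian d = d v* R - \<theta> *\<^sub>R d - (\<Sum>i\<in>UNIV. (d v* R) $ i) *\<^sub>R qsd - (\<Sum>i\<in>UNIV. d $ i) *\<^sub>R qsd"

lemma linear_jacobian: "linear jacobian"
  by (intro linearI) (simp_all add: jacobian_def vector_matrix_scaleR vector_matrix_add sum.distrib algebra_simps
      flip: sum_distrib_left)

text \<open>The added last term makes the coordinate sum of the image equal to
  \<open>- (\<theta> + 1)\<close> times that of \<open>d\<close>, so the kernel lies in the
  hyperplane of sum 0. There pairing with \<open>w\<close> removes the remaining multiple of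
  \<open>qsd\<close>, and \<open>d\<close> becomes an eigenvector of \<open>R\<close> for its Perron
  eigenvalue: a multiple of \<open>qsd\<close> with sum 0.\<close>

lemma jacobian_inj: "inj jacobian"
proof (rule linear_injective_0[OF linear_jacobian, THEN iffD2], intro allI impI)
  fix d assume J: "jacobian d = 0"
  have "(\<Sum>i\<in>UNIV. jacobian d $ i) = - (\<theta> + 1) * (\<Sum>i\<in>UNIV. d $ i)"
    unfolding jacobian_def vector_minus_component vector_scaleR_component real_scaleR_def sum_subtractf
      sum_distrib_left[symmetric] qsd_sum by (simp add: algebra_simps)
  with J \<theta>_pos have d0: "(\<Sum>i\<in>UNIV. d $ i) = 0" by auto
  define c where "c = (\<Sum>i\<in>UNIV. (d v* R) $ i)"
  have e: "d v* R = \<theta> *\<^sub>R d + c *\<^sub>R qsd" using J d0 by (simp add: jacobian_def c_def algebra_simps)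
  have "w \<bullet> (d v* R) = \<theta> * (w \<bullet> d) + c" by (simp add: e inner_add_right w_qsd)
  then have "c = 0" by (simp add: w_left_R)
  with e have "d v* R = \<theta> *\<^sub>R d" by simp
  moreover have "irreducible_matrix R"
    unfolding irreducible_matrix_def using R_pos by auto
  ultimately obtain k where "d = k *\<^sub>R qsd"
    using irreducible_eigenvector_unique[of R qsd \<theta> d] R_pos qsd_pos qsd_R
    by (auto simp: less_imp_le)
  then show "d = 0" using d0 qsd_sum by (auto simp flip: sum_distrib_left)
qed

text \<open>The drift is a polynomial of degree two, so the expansion at \<open>qsd\<close> is exact
  with one quadratic term. The modification inside \<open>jacobian\<close> is invisible because
  \<open>x - qsd\<close> has coordinate sum 0.\<close>

lemma drift_expansion:
  assumes x: "x \<in> prob_simplex"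
  shows "drift x = jacobian (x - qsd) - (\<Sum>i\<in>UNIV. ((x - qsd) v* R) $ i) *\<^sub>R (x - qsd)"
proof -
  define d where "d = x - qsd"
  have xd: "x = d + qsd" by (simp add: d_def)
  have d0: "(\<Sum>i\<in>UNIV. d $ i) = 0" using simplex_sum[OF x] qsd_sum by (simp add: d_def sum_subtractf)
  have "drift x = d v* R + \<theta> *\<^sub>R qsd - ((\<Sum>i\<in>UNIV. (d v* R) $ i) + \<theta>) *\<^sub>R (d + qsd)"
    unfolding drift_def by (simp add: xd vector_matrix_add qsd_R sum.distrib qsd_sum flip: sum_distrib_left)
  then show ?thesis using d0 by (simp add: jacobian_def d_def[symmetric] algebra_simps)
qed

end


section \<open>Averages, recursions and step sizes\<close>

text \<open>Common core of the Kronecker and Cesaro arguments: a fixed initial block is negligible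
  against \<open>g n\<close>, and the tail condition handles the rest.\<close>

lemma weighted_average_tendsto_0:
  fixes a g :: "nat \<Rightarrow> real"
  assumes tail: "\<And>e. 0 < e \<Longrightarrow> \<exists>N. \<forall>n\<ge>N. \<bar>\<Sum>k\<in>{N..<n}. a k\<bar> \<le> e * g n"
    and g: "filterlim g at_top sequentially"
  shows "(\<lambda>n. (\<Sum>k<n. a k) / g n) \<longlonglongrightarrow> 0"
proof (rule LIMSEQ_I)
  fix r :: real assume r: "0 < r"
  obtain N where N: "\<And>n. n \<ge> N \<Longrightarrow> \<bar>\<Sum>k\<in>{N..<n}. a k\<bar> \<le> r / 2 * g n" using tail[of "r/2"] r by auto
  define A where "A = \<bar>\<Sum>k<N. a k\<bar>"
  have "\<forall>\<^sub>F n in sequentially. 2 * A / r + 1 \<le> g n" using g by (simp add: filterlim_at_top)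
  then obtain n1 where n1: "\<And>n. n \<ge> n1 \<Longrightarrow> 2 * A / r + 1 \<le> g n" unfolding eventually_sequentially by blast
  have "norm ((\<Sum>k<n. a k) / g n - 0) < r" if n: "n \<ge> max N n1" for n
  proof -
    have gn: "2 * A / r < g n" "0 < g n"
    proof -
      have "0 \<le> 2 * A / r" using r by (simp add: A_def)
      then show "2 * A / r < g n" "0 < g n" using n1[of n] n by auto
    qed
    have "(\<Sum>k<n. a k) = (\<Sum>k<N. a k) + (\<Sum>k\<in>{N..<n}. a k)"
      using n by (simp add: sum.atLeastLessThan_concat lessThan_atLeast0)
    then have "\<bar>\<Sum>k<n. a k\<bar> \<le> A + r / 2 * g n" using N[of n] n by (simp add: A_def)
    also have "A < r / 2 * g n" using gn(1) r by (simp add: field_simps)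
    finally have "\<bar>\<Sum>k<n. a k\<bar> < r * g n" by simp
    then show ?thesis using gn(2) by (simp add: field_simps)
  qed
  then show "\<exists>no. \<forall>n\<ge>no. norm ((\<Sum>k<n. a k) / g n - 0) < r" by blast
qed

text \<open>With nonnegative terms and monotone weights,
  \<open>a k = a k / g k * g k \<le> a k / g k * g n\<close>, so the Cauchy criterion for the
  weighted series bounds the tails directly.\<close>

lemma kronecker_nonneg:
  fixes a g :: "nat \<Rightarrow> real"
  assumes a: "\<And>k. 0 \<le> a k" and g: "mono g" "\<And>k. 0 < g k" "filterlim g at_top sequentially"
    and s: "summable (\<lambda>k. a k / g k)"
  shows "(\<lambda>n. (\<Sum>k<n. a k) / g n) \<longlonglongrightarrow> 0"
proof (rule weighted_average_tendsto_0[OF _ g(3)])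
  fix e :: real assume e: "0 < e"
  obtain N where N: "\<And>n. norm (\<Sum>k\<in>{N..<n}. a k / g k) < e"
    using s[unfolded summable_Cauchy] e by (metis order_refl)
  have "\<bar>\<Sum>k\<in>{N..<n}. a k\<bar> \<le> e * g n" for n
  proof -
    have "\<bar>\<Sum>k\<in>{N..<n}. a k\<bar> = (\<Sum>k\<in>{N..<n}. a k / g k * g k)"
      using a g(2) by (simp add: sum_nonneg less_imp_neq[symmetric])
    also have "\<dots> \<le> (\<Sum>k\<in>{N..<n}. a k / g k * g n)"
      using a g by (intro sum_mono mult_left_mono) (auto simp: mono_def less_imp_le)
    also have "\<dots> \<le> e * g n" unfolding sum_distrib_right[symmetric]
      using N[of n] g(2)[of n] by (intro mult_right_mono) (auto simp: abs_le_iff)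
    finally show ?thesis .
  qed
  then show "\<exists>N. \<forall>n\<ge>N. \<bar>\<Sum>k\<in>{N..<n}. a k\<bar> \<le> e * g n" by blast
qed

lemma cesaro_tendsto_0:
  fixes a :: "nat \<Rightarrow> real"
  assumes "a \<longlonglongrightarrow> 0" shows "(\<lambda>n. (\<Sum>k<n. a k) / real n) \<longlonglongrightarrow> 0"
proof (rule weighted_average_tendsto_0[OF _ filterlim_real_sequentially])
  fix e :: real assume e: "0 < e"
  obtain N where N: "\<And>k. k \<ge> N \<Longrightarrow> \<bar>a k\<bar> < e" using LIMSEQ_D[OF assms e] by auto
  have "\<bar>\<Sum>k\<in>{N..<n}. a k\<bar> \<le> e * real n" for n
  proof -
    have "\<bar>\<Sum>k\<in>{N..<n}. a k\<bar> \<le> (\<Sum>k\<in>{N..<n}. e)"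
      using N by (intro order_trans[OF sum_abs] sum_mono) (auto simp: less_imp_le)
    also have "\<dots> \<le> e * real n" using e by simp
    finally show ?thesis .
  qed
  then show "\<exists>N. \<forall>n\<ge>N. \<bar>\<Sum>k\<in>{N..<n}. a k\<bar> \<le> e * real n" by blast
qed

text \<open>The factor \<open>1 - p * y n\<close> contracts by a relative amount
  \<open>p * y n\<close>. One half of it absorbs \<open>C * (y n)\<^sup>2\<close>; the other half
  pays for the relative decrease of \<open>y\<close>, which is at most \<open>1 / (n + 1)\<close>
  and eventually smaller than \<open>p / 2 * y n\<close> because
  \<open>\<alpha> < 1\<close>.\<close>

lemma powr_decay_recursion:
  fixes e :: "nat \<Rightarrow> real"
  assumes \<alpha>: "0 < \<alpha>" "\<alpha> < 1" and p: "0 < p" and C: "0 \<le> C" and e: "\<And>n. 0 \<le> e n"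
    and rec: "\<And>n. e (Suc n) \<le> (1 - p * (real n + 1) powr - \<alpha>) * e n + C * ((real n + 1) powr - \<alpha>)\<^sup>2"
  shows "\<exists>K. 0 \<le> K \<and> (\<forall>n. e n \<le> K * (real n + 1) powr - \<alpha>)"
proof -
  define y where "y = (\<lambda>n. (real n + 1) powr - \<alpha>)"
  have y: "0 < y n" for n by (simp add: y_def)
  have "\<forall>\<^sub>F n in sequentially. y n * p \<le> 1"
    unfolding y_def using \<alpha> p by real_asymp
  moreover have "\<forall>\<^sub>F n in sequentially. (real n + 1) powr (\<alpha> - 1) \<le> p / 2"
    using \<alpha> p by real_asymp
  ultimately obtain N where N: "\<And>n. n \<ge> N \<Longrightarrow> y n * p \<le> 1" "\<And>n. n \<ge> N \<Longrightarrow> (real n + 1) powr (\<alpha> - 1) \<le> p / 2"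
    unfolding eventually_sequentially by (metis le_cases order_trans)
  have ratio: "y n * (1 - p / 2 * y n) \<le> y (Suc n)" if n: "n \<ge> N" for n
  proof -
    define t where "t = real n + 1"
    have t: "1 \<le> t" by (simp add: t_def)
    have "t powr (\<alpha> - 1) * t powr - \<alpha> = t powr (- 1)" by (simp only: powr_add[symmetric]) simp
    then have "1 / t = t powr (\<alpha> - 1) * y n" using t by (simp add: y_def t_def powr_minus_divide)
    also have "\<dots> \<le> p / 2 * y n" using N(2)[OF n] y[of n] by (intro mult_right_mono) (auto simp: t_def)
    finally have 1: "1 / t \<le> p / 2 * y n" .
    have "1 - p / 2 * y n \<le> 1 - 1 / (t + 1)"
      using 1 t by (smt (verit, best) frac_le)
    also have "\<dots> = t / (t + 1)" using t by (simp add: field_simps)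
    also have "\<dots> = (t / (t + 1)) powr 1" using t by simp
    also have "\<dots> \<le> (t / (t + 1)) powr \<alpha>" using t \<alpha> by (intro powr_mono') auto
    also have "\<dots> = y (Suc n) / y n"
      using t by (simp add: y_def t_def powr_divide powr_minus_divide add.commute)
    finally show ?thesis using y[of n] by (simp add: field_simps)
  qed
  \<comment> \<open>The first argument makes \<open>C * (y n)\<^sup>2\<close> at most half of the
    contraction; the second starts the induction at \<open>N\<close>.\<close>
  define K0 where "K0 = max (2 * C / p) (e N / y N)"
  have K0: "0 \<le> K0" "C \<le> K0 * p / 2" "e N \<le> K0 * y N"
    unfolding K0_def using C p y[of N] e[of N] by (auto simp: max_def field_simps)
  have A: "e n \<le> K0 * y n" if "n \<ge> N" for n
    using that
  proof (induction n rule: dec_induct)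
    case base show ?case by (rule K0)
  next
    case (step n)
    have "e (Suc n) \<le> (1 - p * y n) * e n + C * (y n)\<^sup>2" using rec[of n] by (simp add: y_def)
    also have "\<dots> \<le> (1 - p * y n) * (K0 * y n) + (K0 * p / 2) * (y n)\<^sup>2"
      using step N(1)[of n] K0 by (intro add_mono mult_left_mono mult_right_mono) (auto simp: mult.commute)
    also have "\<dots> = K0 * (y n * (1 - p / 2 * y n))" by (simp add: algebra_simps power2_eq_square)
    also have "\<dots> \<le> K0 * y (Suc n)" using ratio[of n] step K0 by (intro mult_left_mono) auto
    finally show ?case .
  qed
  \<comment> \<open>The finitely many indices below \<open>N\<close> are covered by adding their
    ratios.\<close>
  define K where "K = K0 + (\<Sum>n<N. e n / y n)"
  have s: "0 \<le> (\<Sum>n<N. e n / y n)" using e y by (intro sum_nonneg) (auto simp: less_imp_le)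
  have "e n \<le> K * y n" for n
  proof (cases "n \<ge> N")
    case True
    have "K0 * y n \<le> K * y n" using s y[of n] by (intro mult_right_mono) (auto simp: K_def)
    then show ?thesis using A[OF True] by simp
  next
    case False
    have "e n / y n \<le> (\<Sum>n<N. e n / y n)"
      using False e y by (intro member_le_sum) (auto simp: less_imp_le)
    then have "e n / y n \<le> K" using K0 by (simp add: K_def)
    then show ?thesis using y[of n] by (simp add: field_simps)
  qed
  moreover have "0 \<le> K" using s K0 by (simp add: K_def)
  ultimately show ?thesis by (auto simp: y_def)
qed

text \<open>The asymptotic hypothesis says nothing about small \<open>n\<close>, and its comparison
  function takes the conventional value 0 at \<open>n = 0\<close>. After the shift to
  \<open>real n + 1\<close> both sequences are positive everywhere, so eventually bounded ratios are
  bounded outright.\<close>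

lemma admissible_steps_bounds:
  assumes "admissible_steps \<epsilon>"
  obtains \<alpha> a b where "1 / 2 < \<alpha>" "\<alpha> < 1" "0 < a" "0 < b"
    "\<And>n. a * (real n + 1) powr - \<alpha> \<le> \<epsilon> n" "\<And>n. \<epsilon> n \<le> b * (real n + 1) powr - \<alpha>"
proof -
  obtain \<alpha> :: real where \<alpha>: "1 / 2 < \<alpha>" "\<alpha> < 1" and th: "\<epsilon> \<in> \<Theta>(\<lambda>n. 1 / real n powr \<alpha>)"
    and pos: "\<And>n. 0 < \<epsilon> n"
    using assms by (auto simp: admissible_steps_def)
  define y where "y = (\<lambda>n. (real n + 1) powr - \<alpha>)"
  have y: "0 < y n" for n by (simp add: y_def)
  have "(\<lambda>n. 1 / real n powr \<alpha>) \<in> \<Theta>(y)"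
    unfolding y_def using \<alpha> by real_asymp
  with th have th': "\<epsilon> \<in> \<Theta>(y)" by (rule landau_theta.trans)
  have "(\<lambda>n. \<epsilon> n / y n) \<in> O(\<lambda>n. y n / y n)"
    by (rule landau_o.big.divide_right) (use th' y in \<open>auto simp: bigtheta_def less_imp_neq[symmetric]\<close>)
  then have "(\<lambda>n. \<epsilon> n / y n) \<in> O(\<lambda>_. 1)" using y by (simp add: less_imp_neq[symmetric])
  then have "Bseq (\<lambda>n. \<epsilon> n / y n)" by (elim landau_o.bigE) (auto simp: Bfun_def)
  then obtain b where b: "0 < b" "\<And>n. norm (\<epsilon> n / y n) \<le> b" unfolding Bseq_def by blast
  have "(\<lambda>n. y n / \<epsilon> n) \<in> O(\<lambda>n. \<epsilon> n / \<epsilon> n)"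
    by (rule landau_o.big.divide_right)
      (use th' pos in \<open>auto simp: bigtheta_def bigomega_iff_bigo less_imp_neq[symmetric]\<close>)
  then have "(\<lambda>n. y n / \<epsilon> n) \<in> O(\<lambda>_. 1)" using pos by (simp add: less_imp_neq[symmetric])
  then have "Bseq (\<lambda>n. y n / \<epsilon> n)" by (elim landau_o.bigE) (auto simp: Bfun_def)
  then obtain a where a: "0 < a" "\<And>n. norm (y n / \<epsilon> n) \<le> a" unfolding Bseq_def by blast
  show ?thesis
  proof (rule that[OF \<alpha>, of "1 / a" b])
    show "\<epsilon> n \<le> b * (real n + 1) powr - \<alpha>" for n
      using b(2)[of n] y[of n] pos[of n] by (simp add: y_def[symmetric] field_simps) (simp add: y_def add.commute)
    show "1 / a * (real n + 1) powr - \<alpha> \<le> \<epsilon> n" for n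
    proof -
      have "y n / \<epsilon> n \<le> a" using a(2)[of n] y[of n] pos[of n] by simp
      then have "y n \<le> a * \<epsilon> n" using pos[of n] by (simp add: field_simps)
      then show ?thesis using a(1) by (simp add: y_def field_simps)
    qed
  qed (use a b in auto)
qed

lemma summation_by_parts:
  fixes d :: "nat \<Rightarrow> 'a::real_vector"
  shows "(\<Sum>k<N. b k *\<^sub>R (d (Suc k) - d k))
    = b N *\<^sub>R d N - b 0 *\<^sub>R d 0 - (\<Sum>k<N. (b (Suc k) - b k) *\<^sub>R d (Suc k))"
  by (induction N) (simp_all add: algebra_simps)

text \<open>The real part of the remainder bound for the complex exponential, rotated by a factor of
  modulus 1.\<close>

lemma cos_taylor2: "\<bar>cos (s + d) - (cos s - sin s * d - cos s * d\<^sup>2 / 2)\<bar> \<le> \<bar>d\<bar> ^ 3" for s d :: real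
proof -
  have sum: "(\<Sum>k\<le>2. (\<i> * complex_of_real d) ^ k / fact k) = 1 + \<i> * d - d\<^sup>2 / 2"
    by (simp add: numeral_2_eq_2 algebra_simps)
  have "cos (s + d) - (cos s - sin s * d - cos s * d\<^sup>2 / 2) = Re (iexp s * (iexp d - (1 + \<i> * d - d\<^sup>2 / 2)))"
    by (simp add: cis_conv_exp[symmetric] cos_add algebra_simps power2_eq_square)
  also have "\<bar>\<dots>\<bar> \<le> cmod (iexp s * (iexp d - (1 + \<i> * d - d\<^sup>2 / 2)))" by (rule abs_Re_le_cmod)
  also have "\<dots> = cmod (iexp d - (1 + \<i> * d - d\<^sup>2 / 2))" by (simp add: norm_mult)
  also have "\<dots> \<le> \<bar>d\<bar> ^ 3 / fact 3" using iexp_approx1[of d 2] by (simp add: sum numeral_3_eq_3)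
  also have "\<dots> \<le> \<bar>d\<bar> ^ 3" by (simp add: fact_numeral)
  finally show ?thesis .
qed


section \<open>Weak convergence and Gaussian laws\<close>

text \<open>The phase makes sines and, with \<open>t = 0\<close>, constants special cases, so
  product-to-sum formulas yield a real algebra of test functions.\<close>

inductive trig_poly :: "('a::euclidean_space \<Rightarrow> real) \<Rightarrow> bool" where
  trig_poly_cos: "trig_poly (\<lambda>x. c * cos (t \<bullet> x + b))"
| trig_poly_add: "trig_poly f \<Longrightarrow> trig_poly g \<Longrightarrow> trig_poly (\<lambda>x. f x + g x)"

lemma trig_poly_const: "trig_poly (\<lambda>x. c)"
  using trig_poly_cos[of c 0 0] by simp

lemma trig_poly_mult:
  assumes "trig_poly f" "trig_poly g" shows "trig_poly (\<lambda>x. f x * g x)"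
  using assms
proof (induction arbitrary: g rule: trig_poly.induct)
  case (trig_poly_cos c t b)
  from trig_poly_cos show ?case
  proof (induction rule: trig_poly.induct)
    case (trig_poly_cos c' t' b')
    have eq: "c * cos (t \<bullet> x + b) * (c' * cos (t' \<bullet> x + b'))
       = c * c' / 2 * cos ((t - t') \<bullet> x + (b - b')) + c * c' / 2 * cos ((t + t') \<bullet> x + (b + b'))" for x
    proof -
      have "cos (t \<bullet> x + b) * cos (t' \<bullet> x + b')
        = (cos ((t - t') \<bullet> x + (b - b')) + cos ((t + t') \<bullet> x + (b + b'))) / 2"
        unfolding cos_times_cos by (simp add: inner_diff_left inner_add_left algebra_simps)
      moreover have "c * cos (t \<bullet> x + b) * (c' * cos (t' \<bullet> x + b')) = c * c' * (cos (t \<bullet> x + b) * cos (t' \<bullet> x + b'))"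
        by (simp only: mult_ac)
      ultimately show ?thesis by (simp only: distrib_left add_divide_distrib times_divide_eq_right times_divide_eq_left)
    qed
    show ?case unfolding eq by (intro trig_poly.intros)
  next
    case (trig_poly_add f g)
    then show ?case by (simp add: distrib_left trig_poly.trig_poly_add)
  qed
next
  case (trig_poly_add f1 f2)
  then show ?case by (simp add: distrib_right trig_poly.trig_poly_add)
qed

lemma trig_poly_continuous: "trig_poly f \<Longrightarrow> continuous_on S f"
  by (induction rule: trig_poly.induct) (auto intro!: continuous_intros)

lemma trig_poly_borel: "trig_poly f \<Longrightarrow> f \<in> borel_measurable borel"
  by (intro borel_measurable_continuous_onI trig_poly_continuous)

lemma trig_poly_bounded: "trig_poly f \<Longrightarrow> \<exists>B. \<forall>x. \<bar>f x\<bar> \<le> B"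
proof (induction rule: trig_poly.induct)
  case (trig_poly_cos c t b)
  have "\<bar>c * cos (t \<bullet> x + b)\<bar> \<le> \<bar>c\<bar>" for x
    unfolding abs_mult by (intro mult_left_le abs_cos_le_one) auto
  then show ?case by blast
next
  case (trig_poly_add f g)
  then obtain B B' where "\<forall>x. \<bar>f x\<bar> \<le> B" "\<forall>x. \<bar>g x\<bar> \<le> B'" by blast
  then have "\<forall>x. \<bar>f x + g x\<bar> \<le> B + B'" by (metis abs_triangle_ineq add_mono order_trans)
  then show ?case by blast
qed

lemma trig_poly_compose_polynomial:
  assumes "real_polynomial_function p" "trig_poly f" shows "trig_poly (\<lambda>x. p (f x))"
  using assms(1)
proof (induction rule: real_polynomial_function.induct)
  case (linear h)
  have "h r = h 1 * r" for r using linear_scale[OF bounded_linear.linear[OF linear], of r 1] by simp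
  then have "(\<lambda>x. h (f x)) = (\<lambda>x. h 1 * f x)" by blast
  then show ?case using trig_poly_mult[OF trig_poly_const[of "h 1"] assms(2)] by simp
qed (auto intro: trig_poly_const trig_poly_add trig_poly_mult)

text \<open>Approximate on a ball by Stone--Weierstrass, then cut off with a polynomial approximation of the
  truncation map, which keeps the approximant bounded outside the ball.\<close>

lemma trig_poly_approximation:
  fixes f :: "'a::euclidean_space \<Rightarrow> real"
  assumes f: "continuous_on UNIV f" "\<And>x. \<bar>f x\<bar> \<le> C" and e: "0 < e"
  obtains q where "trig_poly q"
    "\<And>x. \<bar>f x - q x\<bar> \<le> e + (2 * C + e) * indicator {x. K < norm x} x"
proof -
  have "\<exists>g. trig_poly g \<and> (\<forall>x\<in>cball (0::'a) K. \<bar>f x - g x\<bar> < e / 2)"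
  proof (rule Stone_Weierstrass_HOL)
    fix x y :: 'a assume "x \<in> cball 0 K \<and> y \<in> cball 0 K \<and> x \<noteq> y"
    then have "x \<noteq> y" by simp
    \<comment> \<open>Scaled so that with the phase \<open>b\<close> the arguments at
      \<open>x\<close> and \<open>y\<close> are 1 and 0, where the cosine takes different
      values.\<close>
    define t where "t = (1 / (norm (x - y))\<^sup>2) *\<^sub>R (x - y)"
    define b where "b = - (t \<bullet> y)"
    have "t \<bullet> x + b = 1"
    proof -
      have "t \<bullet> x + b = t \<bullet> (x - y)" by (simp add: b_def inner_diff_right)
      also have "\<dots> = 1" using \<open>x \<noteq> y\<close> by (simp add: t_def dot_square_norm)
      finally show ?thesis .
    qed
    moreover have "t \<bullet> y + b = 0" by (simp add: b_def)
    moreover have "cos 1 \<noteq> (1::real)" using cos_monotone_0_pi[of 0 1] pi_gt3 by simp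
    ultimately show "\<exists>f. trig_poly f \<and> f x \<noteq> f y"
      using trig_poly_cos[of 1 t b] by (intro exI[of _ "\<lambda>x. 1 * cos (t \<bullet> x + b)"]) auto
  next
    show "continuous_on (cball 0 K) f" using f(1) continuous_on_subset by blast
  qed (use e in \<open>auto intro: trig_poly_const trig_poly_add trig_poly_mult trig_poly_continuous\<close>)
  then obtain g where g: "trig_poly g" "\<And>x. norm x \<le> K \<Longrightarrow> \<bar>f x - g x\<bar> < e / 2" by auto
  obtain D where D: "\<And>x. \<bar>g x\<bar> \<le> D" using trig_poly_bounded[OF g(1)] by blast
  define \<psi> where "\<psi> = (\<lambda>r::real. max (- C) (min C r))"
  have "continuous_on {-D..D} \<psi>" unfolding \<psi>_def by (intro continuous_intros)
  then obtain p where p: "real_polynomial_function p" "\<And>r. r \<in> {-D..D} \<Longrightarrow> \<bar>\<psi> r - p r\<bar> < e / 2"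
    using Stone_Weierstrass_real_polynomial_function[of "{-D..D}" \<psi> "e/2"] e by auto
  have C: "0 \<le> C" using f(2)[of 0] by simp
  have q: "\<bar>f x - p (g x)\<bar> \<le> e + (2 * C + e) * indicator {x. K < norm x} x" for x
  proof -
    have "g x \<in> {-D..D}" using D[of x] by auto
    then have 1: "\<bar>\<psi> (g x) - p (g x)\<bar> < e / 2" by (rule p(2))
    have "\<bar>\<psi> (g x)\<bar> \<le> C" using C unfolding \<psi>_def by auto
    then have 2: "\<bar>f x - \<psi> (g x)\<bar> \<le> 2 * C" using f(2)[of x] by linarith
    \<comment> \<open>Truncation to \<open>[-C, C]\<close> does not move a value further from
      \<open>f x\<close>, which already lies in that interval.\<close>
    have 3: "\<bar>f x - \<psi> (g x)\<bar> \<le> \<bar>f x - g x\<bar>" using f(2)[of x] unfolding \<psi>_def by (auto simp: max_def min_def)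
    have 4: "\<bar>f x - p (g x)\<bar> \<le> \<bar>f x - \<psi> (g x)\<bar> + \<bar>\<psi> (g x) - p (g x)\<bar>" by linarith
    show ?thesis
    proof (cases "K < norm x")
      case True
      then have "e + (2 * C + e) * indicator {x. K < norm x} x = 2 * e + 2 * C" by simp
      then show ?thesis using 1 2 4 e by linarith
    next
      case False
      then have "indicator {x. K < norm x} x = (0::real)" "norm x \<le> K" by auto
      then show ?thesis using 1 3 4 e g(2)[of x] by simp
    qed
  qed
  show ?thesis by (rule that[OF trig_poly_compose_polynomial[OF p(1) g(1)] q])
qed

lemma (in prob_space) trig_poly_integral_error:
  fixes f q :: "'b::euclidean_space \<Rightarrow> real"
  assumes [measurable]: "Z \<in> borel_measurable M" "f \<in> borel_measurable borel" and q: "trig_poly q"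
    and f: "\<And>x. \<bar>f x\<bar> \<le> C"
    and fq: "\<And>x. \<bar>f x - q x\<bar> \<le> e + c * indicator {x. K < norm x} x" and c: "0 \<le> c"
  shows "\<bar>expectation (\<lambda>\<omega>. f (Z \<omega>)) - expectation (\<lambda>\<omega>. q (Z \<omega>))\<bar>
     \<le> e + c * prob {\<omega>\<in>space M. K < norm (Z \<omega>)}"
proof -
  obtain D where D: "\<And>x. \<bar>q x\<bar> \<le> D" using trig_poly_bounded[OF q] by blast
  have [measurable]: "q \<in> borel_measurable borel" by (rule trig_poly_borel[OF q])
  have i1: "integrable M (\<lambda>\<omega>. f (Z \<omega>))" by (rule integrable_const_bound[where B=C]) (use f in auto)
  have i2: "integrable M (\<lambda>\<omega>. q (Z \<omega>))" by (rule integrable_const_bound[where B=D]) (use D in auto)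
  have "\<bar>expectation (\<lambda>\<omega>. f (Z \<omega>)) - expectation (\<lambda>\<omega>. q (Z \<omega>))\<bar>
    = \<bar>expectation (\<lambda>\<omega>. f (Z \<omega>) - q (Z \<omega>))\<bar>" using i1 i2 by simp
  also have "\<dots> \<le> expectation (\<lambda>\<omega>. \<bar>f (Z \<omega>) - q (Z \<omega>)\<bar>)"
    by (rule integral_abs_bound)
  also have "\<dots> \<le> expectation (\<lambda>\<omega>. e + c * indicator {\<omega>\<in>space M. K < norm (Z \<omega>)} \<omega>)"
  proof (rule integral_mono)
    show "integrable M (\<lambda>\<omega>. e + c * indicator {\<omega>\<in>space M. K < norm (Z \<omega>)} \<omega>)"
      by (rule integrable_const_bound[where B="\<bar>e\<bar> + \<bar>c\<bar>"]) (auto simp: indicator_def)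
    show "\<bar>f (Z \<omega>) - q (Z \<omega>)\<bar> \<le> e + c * indicator {\<omega>\<in>space M. K < norm (Z \<omega>)} \<omega>" if "\<omega> \<in> space M" for \<omega>
      using fq[of "Z \<omega>"] that by (auto simp: indicator_def split: if_splits)
  qed (use i1 i2 in auto)
  also have "\<dots> = e + c * prob {\<omega>\<in>space M. K < norm (Z \<omega>)}"
  proof -
    define A where "A = {\<omega>\<in>space M. K < norm (Z \<omega>)}"
    have A[measurable]: "A \<in> sets M" unfolding A_def by measurable
    have "integrable M (indicator A :: 'a \<Rightarrow> real)"
      by (rule integrable_const_bound[where B=1]) auto
    then show ?thesis unfolding A_def[symmetric] using A by (simp add: prob_space)
  qed
  finally show ?thesis .
qed

text \<open>The bounded first moments give tightness by Markov's inequality. A test function is then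
  replaced by one trigonometric polynomial, the same for all \<open>n\<close> and for the limit law,
  at a cost that is small uniformly in \<open>n\<close>.\<close>

lemma converges_in_distribution_cos:
  fixes Y :: "nat \<Rightarrow> 'w \<Rightarrow> real^'m::finite"
  assumes M: "prob_space M" and Y[measurable]: "\<And>n. Y n \<in> borel_measurable M"
    and N: "prob_space N" "sets N = sets borel"
    and int: "\<And>n. integrable M (\<lambda>\<omega>. norm (Y n \<omega>))" and bnd: "\<And>n. (\<integral>\<omega>. norm (Y n \<omega>) \<partial>M) \<le> B"
    and conv: "\<And>t b. (\<lambda>n. \<integral>\<omega>. cos (t \<bullet> Y n \<omega> + b) \<partial>M) \<longlonglongrightarrow> (\<integral>x. cos (t \<bullet> x + b) \<partial>N)"
  shows "converges_in_distribution M Y N"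
  unfolding converges_in_distribution_def
proof (intro allI impI, elim conjE)
  interpret M: prob_space M by fact
  interpret N: prob_space N by fact
  have [measurable]: "(\<lambda>x. x) \<in> borel_measurable N" using N(2) by (simp add: measurable_ident_sets)
  have trig: "(\<lambda>n. \<integral>\<omega>. q (Y n \<omega>) \<partial>M) \<longlonglongrightarrow> (\<integral>x. q x \<partial>N)" if "trig_poly q" for q :: "real^'m \<Rightarrow> real"
    using that
  proof (induction rule: trig_poly.induct)
    case (trig_poly_cos c t b)
    show ?case using conv[of t b] by (simp add: tendsto_mult_left)
  next
    case (trig_poly_add f g)
    have ig: "integrable M' (\<lambda>\<omega>. h (Z \<omega>))"
      if h: "trig_poly h" "Z \<in> borel_measurable M'" "prob_space M'" for h :: "real^'m \<Rightarrow> real" and Z and M' :: "'x measure"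
    proof -
      interpret M': prob_space M' by fact
      obtain D where "\<And>x. \<bar>h x\<bar> \<le> D" using trig_poly_bounded[OF h(1)] by blast
      then show ?thesis
        using measurable_compose[OF h(2) trig_poly_borel[OF h(1)]]
        by (intro M'.integrable_const_bound[where B=D]) auto
    qed
    have "(\<integral>\<omega>. f (Y n \<omega>) + g (Y n \<omega>) \<partial>M) = (\<integral>\<omega>. f (Y n \<omega>) \<partial>M) + (\<integral>\<omega>. g (Y n \<omega>) \<partial>M)" for n
      using trig_poly_add M by (intro Bochner_Integration.integral_add ig) auto
    moreover have "(\<integral>x. f x + g x \<partial>N) = (\<integral>x. f x \<partial>N) + (\<integral>x. g x \<partial>N)"
      using trig_poly_add N(1) ig[of _ "\<lambda>x. x" N] by (intro Bochner_Integration.integral_add) auto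
    ultimately show ?case using trig_poly_add by (simp add: tendsto_add)
  qed
  fix f :: "real^'m \<Rightarrow> real" assume f: "continuous_on UNIV f" and bf: "bounded (range f)"
  obtain C where C: "\<And>x. \<bar>f x\<bar> \<le> C" using bf by (auto simp: bounded_iff)
  have C0: "0 \<le> C" using C[of 0] by simp
  have [measurable]: "f \<in> borel_measurable borel" using f by (rule borel_measurable_continuous_onI)
  show "(\<lambda>n. \<integral>\<omega>. f (Y n \<omega>) \<partial>M) \<longlonglongrightarrow> (\<integral>x. f x \<partial>N)"
  proof (rule LIMSEQ_I)
    fix r :: real assume r: "0 < r"
    \<comment> \<open>The total error is \<open>5 * e\<close>: two for each replacement of
      \<open>f\<close> by \<open>q\<close>, one for the convergence of the integrals of
      \<open>q\<close>.\<close>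
    define e where "e = r / 8"
    define c where "c = 2 * C + e"
    have e: "0 < e" and c: "0 < c" using r C0 by (auto simp: e_def c_def)
    have "(\<lambda>n. measure N {x\<in>space N. real n < norm x}) \<longlonglongrightarrow> measure N (\<Inter>n. {x\<in>space N. real n < norm x})"
      by (rule N.finite_Lim_measure_decseq) (auto simp: decseq_def)
    moreover have "(\<Inter>n. {x\<in>space N. real n < norm x}) = {}"
      by auto (meson less_asym reals_Archimedean2)
    ultimately have "(\<lambda>n. measure N {x\<in>space N. real n < norm x}) \<longlonglongrightarrow> 0" by simp
    then have "\<forall>\<^sub>F n in sequentially. measure N {x\<in>space N. real n < norm x} < e / c"
      using e c by (intro order_tendstoD) auto
    moreover have "\<forall>\<^sub>F n in sequentially. \<bar>B\<bar> * c / e + 1 \<le> real n"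
      using filterlim_real_sequentially by (simp add: filterlim_at_top)
    \<comment> \<open>One radius serves both sides: the first condition bounds the tail of the limit
      law, the second makes the Markov bound at most \<open>e / c\<close>.\<close>
    ultimately obtain k where k: "measure N {x\<in>space N. real k < norm x} < e / c" "\<bar>B\<bar> * c / e + 1 \<le> real k"
      using eventually_conj eventually_happens'[OF sequentially_bot] by fastforce
    have kpos: "0 < real k" using k(2) e c by (smt (verit, best) divide_nonneg_pos mult_nonneg_nonneg abs_ge_zero)
    obtain q where q: "trig_poly q"
      and fq: "\<And>x. \<bar>f x - q x\<bar> \<le> e + c * indicator {x. real k < norm x} x"
      using trig_poly_approximation[OF f C e, of "real k"] unfolding c_def by blast
    have PM: "measure M {\<omega>\<in>space M. real k < norm (Y n \<omega>)} \<le> e / c" for n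
    proof -
      have "measure M {\<omega>\<in>space M. real k < norm (Y n \<omega>)} \<le> measure M {\<omega>\<in>space M. real k \<le> norm (Y n \<omega>)}"
        by (intro M.finite_measure_mono) auto
      also have "\<dots> \<le> (\<integral>\<omega>. norm (Y n \<omega>) \<partial>M) / real k"
        using integral_Markov_inequality_measure[OF int[of n], of "{}" "real k"] kpos by simp
      also have "\<dots> \<le> \<bar>B\<bar> / real k" using bnd[of n] kpos by (intro divide_right_mono) auto
      also have "\<dots> \<le> e / c"
      proof -
        have "\<bar>B\<bar> * c / e \<le> real k" using k(2) by simp
        then show ?thesis using e c kpos by (simp add: field_simps)
      qed
      finally show ?thesis .
    qed
    have 1: "\<bar>(\<integral>\<omega>. f (Y n \<omega>) \<partial>M) - (\<integral>\<omega>. q (Y n \<omega>) \<partial>M)\<bar> \<le> 2 * e" for n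
    proof -
      have "\<bar>(\<integral>\<omega>. f (Y n \<omega>) \<partial>M) - (\<integral>\<omega>. q (Y n \<omega>) \<partial>M)\<bar> \<le> e + c * measure M {\<omega>\<in>space M. real k < norm (Y n \<omega>)}"
        by (rule M.trig_poly_integral_error[OF Y _ q C fq]) (use c in auto)
      moreover have "c * measure M {\<omega>\<in>space M. real k < norm (Y n \<omega>)} \<le> c * (e / c)"
        using PM c by (intro mult_left_mono) auto
      ultimately show ?thesis using c by simp
    qed
    have 2: "\<bar>(\<integral>x. f x \<partial>N) - (\<integral>x. q x \<partial>N)\<bar> \<le> 2 * e"
    proof -
      have "\<bar>(\<integral>x. f x \<partial>N) - (\<integral>x. q x \<partial>N)\<bar> \<le> e + c * measure N {x\<in>space N. real k < norm x}"
        by (rule N.trig_poly_integral_error[OF _ _ q C fq]) (use c in auto)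
      moreover have "c * measure N {x\<in>space N. real k < norm x} \<le> c * (e / c)"
        using k(1) c by (intro mult_left_mono) auto
      ultimately show ?thesis using c by simp
    qed
    obtain n0 where n0: "\<And>n. n \<ge> n0 \<Longrightarrow> \<bar>(\<integral>\<omega>. q (Y n \<omega>) \<partial>M) - (\<integral>x. q x \<partial>N)\<bar> < e"
      using LIMSEQ_D[OF trig[OF q] e] by auto
    then have "norm ((\<integral>\<omega>. f (Y n \<omega>) \<partial>M) - (\<integral>x. f x \<partial>N)) < r" if "n \<ge> n0" for n
    proof -
      have "\<bar>(\<integral>\<omega>. q (Y n \<omega>) \<partial>M) - (\<integral>x. q x \<partial>N)\<bar> < e" using n0 that by blast
      then have "\<bar>(\<integral>\<omega>. f (Y n \<omega>) \<partial>M) - (\<integral>x. f x \<partial>N)\<bar> < 2 * e + e + 2 * e"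
        using 1[of n] 2 by linarith
      then show ?thesis using r by (simp add: e_def)
    qed
    then show "\<exists>n0. \<forall>n\<ge>n0. norm ((\<integral>\<omega>. f (Y n \<omega>) \<partial>M) - (\<integral>x. f x \<partial>N)) < r" by blast
  qed
qed

section \<open>Covariance matrices and the existence of Gaussian laws\<close>

lemma covariance_nonneg: "covariance_matrix V \<Longrightarrow> 0 \<le> t \<bullet> (V *v t)"
  by (simp add: covariance_matrix_def)

lemma symmetric_form: "transpose V = V \<Longrightarrow> s \<bullet> (V *v t) = t \<bullet> (V *v s)" for V :: "real^'m::finite^'m"
  by (metis dot_lmul_matrix inner_commute vector_transpose_matrix)

lemma form_expand:
  fixes V :: "real^'m::finite^'m"
  assumes "transpose V = V"
  shows "(s + x *\<^sub>R t) \<bullet> (V *v (s + x *\<^sub>R t)) = s \<bullet> (V *v s) + 2 * x * (s \<bullet> (V *v t)) + x\<^sup>2 * (t \<bullet> (V *v t))"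
  using symmetric_form[OF assms, of t s]
  by (simp add: matrix_vector_right_distrib matrix_vector_mult_scaleR inner_add_left inner_add_right
      power2_eq_square algebra_simps)

text \<open>Along \<open>y + x *\<^sub>R t\<close> with \<open>y = V *v t\<close> the form is affine
  in \<open>x\<close> with slope \<open>2 * (y \<bullet> y)\<close>, so a nonzero \<open>y\<close>
  would allow negative values; \<open>x\<close> is chosen to reach -1.\<close>

lemma covariance_kernel:
  fixes V :: "real^'m::finite^'m"
  assumes V: "covariance_matrix V" and t: "t \<bullet> (V *v t) = 0"
  shows "V *v t = 0"
proof (rule ccontr)
  define y where "y = V *v t"
  assume "V *v t \<noteq> 0"
  then have y: "0 < y \<bullet> y" by (simp add: y_def)
  define x where "x = - (y \<bullet> (V *v y) + 1) / (2 * (y \<bullet> y))"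
  have "0 \<le> (y + x *\<^sub>R t) \<bullet> (V *v (y + x *\<^sub>R t))" by (rule covariance_nonneg[OF V])
  also have "\<dots> = y \<bullet> (V *v y) + 2 * x * (y \<bullet> y)"
    using V t by (simp add: form_expand covariance_matrix_def y_def)
  also have "\<dots> = - 1" using y by (simp add: x_def field_simps)
  finally show False by simp
qed

text \<open>The form is evaluated at \<open>s\<close> minus its projection along \<open>t\<close>,
  the minimiser on that line.\<close>

lemma covariance_Cauchy_Schwarz:
  fixes V :: "real^'m::finite^'m"
  assumes V: "covariance_matrix V" and t: "0 < t \<bullet> (V *v t)"
  shows "(s \<bullet> (V *v t))\<^sup>2 / (t \<bullet> (V *v t)) \<le> s \<bullet> (V *v s)"
proof -
  define a b where "a = t \<bullet> (V *v t)" and "b = s \<bullet> (V *v t)"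
  have "0 \<le> (s + (- b / a) *\<^sub>R t) \<bullet> (V *v (s + (- b / a) *\<^sub>R t))" by (rule covariance_nonneg[OF V])
  also have "\<dots> = s \<bullet> (V *v s) + 2 * (- b / a) * b + (- b / a)\<^sup>2 * a"
    using V form_expand[of V s "- b / a" t] by (simp add: covariance_matrix_def a_def b_def)
  also have "\<dots> = s \<bullet> (V *v s) - b\<^sup>2 / a" using t by (simp add: a_def[symmetric] power2_eq_square field_simps)
  finally show ?thesis by (simp add: a_def b_def)
qed

text \<open>Pivoted Cholesky decomposition: each step removes one rank-one term and enlarges the kernel of
  the remainder by one coordinate vector.\<close>

lemma covariance_decomposition:
  fixes V :: "real^'m::finite^'m"
  assumes V: "covariance_matrix V"
  shows "\<exists>v :: 'm \<Rightarrow> real^'m. \<forall>t. t \<bullet> (V *v t) = (\<Sum>i\<in>UNIV. (v i \<bullet> t)\<^sup>2)"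
proof -
  have "\<exists>(v :: 'm \<Rightarrow> real^'m) R. covariance_matrix R \<and> (\<forall>i\<in>S. R *v axis i 1 = 0) \<and>
      (\<forall>t. t \<bullet> (V *v t) = (\<Sum>i\<in>S. (v i \<bullet> t)\<^sup>2) + t \<bullet> (R *v t))"
    if "finite S" for S :: "'m set"
    using that
  proof (induction S)
    case empty
    then show ?case using V by auto
  next
    case (insert k S)
    then obtain v :: "'m \<Rightarrow> real^'m" and R where R: "covariance_matrix R" and ker: "\<And>i. i \<in> S \<Longrightarrow> R *v axis i 1 = 0"
      and dec: "\<And>t. t \<bullet> (V *v t) = (\<Sum>i\<in>S. (v i \<bullet> t)\<^sup>2) + t \<bullet> (R *v t)" by blast
    define e where "e = (axis k 1 :: real^'m)"
    define a where "a = e \<bullet> (R *v e)"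
    have a0: "0 \<le> a" unfolding a_def by (rule covariance_nonneg[OF R])
    show ?case
    proof (cases "a = 0")
      case True
      then have "R *v e = 0" unfolding a_def by (rule covariance_kernel[OF R])
      moreover have "(\<Sum>i\<in>insert k S. ((v(k := 0)) i \<bullet> t)\<^sup>2) = (\<Sum>i\<in>S. (v i \<bullet> t)\<^sup>2)" for t
        using insert.hyps by (auto intro!: sum.cong)
      ultimately show ?thesis
        using R ker dec by (intro exI[of _ "v(k := 0)"] exI[of _ R]) (auto simp: e_def)
    next
      case False
      with a0 have a: "0 < a" by simp
      \<comment> \<open>The normalised pivot column: subtracting the square of \<open>u\<close> puts
        \<open>e\<close> into the kernel, and the Cauchy-Schwarz inequality keeps the remainder
        nonnegative.\<close>
      define u where "u = (1 / sqrt a) *\<^sub>R (R *v e)"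
      define R' where "R' = (\<chi> i j. R $ i $ j - u $ i * u $ j)"
      have R'v: "R' *v t = R *v t - (u \<bullet> t) *\<^sub>R u" for t
        by (simp add: R'_def vec_eq_iff matrix_vector_mult_def inner_vec_def sum_subtractf
            sum_distrib_left sum_distrib_right algebra_simps)
      have tr: "transpose R = R" using R by (simp add: covariance_matrix_def)
      have ut: "u \<bullet> t = e \<bullet> (R *v t) / sqrt a" for t
        using symmetric_form[OF tr, of t e] by (simp add: u_def inner_commute)
      have ut2: "(u \<bullet> t)\<^sup>2 = (t \<bullet> (R *v e))\<^sup>2 / a" for t
        using a symmetric_form[OF tr, of t e] by (simp add: ut power_divide)
      have "covariance_matrix R'"
        unfolding covariance_matrix_def
      proof
        have "R $ i $ j = R $ j $ i" for i j using tr by (metis transpose_def vec_lambda_beta)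
        then show "transpose R' = R'" by (simp add: R'_def transpose_def vec_eq_iff mult.commute)
        show "\<forall>t. 0 \<le> t \<bullet> (R' *v t)"
        proof
          fix t
          have "t \<bullet> (R' *v t) = t \<bullet> (R *v t) - (u \<bullet> t)\<^sup>2"
            by (simp add: R'v inner_diff_right power2_eq_square inner_commute)
          then show "0 \<le> t \<bullet> (R' *v t)"
            using covariance_Cauchy_Schwarz[OF R, of e t] a by (simp add: ut2 a_def)
        qed
      qed
      moreover have "R' *v axis i 1 = 0" if "i \<in> insert k S" for i
      proof (cases "i = k")
        case True
        have "R' *v e = R *v e - (a / sqrt a * (1 / sqrt a)) *\<^sub>R (R *v e)"
          by (simp add: R'v ut a_def[symmetric]) (simp add: u_def)
        also have "a / sqrt a * (1 / sqrt a) = 1" using a by simp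
        finally show ?thesis using True by (simp add: e_def)
      next
        \<comment> \<open>Vectors already in the kernel stay there because
          \<open>u \<bullet> t\<close> is a multiple of \<open>e \<bullet> (R *v t)\<close>.\<close>
        case False
        then have "R *v axis i 1 = 0" using that ker by auto
        then show ?thesis by (simp add: R'v ut)
      qed
      moreover have "t \<bullet> (V *v t) = (\<Sum>i\<in>insert k S. ((v(k := u)) i \<bullet> t)\<^sup>2) + t \<bullet> (R' *v t)" for t
      proof -
        have "(\<Sum>i\<in>insert k S. ((v(k := u)) i \<bullet> t)\<^sup>2) = (u \<bullet> t)\<^sup>2 + (\<Sum>i\<in>S. (v i \<bullet> t)\<^sup>2)"
          using insert.hyps by (auto intro!: sum.cong)
        then show ?thesis
          by (simp add: dec[of t] R'v inner_diff_right power2_eq_square inner_commute)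
      qed
      ultimately show ?thesis by blast
    qed
  qed
  from this[OF finite_class.finite_UNIV] obtain v :: "'m \<Rightarrow> real^'m" and R :: "real^'m^'m"
    where "covariance_matrix R \<and> (\<forall>i\<in>UNIV. R *v axis i 1 = 0) \<and>
      (\<forall>t. t \<bullet> (V *v t) = (\<Sum>i\<in>UNIV. (v i \<bullet> t)\<^sup>2) + t \<bullet> (R *v t))" by (elim exE)
  then have R: "\<And>i. R *v axis i 1 = 0"
    and dec: "\<And>t. t \<bullet> (V *v t) = (\<Sum>i\<in>UNIV. (v i \<bullet> t)\<^sup>2) + t \<bullet> (R *v t)" by simp_all
  have "R = 0"
    using R by (simp add: vec_eq_iff matrix_vector_mult_basis column_def)
  then have "t \<bullet> (R *v t) = 0" for t by simp
  then show ?thesis using dec by auto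
qed


text \<open>Scaling a standard Gaussian by \<open>sqrt v\<close> includes the point mass at
  \<open>v = 0\<close>, so later computations treat both cases alike.\<close>

lemma normal_law_eq_distr:
  assumes "0 \<le> v"
  shows "normal_law 0 v = distr std_normal_distribution borel (\<lambda>x. sqrt v * x)"
proof (cases "v = 0")
  case True
  interpret prob_space std_normal_distribution by (rule prob_space_normal_density) simp
  have "distr std_normal_distribution borel (\<lambda>x. 0::real) = return borel 0"
    by (rule distr_const) simp_all
  then show ?thesis using True by (simp add: normal_law_def)
next
  case False
  then have v: "0 < sqrt v" using assms by simp
  interpret prob_space std_normal_distribution by (rule prob_space_normal_density) simp
  have "distributed std_normal_distribution lborel (\<lambda>x. x) std_normal_density"
    by (simp add: distributed_def distr_id2)
  then have "distributed std_normal_distribution lborel (\<lambda>x. sqrt v * x) (normal_density 0 (sqrt v))"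
    using normal_standard_normal_convert[OF v, of "\<lambda>x. sqrt v * x" 0] v by simp
  then have "distr std_normal_distribution lborel (\<lambda>x. sqrt v * x) = density lborel (normal_density 0 (sqrt v))"
    by (simp add: distributed_def)
  moreover have "distr std_normal_distribution lborel (\<lambda>x. sqrt v * x) = distr std_normal_distribution borel (\<lambda>x. sqrt v * x)"
    by (intro distr_cong) simp_all
  ultimately show ?thesis using False by (simp add: normal_law_def)
qed

lemma normal_law_char:
  assumes "0 \<le> v"
  shows "char (normal_law 0 v) s = complex_of_real (exp (- (s\<^sup>2 * v) / 2))"
proof -
  have "char (normal_law 0 v) s = char std_normal_distribution (s * sqrt v)"
    unfolding normal_law_eq_distr[OF assms] char_def by (subst integral_distr) (simp_all add: mult.assoc)
  then show ?thesis using assms by (simp add: char_std_normal_distribution power_mult_distrib)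
qed

lemma normal_law_distribution: "0 \<le> v \<Longrightarrow> real_distribution (normal_law 0 v)"
  unfolding normal_law_eq_distr
  by (intro prob_space.real_distribution_distr prob_space_normal_density) simp_all

text \<open>The integral depends only on the one-dimensional marginal in direction \<open>t\<close>;
  a cosine with phase \<open>b\<close> is the real part of its characteristic function rotated by
  \<open>b\<close>.\<close>

lemma multivariate_normal_cos:
  fixes V :: "real^'m::finite^'m"
  assumes N: "multivariate_normal N 0 V"
  shows "(\<integral>x. cos (t \<bullet> x + b) \<partial>N) = exp (- (t \<bullet> (V *v t)) / 2) * cos b"
proof -
  define v where "v = t \<bullet> (V *v t)"
  have v: "0 \<le> v" and eq: "distr N borel (\<lambda>x. t \<bullet> x) = normal_law 0 v" and sets: "sets N = sets borel"
    using N by (auto simp: multivariate_normal_def v_def covariance_matrix_def)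
  interpret L: real_distribution "normal_law 0 v" by (rule normal_law_distribution[OF v])
  have [measurable]: "(\<lambda>x. t \<bullet> x) \<in> borel_measurable N"
    by (simp add: measurable_cong_sets[OF sets refl])
  have "(\<integral>x. cos (t \<bullet> x + b) \<partial>N) = (\<integral>y. cos (y + b) \<partial>normal_law 0 v)"
    unfolding eq[symmetric] by (subst integral_distr) simp_all
  also have "\<dots> = (\<integral>y. Re (iexp b * iexp (1 * y)) \<partial>normal_law 0 v)"
    by (intro Bochner_Integration.integral_cong refl)
      (simp add: cis_conv_exp[symmetric] cis_mult add.commute flip: exp_add)
  also have "\<dots> = Re (\<integral>y. iexp b * iexp (1 * y) \<partial>normal_law 0 v)"
    by (intro integral_Re integrable_mult_right L.integrable_iexp) auto
  also have "\<dots> = Re (iexp b * char (normal_law 0 v) 1)"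
    by (simp add: char_def)
  also have "\<dots> = exp (- v / 2) * cos b"
    by (simp add: normal_law_char[OF v] cis_conv_exp[symmetric])
  finally show ?thesis by (simp add: v_def)
qed

text \<open>The law of a sum of the vectors \<open>v i\<close> with independent standard Gaussian
  coefficients, the \<open>v i\<close> coming from the decomposition of the form, which allows
  singular \<open>V\<close>. Characteristic functions identify the marginals.\<close>

lemma multivariate_normal_exists:
  fixes V :: "real^'m::finite^'m"
  assumes V: "covariance_matrix V"
  shows "\<exists>N. multivariate_normal N 0 V"
proof -
  obtain v :: "'m \<Rightarrow> real^'m" where v: "\<And>t. t \<bullet> (V *v t) = (\<Sum>i\<in>UNIV. (v i \<bullet> t)\<^sup>2)"
    using covariance_decomposition[OF V] by blast
  define G where "G = (\<Pi>\<^sub>M i\<in>(UNIV::'m set). std_normal_distribution)"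
  interpret S: prob_space std_normal_distribution by (rule prob_space_normal_density) simp
  interpret product_prob_space "\<lambda>_. std_normal_distribution" "UNIV :: 'm set" by unfold_locales
  interpret G: prob_space G unfolding G_def by (rule prob_space_PiM) unfold_locales
  have component_measurable[measurable]: "(\<lambda>z. z i) \<in> borel_measurable G" for i
    unfolding G_def using measurable_component_singleton[of i UNIV "\<lambda>_. std_normal_distribution"] by simp
  have marg: "distr G std_normal_distribution (\<lambda>z. z i) = std_normal_distribution" for i
    unfolding G_def by (rule PiM_component) simp
  define N where "N = distr G borel (\<lambda>z. \<Sum>i\<in>UNIV. z i *\<^sub>R v i)"
  have "distr N borel (\<lambda>x. t \<bullet> x) = normal_law 0 (t \<bullet> (V *v t))" for t
  proof -
    have 1: "distr N borel (\<lambda>x. t \<bullet> x) = distr G borel (\<lambda>z. \<Sum>i\<in>UNIV. z i * (v i \<bullet> t))"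
      unfolding N_def by (subst distr_distr) (simp_all add: o_def inner_sum_right inner_commute)
    have ind: "G.indep_vars (\<lambda>_. borel) (\<lambda>i z. z i * (v i \<bullet> t)) UNIV"
    proof (rule G.indep_vars_compose2[where X="\<lambda>i z. z i" and M'="\<lambda>_. std_normal_distribution"])
      show "G.indep_vars (\<lambda>_. std_normal_distribution) (\<lambda>i z. z i) UNIV"
      proof (subst G.indep_vars_iff_distr_eq_PiM')
        have "distr G (\<Pi>\<^sub>M i\<in>(UNIV::'m set). std_normal_distribution) (\<lambda>z. \<lambda>i\<in>UNIV. z i) = distr G G (\<lambda>z. z)"
          by (simp add: G_def restrict_UNIV)
        also have "\<dots> = (\<Pi>\<^sub>M i\<in>UNIV. distr G std_normal_distribution (\<lambda>z. z i))"
          by (simp add: distr_id2 marg) (simp add: G_def)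
        finally show "distr G (\<Pi>\<^sub>M i\<in>(UNIV::'m set). std_normal_distribution) (\<lambda>z. \<lambda>i\<in>UNIV. z i)
          = (\<Pi>\<^sub>M i\<in>UNIV. distr G std_normal_distribution (\<lambda>z. z i))" .
      qed (simp_all add: component_measurable)
    qed simp
    have comp: "char (distr G borel (\<lambda>z. z i * c)) s = complex_of_real (exp (- (s\<^sup>2 * c\<^sup>2) / 2))" for i c s
    proof -
      have "char (distr G borel (\<lambda>z. z i * c)) s = (CLINT z|G. iexp (s * c * z i))"
        unfolding char_def by (subst integral_distr) (simp_all add: mult_ac)
      also have "\<dots> = (CLINT x|distr G std_normal_distribution (\<lambda>z. z i). iexp (s * c * x))"
        by (subst integral_distr) (simp_all add: component_measurable)
      also have "distr G std_normal_distribution (\<lambda>z. z i) = std_normal_distribution"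
        by (rule marg)
      also have "(CLINT x|std_normal_distribution. iexp (s * c * x)) = char std_normal_distribution (s * c)"
        by (simp add: char_def)
      finally show ?thesis by (simp add: char_std_normal_distribution power_mult_distrib)
    qed
    have "char (distr G borel (\<lambda>z. \<Sum>i\<in>UNIV. z i * (v i \<bullet> t))) = char (normal_law 0 (t \<bullet> (V *v t)))"
    proof
      fix s
      have "char (distr G borel (\<lambda>z. \<Sum>i\<in>UNIV. z i * (v i \<bullet> t))) s
         = (\<Prod>i\<in>UNIV. complex_of_real (exp (- (s\<^sup>2 * (v i \<bullet> t)\<^sup>2) / 2)))"
        by (simp add: G.char_distr_sum[OF ind] comp)
      also have "\<dots> = complex_of_real (exp (\<Sum>i\<in>UNIV. - (s\<^sup>2 * (v i \<bullet> t)\<^sup>2) / 2))"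
        by (simp add: exp_sum)
      also have "(\<Sum>i\<in>UNIV. - (s\<^sup>2 * (v i \<bullet> t)\<^sup>2) / 2) = - (s\<^sup>2 * (t \<bullet> (V *v t))) / 2"
        by (simp add: v sum_negf sum_divide_distrib[symmetric] sum_distrib_left)
      finally show "char (distr G borel (\<lambda>z. \<Sum>i\<in>UNIV. z i * (v i \<bullet> t))) s = char (normal_law 0 (t \<bullet> (V *v t))) s"
        by (simp add: normal_law_char covariance_nonneg[OF V])
    qed
    then show ?thesis unfolding 1
      by (intro Levy_uniqueness G.real_distribution_distr normal_law_distribution covariance_nonneg[OF V]) simp_all
  qed
  moreover have "prob_space N" unfolding N_def by (rule G.prob_space_distr) simp
  ultimately have "multivariate_normal N 0 V"
    using V by (simp add: multivariate_normal_def N_def)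
  then show ?thesis by blast
qed


section \<open>A single run given the past\<close>

definition alive :: "'s set \<Rightarrow> nat \<Rightarrow> (nat \<Rightarrow> 's) \<Rightarrow> real" where
  "alive T k p = of_bool (\<forall>j\<le>k. p j \<in> T)"

text \<open>Survival up to time \<open>k\<close> is part of the indicator. It thus vanishes after
  the first exit for every function \<open>p\<close>, including those that return to
  \<open>T\<close>, which are excluded for the process only almost surely.\<close>

definition occupies :: "'s set \<Rightarrow> ('m \<Rightarrow> 's) \<Rightarrow> nat \<Rightarrow> 'm \<Rightarrow> (nat \<Rightarrow> 's) \<Rightarrow> real" where
  "occupies T idx k i p = of_bool ((\<forall>j\<le>k. p j \<in> T) \<and> p k = idx i)"

text \<open>A single run with past \<open>F\<close> and random initial law \<open>x\<close>. The
  moment computations are made once here and later instantiated for every run of the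
  algorithm.\<close>

locale conditional_run = perron_chain P T idx Q w qsd l + prob_space M
  for P :: "real^'s::finite^'s" and T and idx :: "'m::finite \<Rightarrow> 's" and Q w qsd l and M :: "'w measure" +
  fixes F :: "'w measure" and x :: "'w \<Rightarrow> real^'m" and X :: "nat \<Rightarrow> 'w \<Rightarrow> 's"
  assumes sub: "subalgebra M F" and x_F[measurable]: "x \<in> borel_measurable F"
    and x_simplex: "AE \<omega> in M. x \<omega> \<in> prob_simplex"
    and X_M[measurable]: "\<And>k. X k \<in> M \<rightarrow>\<^sub>M count_space UNIV"
    and cond: "\<And>k s. AE \<omega> in M.
      real_cond_exp M F (indicator {\<omega>\<in>space M. \<forall>j\<le>k. X j \<omega> = s j}) \<omega> =
      path_prob P (extend_distribution idx (x \<omega>)) k s"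
begin

abbreviation "traj \<omega> \<equiv> (\<lambda>k. X k \<omega>)"
abbreviation "alv \<equiv> alive T"
abbreviation "occ \<equiv> occupies T idx"

lemma inj_idx: "inj idx" and idx_T: "idx i \<in> T" and range_idx: "y \<in> T \<Longrightarrow> \<exists>i. y = idx i"
  using chain by (auto simp: irreducible_absorbing_chain_def bij_betw_def)

lemma F_M: "f \<in> borel_measurable F \<Longrightarrow> f \<in> borel_measurable M"
  using measurable_from_subalg[OF sub] .

lemma x_M[measurable]: "x \<in> borel_measurable M" by (rule F_M[OF x_F])

lemma x_nth_M[measurable]: "(\<lambda>\<omega>. x \<omega> $ i) \<in> borel_measurable M"
  by (rule measurable_compose[OF x_M]) (intro borel_measurable_continuous_onI continuous_intros)

lemma extend_idx: "extend_distribution idx v (idx i) = v $ i"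
proof -
  have "{j. idx j = idx i} = {i}" using inj_idx by (auto dest: injD)
  then show ?thesis by (simp add: extend_distribution_def)
qed

lemma extend_M[measurable]: "(\<lambda>\<omega>. extend_distribution idx (x \<omega>) y) \<in> borel_measurable M"
  unfolding extend_distribution_def by measurable

definition cyl :: "nat \<Rightarrow> (nat \<Rightarrow> 's) \<Rightarrow> 'w \<Rightarrow> real" where
  "cyl k s \<omega> = of_bool (\<forall>j\<le>k. X j \<omega> = s j)"

lemma cyl_M[measurable]: "cyl k s \<in> borel_measurable M"
  unfolding cyl_def by measurable

text \<open>The defining property of conditional expectation, specialised to cylinders. This is the
  point where the conditional law of the run enters; the later moment identities are derived from
  it.\<close>

lemma cylinder_integral:
  assumes Z: "Z \<in> borel_measurable F" "integrable M Z"
  shows "(\<integral>\<omega>. Z \<omega> * cyl k s \<omega> \<partial>M) = (\<integral>\<omega>. Z \<omega> * path_prob P (extend_distribution idx (x \<omega>)) k s \<partial>M)"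
proof -
  interpret finite_measure_subalgebra M F by unfold_locales (rule sub)
  have [measurable]: "Z \<in> borel_measurable M" by (rule F_M[OF Z(1)])
  define C where "C = {\<omega>\<in>space M. \<forall>j\<le>k. X j \<omega> = s j}"
  have [measurable]: "C \<in> sets M" unfolding C_def by measurable
  have "(\<integral>\<omega>. Z \<omega> * cyl k s \<omega> \<partial>M) = (\<integral>\<omega>. Z \<omega> * indicator C \<omega> \<partial>M)"
    by (intro Bochner_Integration.integral_cong refl) (simp add: cyl_def C_def indicator_def)
  also have "\<dots> = (\<integral>\<omega>. Z \<omega> * real_cond_exp M F (indicator C) \<omega> \<partial>M)"
    by (intro real_cond_exp_intg(2)[symmetric] Z)
      (auto intro!: Bochner_Integration.integrable_bound[OF Z(2)] simp: indicator_def)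
  also have "\<dots> = (\<integral>\<omega>. Z \<omega> * path_prob P (extend_distribution idx (x \<omega>)) k s \<partial>M)"
  proof (rule integral_cong_AE)
    show "AE \<omega> in M. Z \<omega> * real_cond_exp M F (indicator C) \<omega> =
        Z \<omega> * path_prob P (extend_distribution idx (x \<omega>)) k s"
      using cond[of k s] unfolding C_def by eventually_elim simp
    show "(\<lambda>\<omega>. Z \<omega> * path_prob P (extend_distribution idx (x \<omega>)) k s) \<in> borel_measurable M"
      unfolding path_prob_def by measurable
    show "(\<lambda>\<omega>. Z \<omega> * real_cond_exp M F (indicator C) \<omega>) \<in> borel_measurable M"
      by measurable
  qed
  finally show ?thesis .
qed

definition depends_upto :: "nat \<Rightarrow> ((nat \<Rightarrow> 's) \<Rightarrow> real) \<Rightarrow> bool" where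
  "depends_upto k f \<longleftrightarrow> (\<forall>p q. (\<forall>j\<le>k. p j = q j) \<longrightarrow> f p = f q)"

text \<open>With finitely many states, a functional of the first \<open>k + 1\<close> states is a
  finite combination of cylinder indicators. Extensional functions on \<open>{..k}\<close> provide a
  finite index set with one path per cylinder.\<close>

lemma depends_cylinders:
  assumes "depends_upto k f"
  shows "f (traj \<omega>) = (\<Sum>s\<in>PiE {..k} (\<lambda>_. UNIV). f s * cyl k s \<omega>)"
proof -
  define r where "r = restrict (traj \<omega>) {..k}"
  have r: "r \<in> PiE {..k} (\<lambda>_. UNIV)" by (simp add: r_def)
  have "(\<Sum>s\<in>PiE {..k} (\<lambda>_. UNIV). f s * cyl k s \<omega>) = (\<Sum>s\<in>PiE {..k} (\<lambda>_. UNIV). if s = r then f r else 0)"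
  proof (intro sum.cong refl)
    fix s assume s: "s \<in> PiE {..k} (\<lambda>_. UNIV :: 's set)"
    have "(\<forall>j\<le>k. X j \<omega> = s j) \<longleftrightarrow> s = r"
      using s by (auto simp: r_def PiE_def extensional_def)
    then show "f s * cyl k s \<omega> = (if s = r then f r else 0)" by (simp add: cyl_def)
  qed
  also have "\<dots> = f r" using r by (simp add: finite_PiE)
  also have "\<dots> = f (traj \<omega>)"
    using assms unfolding depends_upto_def by (auto simp: r_def)
  finally show ?thesis by simp
qed

lemma integrable_cyl: "integrable M Z \<Longrightarrow> integrable M (\<lambda>\<omega>. Z \<omega> * cyl k s \<omega>)"
  by (rule integrable_mult_bounded[where B=1]) (auto simp: cyl_def)

lemma integral_depends:
  assumes Z: "integrable M Z" and f: "depends_upto k f"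
  shows "(\<integral>\<omega>. Z \<omega> * f (traj \<omega>) \<partial>M) = (\<Sum>s\<in>PiE {..k} (\<lambda>_. UNIV). f s * (\<integral>\<omega>. Z \<omega> * cyl k s \<omega> \<partial>M))"
proof -
  have "(\<integral>\<omega>. Z \<omega> * f (traj \<omega>) \<partial>M) = (\<integral>\<omega>. (\<Sum>s\<in>PiE {..k} (\<lambda>_. UNIV). f s * (Z \<omega> * cyl k s \<omega>)) \<partial>M)"
    by (intro Bochner_Integration.integral_cong refl)
      (simp add: depends_cylinders[OF f] sum_distrib_left mult_ac)
  also have "\<dots> = (\<Sum>s\<in>PiE {..k} (\<lambda>_. UNIV). f s * (\<integral>\<omega>. Z \<omega> * cyl k s \<omega> \<partial>M))"
    using integrable_cyl[OF Z] by (subst Bochner_Integration.integral_sum) auto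
  finally show ?thesis .
qed

text \<open>Prolonging a cylinder by one state multiplies \<open>path_prob\<close> by one transition
  probability; linearity extends this from cylinders to \<open>f\<close>.\<close>

lemma markov_step:
  assumes Z: "Z \<in> borel_measurable F" "integrable M Z" and f: "depends_upto k f"
  shows "(\<integral>\<omega>. Z \<omega> * (f (traj \<omega>) * of_bool (X (Suc k) \<omega> = y)) \<partial>M) = (\<integral>\<omega>. Z \<omega> * (f (traj \<omega>) * P $ X k \<omega> $ y) \<partial>M)"
proof -
  have a: "(\<integral>\<omega>. Z \<omega> * (cyl k s \<omega> * of_bool (X (Suc k) \<omega> = y)) \<partial>M) = P $ s k $ y * (\<integral>\<omega>. Z \<omega> * cyl k s \<omega> \<partial>M)" for s
  proof -
    define s' where "s' = s(Suc k := y)"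
    have pp: "path_prob P v (Suc k) s' = path_prob P v k s * P $ s k $ y" for v
      by (simp add: path_prob_def s'_def)
    have "cyl k s \<omega> * of_bool (X (Suc k) \<omega> = y) = cyl (Suc k) s' \<omega>" for \<omega>
      by (auto simp: cyl_def s'_def le_Suc_eq)
    then have "(\<integral>\<omega>. Z \<omega> * (cyl k s \<omega> * of_bool (X (Suc k) \<omega> = y)) \<partial>M) = (\<integral>\<omega>. Z \<omega> * cyl (Suc k) s' \<omega> \<partial>M)" by simp
    also have "\<dots> = (\<integral>\<omega>. P $ s k $ y * (Z \<omega> * path_prob P (extend_distribution idx (x \<omega>)) k s) \<partial>M)"
      unfolding cylinder_integral[OF Z] pp by (simp add: mult_ac)
    also have "\<dots> = P $ s k $ y * (\<integral>\<omega>. Z \<omega> * cyl k s \<omega> \<partial>M)"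
      by (simp add: cylinder_integral[OF Z])
    finally show ?thesis .
  qed
  have "(\<integral>\<omega>. Z \<omega> * (f (traj \<omega>) * of_bool (X (Suc k) \<omega> = y)) \<partial>M)
     = (\<integral>\<omega>. (\<Sum>s\<in>PiE {..k} (\<lambda>_. UNIV). f s * (Z \<omega> * (cyl k s \<omega> * of_bool (X (Suc k) \<omega> = y)))) \<partial>M)"
    by (intro Bochner_Integration.integral_cong refl)
      (simp add: depends_cylinders[OF f] sum_distrib_left sum_distrib_right mult_ac)
  also have "\<dots> = (\<Sum>s\<in>PiE {..k} (\<lambda>_. UNIV). f s * (P $ s k $ y * (\<integral>\<omega>. Z \<omega> * cyl k s \<omega> \<partial>M)))"
    unfolding a[symmetric]
    by (subst Bochner_Integration.integral_sum)
      (auto intro!: integrable_mult_right integrable_mult_bounded[where B=1] Z simp: cyl_def)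
  also have "\<dots> = (\<integral>\<omega>. Z \<omega> * (f (traj \<omega>) * P $ X k \<omega> $ y) \<partial>M)"
    using f integral_depends[OF Z(2), of k "\<lambda>p. f p * P $ p k $ y"]
    by (auto simp: depends_upto_def mult.assoc)
  finally show ?thesis .
qed

lemma occ_M[measurable]: "(\<lambda>\<omega>. occ k i (traj \<omega>)) \<in> borel_measurable M"
  unfolding occupies_def by measurable

lemma alv_M[measurable]: "(\<lambda>\<omega>. alv k (traj \<omega>)) \<in> borel_measurable M"
  unfolding alive_def by measurable

lemma occ_depends: "k \<le> n \<Longrightarrow> depends_upto n (occ k i)"
  unfolding depends_upto_def occupies_def by auto

lemma alv_eq_sum: "alv k p = (\<Sum>i\<in>UNIV. occ k i p)"
proof (cases "\<forall>j\<le>k. p j \<in> T")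
  case True
  then obtain i where i: "p k = idx i" using range_idx[of "p k"] by auto
  have "occ k j p = (if j = i then 1 else 0)" for j
    using True i inj_idx by (auto simp: occupies_def dest: injD)
  then show ?thesis using True by (simp add: alive_def)
next
  case False
  then have "occ k j p = 0" for j by (auto simp: occupies_def)
  then show ?thesis using False by (auto simp: alive_def)
qed

lemma occ_bounds: "0 \<le> occ k i p" "occ k i p \<le> 1" by (auto simp: occupies_def)

lemma occ_mult: "occ k i p * occ k j p = (if i = j then occ k i p else 0)"
  using inj_idx by (auto simp: occupies_def dest: injD)

lemma depends_bounded: "depends_upto k f \<Longrightarrow> \<exists>B. \<forall>p. \<bar>f p\<bar> \<le> B"
proof -
  assume f: "depends_upto k f"
  have "\<bar>f p\<bar> \<le> (\<Sum>s\<in>PiE {..k} (\<lambda>_. UNIV). \<bar>f s\<bar>)" for p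
  proof -
    have "f p = f (restrict p {..k})" using f unfolding depends_upto_def by auto
    then show ?thesis
      using member_le_sum[of "restrict p {..k}" "PiE {..k} (\<lambda>_. UNIV)" "\<lambda>s. \<bar>f s\<bar>"] by (simp add: finite_PiE)
  qed
  then show ?thesis by blast
qed

lemma depends_M: "depends_upto k f \<Longrightarrow> (\<lambda>\<omega>. f (traj \<omega>)) \<in> borel_measurable M"
  by (simp add: depends_cylinders)

lemma occ_step:
  assumes Z: "Z \<in> borel_measurable F" "integrable M Z" and f: "depends_upto k f"
  shows "(\<integral>\<omega>. Z \<omega> * (f (traj \<omega>) * occ (Suc k) j (traj \<omega>)) \<partial>M)
    = (\<Sum>i\<in>UNIV. Q $ i $ j * (\<integral>\<omega>. Z \<omega> * (f (traj \<omega>) * occ k i (traj \<omega>)) \<partial>M))"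
proof -
  have fk: "depends_upto k (\<lambda>p. f p * occ k i p)" for i
    using f occ_depends[OF order_refl, of k i] unfolding depends_upto_def by metis
  have int: "integrable M (\<lambda>\<omega>. Z \<omega> * (f (traj \<omega>) * occ k i (traj \<omega>) * of_bool (X (Suc k) \<omega> = idx j)))" for i
  proof -
    obtain B where B: "\<And>p. \<bar>f p\<bar> \<le> B" using depends_bounded[OF f] by blast
    have [measurable]: "(\<lambda>\<omega>. f (traj \<omega>)) \<in> borel_measurable M" by (rule depends_M[OF f])
    have B0: "0 \<le> B" using B by (meson abs_ge_zero order_trans)
    show ?thesis
      by (intro integrable_mult_bounded[where B=B] Z AE_I2, measurable)
        (auto simp: occupies_def abs_mult B B0)
  qed
  have eq: "occ (Suc k) j p = (\<Sum>i\<in>UNIV. occ k i p * of_bool (p (Suc k) = idx j))" for p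
  proof -
    have "occ (Suc k) j p = alv k p * of_bool (p (Suc k) = idx j)"
      using idx_T[of j] by (auto simp: occupies_def alive_def le_Suc_eq)
    then show ?thesis by (simp add: alv_eq_sum sum_distrib_right)
  qed
  have "(\<integral>\<omega>. Z \<omega> * (f (traj \<omega>) * occ (Suc k) j (traj \<omega>)) \<partial>M)
     = (\<integral>\<omega>. (\<Sum>i\<in>UNIV. Z \<omega> * (f (traj \<omega>) * occ k i (traj \<omega>) * of_bool (X (Suc k) \<omega> = idx j))) \<partial>M)"
    by (simp only: eq sum_distrib_left mult.assoc)
  also have "\<dots> = (\<Sum>i\<in>UNIV. (\<integral>\<omega>. Z \<omega> * (f (traj \<omega>) * occ k i (traj \<omega>) * of_bool (X (Suc k) \<omega> = idx j)) \<partial>M))"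
    using int by (rule Bochner_Integration.integral_sum)
  also have "\<dots> = (\<Sum>i\<in>UNIV. Q $ i $ j * (\<integral>\<omega>. Z \<omega> * (f (traj \<omega>) * occ k i (traj \<omega>)) \<partial>M))"
  proof (intro sum.cong refl)
    fix i
    have "(\<integral>\<omega>. Z \<omega> * (f (traj \<omega>) * occ k i (traj \<omega>) * of_bool (X (Suc k) \<omega> = idx j)) \<partial>M)
       = (\<integral>\<omega>. Z \<omega> * (f (traj \<omega>) * occ k i (traj \<omega>) * P $ X k \<omega> $ idx j) \<partial>M)"
      by (rule markov_step[OF Z fk])
    also have "\<dots> = (\<integral>\<omega>. Q $ i $ j * (Z \<omega> * (f (traj \<omega>) * occ k i (traj \<omega>))) \<partial>M)"
      by (intro Bochner_Integration.integral_cong refl) (auto simp: occupies_def Q_eq restrict_matrix_def)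
    finally show "(\<integral>\<omega>. Z \<omega> * (f (traj \<omega>) * occ k i (traj \<omega>) * of_bool (X (Suc k) \<omega> = idx j)) \<partial>M)
      = Q $ i $ j * (\<integral>\<omega>. Z \<omega> * (f (traj \<omega>) * occ k i (traj \<omega>)) \<partial>M)" by simp
  qed
  finally show ?thesis .
qed

lemma occ_steps:
  assumes Z: "Z \<in> borel_measurable F" "integrable M Z" and f: "depends_upto k f"
  shows "(\<integral>\<omega>. Z \<omega> * (f (traj \<omega>) * occ (k + d) j (traj \<omega>)) \<partial>M)
    = (\<Sum>i\<in>UNIV. Qk d $ i $ j * (\<integral>\<omega>. Z \<omega> * (f (traj \<omega>) * occ k i (traj \<omega>)) \<partial>M))"
proof (induction d arbitrary: j)
  case 0
  show ?case by (simp add: mat_def if_distrib[of "\<lambda>c. c * _"] cong: if_cong)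
next
  case (Suc d)
  have fd: "depends_upto (k + d) f" using f unfolding depends_upto_def by auto
  have "(\<integral>\<omega>. Z \<omega> * (f (traj \<omega>) * occ (k + Suc d) j (traj \<omega>)) \<partial>M)
    = (\<Sum>m\<in>UNIV. Q $ m $ j * (\<Sum>i\<in>UNIV. Qk d $ i $ m * (\<integral>\<omega>. Z \<omega> * (f (traj \<omega>) * occ k i (traj \<omega>)) \<partial>M)))"
    using occ_step[OF Z fd, of j] by (simp add: Suc.IH)
  also have "\<dots> = (\<Sum>i\<in>UNIV. \<Sum>m\<in>UNIV. Qk d $ i $ m * Q $ m $ j * (\<integral>\<omega>. Z \<omega> * (f (traj \<omega>) * occ k i (traj \<omega>)) \<partial>M))"
    unfolding sum_distrib_left by (subst sum.swap) (simp add: mult_ac)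
  finally show ?case by (simp add: matrix_matrix_nth sum_distrib_right)
qed

lemma x_nth_bound: "AE \<omega> in M. \<bar>x \<omega> $ i\<bar> \<le> 1"
  using x_simplex by eventually_elim (simp add: simplex_nonneg simplex_nth_le1)

lemma integrable_x: "integrable M Z \<Longrightarrow> integrable M (\<lambda>\<omega>. Z \<omega> * x \<omega> $ i)"
  by (rule integrable_mult_bounded[OF _ _ x_nth_bound]) auto

text \<open>At time 0 the conditional probability of \<open>idx i\<close> is \<open>x $ i\<close>,
  and powers of \<open>Q\<close> transport it to time \<open>k\<close>.\<close>

lemma occ_mean:
  assumes Z: "Z \<in> borel_measurable F" "integrable M Z"
  shows "(\<integral>\<omega>. Z \<omega> * occ k j (traj \<omega>) \<partial>M) = (\<Sum>i\<in>UNIV. Qk k $ i $ j * (\<integral>\<omega>. Z \<omega> * x \<omega> $ i \<partial>M))"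
proof -
  have 0: "(\<integral>\<omega>. Z \<omega> * occ 0 i (traj \<omega>) \<partial>M) = (\<integral>\<omega>. Z \<omega> * x \<omega> $ i \<partial>M)" for i
  proof -
    have "occ 0 i (traj \<omega>) = cyl 0 (\<lambda>_. idx i) \<omega>" for \<omega>
      using idx_T[of i] by (auto simp: occupies_def cyl_def)
    then have "(\<integral>\<omega>. Z \<omega> * occ 0 i (traj \<omega>) \<partial>M) = (\<integral>\<omega>. Z \<omega> * cyl 0 (\<lambda>_. idx i) \<omega> \<partial>M)" by simp
    then show ?thesis unfolding cylinder_integral[OF Z] by (simp add: path_prob_def extend_idx)
  qed
  show ?thesis
    using occ_steps[OF Z, of 0 "\<lambda>_. 1" k j] by (simp add: depends_upto_def 0)
qed

text \<open>Two states are not occupied at the same time, so multiplying by the indicator of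
  \<open>i\<close> at time \<open>a\<close> leaves one term of the sum in
  \<open>occ_steps\<close>.\<close>

lemma occ_pair:
  assumes Z: "Z \<in> borel_measurable F" "integrable M Z"
  shows "(\<integral>\<omega>. Z \<omega> * (occ a i (traj \<omega>) * occ (a + d) j (traj \<omega>)) \<partial>M)
     = (\<Sum>m\<in>UNIV. Qk a $ m $ i * Qk d $ i $ j * (\<integral>\<omega>. Z \<omega> * x \<omega> $ m \<partial>M))"
proof -
  have "(\<integral>\<omega>. Z \<omega> * (occ a i (traj \<omega>) * occ (a + d) j (traj \<omega>)) \<partial>M)
     = (\<Sum>m\<in>UNIV. Qk d $ m $ j * (if i = m then (\<integral>\<omega>. Z \<omega> * occ a i (traj \<omega>) \<partial>M) else 0))"
    unfolding occ_steps[OF Z occ_depends[OF order_refl]] occ_mult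
    by (intro sum.cong refl) auto
  also have "\<dots> = Qk d $ i $ j * (\<integral>\<omega>. Z \<omega> * occ a i (traj \<omega>) \<partial>M)"
    by (simp add: if_distrib cong: if_cong)
  finally show ?thesis by (simp add: occ_mean[OF Z] sum_distrib_left mult_ac)
qed

lemma occ_pair_sum:
  assumes Z: "Z \<in> borel_measurable F" "integrable M Z"
  shows "(\<integral>\<omega>. Z \<omega> * ((\<Sum>k<K. occ k i (traj \<omega>)) * (\<Sum>k<K. occ k j (traj \<omega>))) \<partial>M)
     = (\<Sum>m\<in>UNIV. visits_cov_upto K m i j * (\<integral>\<omega>. Z \<omega> * x \<omega> $ m \<partial>M))"
proof -
  have int: "integrable M (\<lambda>\<omega>. Z \<omega> * (occ a i (traj \<omega>) * occ b j (traj \<omega>)))" for a b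
    by (rule integrable_mult_bounded[where B=1]) (auto simp: Z occupies_def)
  have pair: "(\<integral>\<omega>. Z \<omega> * (occ a i (traj \<omega>) * occ b j (traj \<omega>)) \<partial>M)
     = (\<Sum>m\<in>UNIV. (if a \<le> b then Qk a $ m $ i * Qk (b - a) $ i $ j else Qk b $ m $ j * Qk (a - b) $ j $ i)
        * (\<integral>\<omega>. Z \<omega> * x \<omega> $ m \<partial>M))" for a b
  proof (cases "a \<le> b")
    case True then show ?thesis using occ_pair[OF Z, of a i "b - a" j] by simp
  next
    case False then show ?thesis using occ_pair[OF Z, of b j "a - b" i] by (simp add: mult.commute)
  qed
  have "(\<integral>\<omega>. Z \<omega> * ((\<Sum>k<K. occ k i (traj \<omega>)) * (\<Sum>k<K. occ k j (traj \<omega>))) \<partial>M)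
    = (\<integral>\<omega>. (\<Sum>a<K. \<Sum>b<K. Z \<omega> * (occ a i (traj \<omega>) * occ b j (traj \<omega>))) \<partial>M)"
    by (simp only: sum_product) (simp only: sum_distrib_left)
  also have "\<dots> = (\<Sum>a<K. \<Sum>b<K. (\<integral>\<omega>. Z \<omega> * (occ a i (traj \<omega>) * occ b j (traj \<omega>)) \<partial>M))"
    using int by (subst Bochner_Integration.integral_sum; (intro Bochner_Integration.integrable_sum)?; simp)
  also have "\<dots> = (\<Sum>m\<in>UNIV. visits_cov_upto K m i j * (\<integral>\<omega>. Z \<omega> * x \<omega> $ m \<partial>M))"
    unfolding pair visits_cov_upto_def sum_distrib_right
    by (subst (2) sum.swap, subst sum.swap, rule refl)
  finally show ?thesis .
qed


section \<open>Run length and visit counts\<close>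

definition life :: "'w \<Rightarrow> nat" where "life \<omega> = absorption_time T (traj \<omega>)"

definition visits :: "'w \<Rightarrow> real^'m" where
  "visits \<omega> = (\<chi> i. \<Sum>k<life \<omega>. of_bool (X k \<omega> = idx i))"

text \<open>The measure space \<open>G\<close> is arbitrary because a finished run must also be
  measurable for the later histories that contain it.\<close>

lemma life_measurable:
  assumes [measurable]: "\<And>k. X k \<in> G \<rightarrow>\<^sub>M count_space UNIV"
  shows "life \<in> G \<rightarrow>\<^sub>M count_space UNIV"
  unfolding life_def absorption_time_def by measurable

lemma life_M[measurable]: "life \<in> M \<rightarrow>\<^sub>M count_space UNIV"
  by (rule life_measurable) measurable

lemma alive_before_life: "k < life \<omega> \<Longrightarrow> X k \<omega> \<in> T"
  unfolding life_def absorption_time_def using not_less_Least by blast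

lemma visits_nth: "visits \<omega> $ i = (\<Sum>k<life \<omega>. occ k i (traj \<omega>))"
  unfolding visits_def by (auto simp: occupies_def alive_before_life intro!: sum.cong)

lemma visits_nn: "0 \<le> visits \<omega> $ i"
  unfolding visits_nth by (intro sum_nonneg occ_bounds)

lemma visits_sum: "(\<Sum>i\<in>UNIV. visits \<omega> $ i) = real (life \<omega>)"
proof -
  have "(\<Sum>i\<in>UNIV. visits \<omega> $ i) = (\<Sum>k<life \<omega>. alv k (traj \<omega>))"
    unfolding visits_nth alv_eq_sum by (rule sum.swap)
  also have "\<dots> = (\<Sum>k<life \<omega>. 1)"
    by (intro sum.cong refl) (auto simp: alive_def alive_before_life)
  finally show ?thesis by simp
qed

lemma visits_le_life: "visits \<omega> $ i \<le> real (life \<omega>)"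
  unfolding visits_sum[symmetric] by (rule member_le_sum) (auto simp: visits_nn)

lemma visits_measurable:
  assumes [measurable]: "\<And>k. X k \<in> G \<rightarrow>\<^sub>M count_space UNIV"
  shows "visits \<in> borel_measurable G"
proof -
  have "(\<lambda>\<omega>. \<Sum>k<life \<omega>. of_bool (X k \<omega> = idx i) :: real) \<in> borel_measurable G" for i
    by (rule measurable_compose_countable[OF _ life_measurable[OF assms]]) measurable
  then have "(\<lambda>\<omega>. visits \<omega> \<bullet> b) \<in> borel_measurable G" if "b \<in> Basis" for b
    using that by (auto simp: Basis_vec_def inner_axis visits_def)
  then show ?thesis by (subst borel_measurable_euclidean_space) auto
qed

lemma visits_M[measurable]: "visits \<in> borel_measurable M"
  by (rule visits_measurable) measurable

lemma visits_nth_M[measurable]: "(\<lambda>\<omega>. visits \<omega> $ i) \<in> borel_measurable M"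
  by (rule measurable_compose[OF visits_M]) (intro borel_measurable_continuous_onI continuous_intros)

text \<open>One factor \<open>CARD('m)\<close> sums over the initial state, the other over the state
  at time \<open>k\<close>.\<close>

definition tail_const :: real where "tail_const = real CARD('m) * (real CARD('m) * spread)"

lemma tail_const_nn: "0 \<le> tail_const" unfolding tail_const_def using spread_nn by simp

lemma alive_mean: "(\<integral>\<omega>. alv k (traj \<omega>) \<partial>M) \<le> tail_const * l ^ k"
proof -
  have [simp]: "integrable M (\<lambda>\<omega>. occ k i (traj \<omega>))" for i
    by (rule integrable_const_bound[where B=1]) (auto simp: occupies_def)
  have one: "(\<lambda>_. 1::real) \<in> borel_measurable F" "integrable M (\<lambda>_. 1::real)" by auto
  have "(\<integral>\<omega>. occ k j (traj \<omega>) \<partial>M) \<le> real CARD('m) * (spread * l ^ k)" for j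
  proof -
    have "(\<integral>\<omega>. occ k j (traj \<omega>) \<partial>M) = (\<Sum>i\<in>UNIV. Qk k $ i $ j * (\<integral>\<omega>. x \<omega> $ i \<partial>M))"
      using occ_mean[OF one, of k j] by (simp only: mult_1)
    also have "\<dots> \<le> (\<Sum>i\<in>(UNIV::'m set). spread * l ^ k * 1)"
    proof (intro sum_mono mult_mono Qk_bound)
      fix i
      have "(\<integral>\<omega>. x \<omega> $ i \<partial>M) \<le> (\<integral>\<omega>. 1 \<partial>M)"
        using x_nth_bound[of i] integrable_x[OF one(2), of i]
        by (intro integral_mono_AE one) (simp_all add: abs_le_iff)
      then show "(\<integral>\<omega>. x \<omega> $ i \<partial>M) \<le> 1" by (simp add: prob_space)
      show "0 \<le> (\<integral>\<omega>. x \<omega> $ i \<partial>M)"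
        using x_simplex by (intro integral_nonneg_AE) (auto simp: simplex_nonneg)
    qed (use spread_nn l_nn in auto)
    finally show ?thesis by simp
  qed
  then have "(\<Sum>j\<in>UNIV. (\<integral>\<omega>. occ k j (traj \<omega>) \<partial>M)) \<le> (\<Sum>j\<in>(UNIV::'m set). real CARD('m) * (spread * l ^ k))"
    by (intro sum_mono)
  then show ?thesis by (simp add: alv_eq_sum tail_const_def mult_ac)
qed

lemma alv_integrable: "integrable M (\<lambda>\<omega>. alv k (traj \<omega>))"
  by (rule integrable_const_bound[where B=1]) (auto simp: alive_def)

text \<open>On paths that never leave \<open>T\<close> the value of \<open>absorption_time\<close>
  is meaningless; the geometric tail shows that they form a null set.\<close>

lemma absorbed_AE: "AE \<omega> in M. \<exists>k. X k \<omega> \<notin> T"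
proof -
  define A where "A = {\<omega>\<in>space M. \<forall>k. X k \<omega> \<in> T}"
  have A[measurable]: "A \<in> sets M" unfolding A_def by measurable
  have le: "prob A \<le> tail_const * l ^ k" for k
  proof -
    have "prob A = (\<integral>\<omega>. indicator A \<omega> \<partial>M)" using A by simp
    also have "\<dots> \<le> (\<integral>\<omega>. alv k (traj \<omega>) \<partial>M)"
    proof (rule integral_mono[OF _ alv_integrable])
      show "integrable M (indicator A :: 'w \<Rightarrow> real)"
        by (rule integrable_const_bound[where B=1]) auto
      show "indicator A \<omega> \<le> alv k (traj \<omega>)" if "\<omega> \<in> space M" for \<omega>
        by (auto simp: A_def alive_def indicator_def)
    qed
    finally show ?thesis using alive_mean[of k] by simp
  qed
  have "(\<lambda>k. tail_const * l ^ k) \<longlonglongrightarrow> tail_const * 0"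
    using l_nn l_less1 by (intro tendsto_intros LIMSEQ_power_zero) simp
  then have "prob A \<le> tail_const * 0" by (rule LIMSEQ_le_const) (use le in blast)
  then have "prob A = 0" using measure_nonneg[of M A] by simp
  then have "A \<in> null_sets M" using A by (auto simp: emeasure_eq_measure null_sets_def)
  then show ?thesis by (rule AE_I') (auto simp: A_def)
qed

lemma alive_iff_life:
  assumes "\<exists>k. X k \<omega> \<notin> T" shows "alv k (traj \<omega>) = of_bool (k < life \<omega>)"
proof -
  have "X (life \<omega>) \<omega> \<notin> T"
    unfolding life_def absorption_time_def by (rule LeastI_ex[OF assms])
  then have "(\<forall>j\<le>k. X j \<omega> \<in> T) \<longleftrightarrow> k < life \<omega>"
    using alive_before_life[of _ \<omega>] by (meson le_less_trans not_le_imp_less)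
  then show ?thesis by (simp add: alive_def)
qed

lemma occ_after_life:
  assumes "\<exists>k. X k \<omega> \<notin> T" "life \<omega> \<le> k" shows "occ k i (traj \<omega>) = 0"
  using alive_iff_life[OF assms(1), of k] assms(2) by (auto simp: alive_def occupies_def)

text \<open>The cube of the run length telescopes into the increments
  \<open>(k + 1) ^ 3 - k ^ 3\<close> over times survived, and \<open>tail_const * l ^ k\<close>
  bounds the survival probability. The value involves only data of the chain, so the bound is
  uniform over all runs.\<close>

definition moment_const :: real where
  "moment_const = (\<Sum>k. ((real k + 1) ^ 3 - real k ^ 3) * (tail_const * l ^ k))"

text \<open>A ratio \<open>r\<close> strictly between \<open>l\<close> and 1 leaves the factor
  \<open>(l / r) ^ k\<close> to absorb the polynomial and the factor \<open>r ^ k\<close> to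
  sum.\<close>

lemma moment_summable: "summable (\<lambda>k. ((real k + 1) ^ 3 - real k ^ 3) * (tail_const * l ^ k))"
proof -
  define r where "r = (1 + l) / 2"
  have r: "l < r" "r < 1" "0 < r" using l_nn l_less1 by (auto simp: r_def)
  have "(\<lambda>k. (real k + 1) ^ 3 * (l / r) ^ k) \<longlonglongrightarrow> 0"
  proof (cases "l = 0")
    case True
    have "\<forall>\<^sub>F k in sequentially. (real k + 1) ^ 3 * (l / r) ^ k = 0"
      using eventually_gt_at_top[of 0] by eventually_elim (simp add: True)
    then show ?thesis by (rule tendsto_eventually)
  next
    case False
    define c where "c = l / r"
    have "0 < c" "c < 1" using False l_nn r by (auto simp: c_def)
    then show ?thesis unfolding c_def[symmetric] by real_asymp
  qed
  then have "Bseq (\<lambda>k. (real k + 1) ^ 3 * (l / r) ^ k)"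
    by (intro convergent_imp_Bseq convergentI)
  then obtain B where B: "\<And>k. \<bar>(real k + 1) ^ 3 * (l / r) ^ k\<bar> \<le> B"
    unfolding Bseq_def real_norm_def by blast
  show ?thesis
  proof (rule summable_comparison_test')
    show "summable (\<lambda>k. tail_const * (B * r ^ k))" using r by (intro summable_mult summable_geometric) simp
    show "norm (((real k + 1) ^ 3 - real k ^ 3) * (tail_const * l ^ k)) \<le> tail_const * (B * r ^ k)" if "k \<ge> 0" for k
    proof -
      have d: "0 \<le> (real k + 1) ^ 3 - real k ^ 3" "(real k + 1) ^ 3 - real k ^ 3 \<le> (real k + 1) ^ 3"
        by (auto intro!: power_mono)
      have "(real k + 1) ^ 3 * l ^ k = (real k + 1) ^ 3 * (l / r) ^ k * r ^ k"
        using r by (simp add: power_divide)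
      also have "\<dots> \<le> B * r ^ k" using B[of k] r by (intro mult_right_mono) auto
      finally have e: "(real k + 1) ^ 3 * l ^ k \<le> B * r ^ k" .
      have "((real k + 1) ^ 3 - real k ^ 3) * (tail_const * l ^ k) \<le> (real k + 1) ^ 3 * (tail_const * l ^ k)"
        using d tail_const_nn l_nn by (intro mult_right_mono) auto
      also have "\<dots> = tail_const * ((real k + 1) ^ 3 * l ^ k)" by simp
      also have "\<dots> \<le> tail_const * (B * r ^ k)" using e tail_const_nn by (rule mult_left_mono)
      finally show ?thesis using d tail_const_nn l_nn by simp
    qed
  qed
qed

lemma life_moment: "integrable M (\<lambda>\<omega>. real (life \<omega>) ^ 3)" "(\<integral>\<omega>. real (life \<omega>) ^ 3 \<partial>M) \<le> moment_const"
proof -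
  define c where "c = (\<lambda>k. (real k + 1) ^ 3 - real k ^ 3)"
  have c: "0 \<le> c k" for k unfolding c_def by (auto intro!: power_mono)
  have mc: "moment_const = (\<Sum>k. c k * (tail_const * l ^ k))"
    and ms: "summable (\<lambda>k. c k * (tail_const * l ^ k))"
    using moment_summable by (simp_all add: moment_const_def c_def)
  have "AE \<omega> in M. ennreal (real (life \<omega>) ^ 3) = (\<Sum>k. ennreal (c k * alv k (traj \<omega>)))"
    using absorbed_AE
  proof eventually_elim
    case (elim \<omega>)
    have "(\<Sum>k. ennreal (c k * alv k (traj \<omega>))) = (\<Sum>k<life \<omega>. ennreal (c k * alv k (traj \<omega>)))"
      by (rule suminf_finite) (auto simp: alive_iff_life[OF elim])
    also have "\<dots> = ennreal (\<Sum>k<life \<omega>. c k * alv k (traj \<omega>))"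
      using c by (intro sum_ennreal) (auto simp: alive_def)
    also have "(\<Sum>k<life \<omega>. c k * alv k (traj \<omega>)) = (\<Sum>k<life \<omega>. real (Suc k) ^ 3 - real k ^ 3)"
      by (intro sum.cong refl) (simp add: alive_iff_life[OF elim] c_def add.commute)
    also have "\<dots> = real (life \<omega>) ^ 3" by (subst sum_lessThan_telescope) simp
    finally show ?case by simp
  qed
  then have "(\<integral>\<^sup>+\<omega>. ennreal (real (life \<omega>) ^ 3) \<partial>M) = (\<integral>\<^sup>+\<omega>. (\<Sum>k. ennreal (c k * alv k (traj \<omega>))) \<partial>M)"
    by (rule nn_integral_cong_AE)
  also have "\<dots> = (\<Sum>k. \<integral>\<^sup>+\<omega>. ennreal (c k * alv k (traj \<omega>)) \<partial>M)"
    by (rule nn_integral_suminf) measurable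
  also have "\<dots> \<le> (\<Sum>k. ennreal (c k * (tail_const * l ^ k)))"
  proof (intro suminf_le summableI)
    fix k
    have "(\<integral>\<^sup>+\<omega>. ennreal (c k * alv k (traj \<omega>)) \<partial>M) = ennreal (\<integral>\<omega>. c k * alv k (traj \<omega>) \<partial>M)"
      using c[of k] alv_integrable[of k] by (intro nn_integral_eq_integral) (auto simp: alive_def)
    also have "\<dots> \<le> ennreal (c k * (tail_const * l ^ k))"
      using alive_mean[of k] c[of k] by (intro ennreal_leI) (simp add: mult_left_mono)
    finally show "(\<integral>\<^sup>+\<omega>. ennreal (c k * alv k (traj \<omega>)) \<partial>M) \<le> ennreal (c k * (tail_const * l ^ k))" .
  qed
  also have "\<dots> = ennreal moment_const"
    unfolding mc using c tail_const_nn l_nn by (intro suminf_ennreal2 ms) auto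
  finally have le: "(\<integral>\<^sup>+\<omega>. ennreal (real (life \<omega>) ^ 3) \<partial>M) \<le> ennreal moment_const" .
  show int: "integrable M (\<lambda>\<omega>. real (life \<omega>) ^ 3)"
    using le by (intro integrableI_nonneg) (auto simp: top.extremum_strict top.not_eq_extremum intro: le_less_trans)
  have "0 \<le> moment_const" unfolding mc
    using c tail_const_nn l_nn by (intro suminf_nonneg ms) auto
  moreover have "ennreal (\<integral>\<omega>. real (life \<omega>) ^ 3 \<partial>M) \<le> ennreal moment_const"
    using le int by (simp add: nn_integral_eq_integral)
  ultimately show "(\<integral>\<omega>. real (life \<omega>) ^ 3 \<partial>M) \<le> moment_const" by simp
qed

lemma life_powers: "real (life \<omega>) \<le> real (life \<omega>) ^ 3" "real (life \<omega>) ^ 2 \<le> real (life \<omega>) ^ 3"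
  by (cases "life \<omega> = 0"; simp add: self_le_power power_increasing)+

lemma life_integrable: "integrable M (\<lambda>\<omega>. real (life \<omega>))" "integrable M (\<lambda>\<omega>. real (life \<omega>) ^ 2)"
  by (rule Bochner_Integration.integrable_bound[OF life_moment(1)];
      use life_powers in \<open>auto simp del: of_nat_power\<close>)+

lemma life_sq_mean: "(\<integral>\<omega>. real (life \<omega>) ^ 2 \<partial>M) \<le> moment_const"
  using integral_mono[OF life_integrable(2) life_moment(1)] life_powers(2) life_moment(2) by fastforce

lemma visits_limit: "AE \<omega> in M. (\<lambda>K. \<Sum>k<K. occ k i (traj \<omega>)) \<longlonglongrightarrow> visits \<omega> $ i"
  using absorbed_AE
proof eventually_elim
  case (elim \<omega>)
  have "(\<Sum>k<K. occ k i (traj \<omega>)) = visits \<omega> $ i" if "life \<omega> \<le> K" for K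
    unfolding visits_nth using that
    by (intro sum.mono_neutral_right) (auto simp: occ_after_life[OF elim])
  then show ?case by (intro tendsto_eventually eventually_sequentiallyI)
qed

lemma visits_partial: "AE \<omega> in M. \<forall>K. (\<Sum>k<K. occ k i (traj \<omega>)) \<le> real (life \<omega>)"
  using visits_limit[of i]
proof eventually_elim
  case (elim \<omega>)
  have "incseq (\<lambda>K. \<Sum>k<K. occ k i (traj \<omega>))"
    by (intro incseq_SucI) (simp add: occ_bounds)
  then have "(\<Sum>k<K. occ k i (traj \<omega>)) \<le> visits \<omega> $ i" for K using elim incseq_le by blast
  then show ?case using visits_le_life order_trans by blast
qed

text \<open>Up to time \<open>K\<close> the identity is a finite sum of \<open>occ_mean\<close>. The
  limit is taken by dominated convergence with \<open>Z\<close> times the run length as dominating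
  function, whence the third integrability condition.\<close>

lemma visits_mean:
  assumes Z: "Z \<in> borel_measurable F" "integrable M Z" "integrable M (\<lambda>\<omega>. Z \<omega> * real (life \<omega>))"
  shows "(\<integral>\<omega>. Z \<omega> * visits \<omega> $ i \<partial>M) = (\<integral>\<omega>. Z \<omega> * (x \<omega> v* R) $ i \<partial>M)"
proof -
  have [measurable]: "Z \<in> borel_measurable M" by (rule F_M[OF Z(1)])
  have "(\<lambda>K. \<integral>\<omega>. Z \<omega> * (\<Sum>k<K. occ k i (traj \<omega>)) \<partial>M) \<longlonglongrightarrow> (\<integral>\<omega>. Z \<omega> * visits \<omega> $ i \<partial>M)"
  proof (rule integral_dominated_convergence[where w="\<lambda>\<omega>. \<bar>Z \<omega> * real (life \<omega>)\<bar>"])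
    show "AE \<omega> in M. (\<lambda>K. Z \<omega> * (\<Sum>k<K. occ k i (traj \<omega>))) \<longlonglongrightarrow> Z \<omega> * visits \<omega> $ i"
      using visits_limit[of i] by eventually_elim (intro tendsto_intros)
    show "AE \<omega> in M. norm (Z \<omega> * (\<Sum>k<K. occ k i (traj \<omega>))) \<le> \<bar>Z \<omega> * real (life \<omega>)\<bar>" for K
      using visits_partial[of i]
    proof eventually_elim
      case (elim \<omega>)
      have "0 \<le> (\<Sum>k<K. occ k i (traj \<omega>))" by (intro sum_nonneg occ_bounds)
      then show ?case using elim by (auto simp: abs_mult intro!: mult_left_mono)
    qed
  qed (use Z(3) in auto)
  moreover have "(\<integral>\<omega>. Z \<omega> * (\<Sum>k<K. occ k i (traj \<omega>)) \<partial>M)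
      = (\<Sum>m\<in>UNIV. (\<Sum>k<K. Qk k $ m $ i) * (\<integral>\<omega>. Z \<omega> * x \<omega> $ m \<partial>M))" for K
  proof -
    have "(\<integral>\<omega>. Z \<omega> * (\<Sum>k<K. occ k i (traj \<omega>)) \<partial>M) = (\<Sum>k<K. \<integral>\<omega>. Z \<omega> * occ k i (traj \<omega>) \<partial>M)"
      unfolding sum_distrib_left
      by (rule Bochner_Integration.integral_sum)
        (rule integrable_mult_bounded[where B=1], auto simp: Z occupies_def)
    then show ?thesis
      by (simp add: occ_mean[OF Z(1,2)] sum_distrib_right) (rule sum.swap)
  qed
  moreover have "(\<lambda>K. \<Sum>m\<in>UNIV. (\<Sum>k<K. Qk k $ m $ i) * (\<integral>\<omega>. Z \<omega> * x \<omega> $ m \<partial>M))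
      \<longlonglongrightarrow> (\<Sum>m\<in>UNIV. R $ m $ i * (\<integral>\<omega>. Z \<omega> * x \<omega> $ m \<partial>M))"
    using R_sums unfolding sums_def by (intro tendsto_intros) auto
  ultimately have "(\<integral>\<omega>. Z \<omega> * visits \<omega> $ i \<partial>M) = (\<Sum>m\<in>UNIV. R $ m $ i * (\<integral>\<omega>. Z \<omega> * x \<omega> $ m \<partial>M))"
    using LIMSEQ_unique by simp
  also have "\<dots> = (\<integral>\<omega>. (\<Sum>m\<in>UNIV. R $ m $ i * (Z \<omega> * x \<omega> $ m)) \<partial>M)"
    using integrable_x[OF Z(2)] by (subst Bochner_Integration.integral_sum) auto
  also have "\<dots> = (\<integral>\<omega>. Z \<omega> * (x \<omega> v* R) $ i \<partial>M)"
    by (simp add: vector_matrix_nth sum_distrib_left mult_ac)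
  finally show ?thesis .
qed

lemma visits_second_moment:
  assumes Z: "Z \<in> borel_measurable F" "integrable M Z" "integrable M (\<lambda>\<omega>. Z \<omega> * real (life \<omega>) ^ 2)"
  shows "(\<integral>\<omega>. Z \<omega> * (visits \<omega> $ i * visits \<omega> $ j) \<partial>M)
    = (\<integral>\<omega>. Z \<omega> * (\<Sum>m\<in>UNIV. x \<omega> $ m * visits_cov m i j) \<partial>M)"
proof -
  have [measurable]: "Z \<in> borel_measurable M" by (rule F_M[OF Z(1)])
  have "(\<lambda>K. \<integral>\<omega>. Z \<omega> * ((\<Sum>k<K. occ k i (traj \<omega>)) * (\<Sum>k<K. occ k j (traj \<omega>))) \<partial>M)
      \<longlonglongrightarrow> (\<integral>\<omega>. Z \<omega> * (visits \<omega> $ i * visits \<omega> $ j) \<partial>M)"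
  proof (rule integral_dominated_convergence[where w="\<lambda>\<omega>. \<bar>Z \<omega> * real (life \<omega>) ^ 2\<bar>"])
    show "AE \<omega> in M. (\<lambda>K. Z \<omega> * ((\<Sum>k<K. occ k i (traj \<omega>)) * (\<Sum>k<K. occ k j (traj \<omega>))))
        \<longlonglongrightarrow> Z \<omega> * (visits \<omega> $ i * visits \<omega> $ j)"
      using visits_limit[of i] visits_limit[of j] by eventually_elim (intro tendsto_intros)
    show "AE \<omega> in M. norm (Z \<omega> * ((\<Sum>k<K. occ k i (traj \<omega>)) * (\<Sum>k<K. occ k j (traj \<omega>))))
        \<le> \<bar>Z \<omega> * real (life \<omega>) ^ 2\<bar>" for K
      using visits_partial[of i] visits_partial[of j]
    proof eventually_elim
      case (elim \<omega>)
      have "0 \<le> (\<Sum>k<K. occ k i (traj \<omega>))" for i by (intro sum_nonneg occ_bounds)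
      then show ?case using elim
        by (auto simp: abs_mult power2_eq_square intro!: mult_left_mono mult_mono)
    qed
  qed (use Z(3) in auto)
  moreover have "(\<lambda>K. \<Sum>m\<in>UNIV. visits_cov_upto K m i j * (\<integral>\<omega>. Z \<omega> * x \<omega> $ m \<partial>M))
      \<longlonglongrightarrow> (\<Sum>m\<in>UNIV. visits_cov m i j * (\<integral>\<omega>. Z \<omega> * x \<omega> $ m \<partial>M))"
    by (intro tendsto_intros visits_cov_limit)
  ultimately have "(\<integral>\<omega>. Z \<omega> * (visits \<omega> $ i * visits \<omega> $ j) \<partial>M)
      = (\<Sum>m\<in>UNIV. visits_cov m i j * (\<integral>\<omega>. Z \<omega> * x \<omega> $ m \<partial>M))"
    unfolding occ_pair_sum[OF Z(1,2)] using LIMSEQ_unique by blast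
  also have "\<dots> = (\<integral>\<omega>. (\<Sum>m\<in>UNIV. visits_cov m i j * (Z \<omega> * x \<omega> $ m)) \<partial>M)"
    using integrable_x[OF Z(2)] by (subst Bochner_Integration.integral_sum) auto
  also have "\<dots> = (\<integral>\<omega>. Z \<omega> * (\<Sum>m\<in>UNIV. x \<omega> $ m * visits_cov m i j) \<partial>M)"
    by (simp add: sum_distrib_left mult_ac)
  finally show ?thesis .
qed

end


section \<open>Conditional mean and variance of the noise\<close>

context perron_chain
begin

lemma continuous_drift: "continuous_on S drift"
  unfolding drift_def by (intro continuous_intros)

lemma continuous_bounded_simplex:
  fixes h :: "real^'m \<Rightarrow> 'b::real_normed_vector"
  assumes "continuous_on UNIV h" shows "\<exists>B. \<forall>y\<in>prob_simplex. norm (h y) \<le> B"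
proof -
  have "compact (h ` prob_simplex)"
    using assms continuous_on_subset by (intro compact_continuous_image compact_prob_simplex) blast
  then have "bounded (h ` prob_simplex)" by (rule compact_imp_bounded)
  then show ?thesis by (auto simp: bounded_iff)
qed

lemma lyap_deriv_self: "x \<in> prob_simplex \<Longrightarrow> lyap_deriv x x = 0"
  using w_min_pos w_min_le[of x] by (simp add: lyap_deriv_def lyap_def power2_eq_square)

lemma lyap_deriv_coords: "lyap_deriv x y = (\<Sum>i\<in>UNIV. y $ i * lyap_deriv x (axis i 1))"
proof -
  have a: "wform x (axis i 1) = w $ i * x $ i / qsd $ i" for i
    unfolding wform_def axis_def by (simp add: if_distrib[of "\<lambda>c. _ * c / _"] cong: if_cong)
  have b: "w \<bullet> axis i 1 = w $ i" for i by (simp add: inner_axis)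
  have "wform x y = (\<Sum>i\<in>UNIV. y $ i * wform x (axis i 1))" "w \<bullet> y = (\<Sum>i\<in>UNIV. y $ i * (w \<bullet> axis i 1))"
    unfolding a b by (simp_all add: wform_def inner_vec_def mult_ac)
  then show ?thesis
    unfolding lyap_deriv_def
    by (simp add: sum_distrib_left sum_subtractf[symmetric] sum_divide_distrib algebra_simps)
qed

text \<open>The radial part drops out, leaving a combination of visit counts whose coefficients
  depend only on \<open>x\<close>; this is the form to which \<open>visits_mean\<close>
  applies.\<close>

lemma lyap_deriv_displacement:
  assumes x: "x \<in> prob_simplex"
  shows "lyap_deriv x (v - c *\<^sub>R x) = (\<Sum>i\<in>UNIV. v $ i * lyap_deriv x (axis i 1))"
  by (simp add: lyap_deriv_diff lyap_deriv_scale lyap_deriv_self[OF x] lyap_deriv_coords[of x v])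

lemma lyap_measurable[measurable]: "lyap \<in> borel_measurable borel"
  unfolding lyap_def wform_def by measurable

lemma lyap_deriv_measurable[measurable]: "(\<lambda>x. lyap_deriv x y) \<in> borel_measurable borel"
  unfolding lyap_deriv_def wform_def by measurable

text \<open>The conditional variance of \<open>g \<bullet> noise\<close> when the initial law is
  \<open>y\<close>. The run length is the sum of the visit counts, so the update direction tested
  with \<open>g\<close> weighs a visit to \<open>i\<close> by \<open>g $ i - g \<bullet> y\<close>;
  the double sum is the second moment and \<open>g \<bullet> drift y\<close> the mean.\<close>

definition noise_var :: "real^'m \<Rightarrow> real^'m \<Rightarrow> real" where
  "noise_var g y = (\<Sum>i\<in>UNIV. \<Sum>j\<in>UNIV. (g $ i - g \<bullet> y) * (g $ j - g \<bullet> y) *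
      (\<Sum>m\<in>UNIV. y $ m * visits_cov m i j)) - (g \<bullet> drift y)\<^sup>2"

lemma continuous_noise_var: "continuous_on S (noise_var g)"
  unfolding noise_var_def by (intro continuous_intros continuous_drift)

lemma inner_drift: "g \<bullet> drift y = (\<Sum>i\<in>UNIV. (y v* R) $ i * (g $ i - g \<bullet> y))"
  unfolding drift_def
  by (simp add: inner_diff_right inner_vec_def[of g "y v* R"] right_diff_distrib sum_subtractf
      sum_distrib_left mult.commute)

end

context conditional_run
begin

definition noise :: "'w \<Rightarrow> real^'m" where
  "noise \<omega> = visits \<omega> - real (life \<omega>) *\<^sub>R x \<omega> - drift (x \<omega>)"

lemma noise_measurable:
  assumes X: "\<And>k. X k \<in> G \<rightarrow>\<^sub>M count_space UNIV" and x: "x \<in> borel_measurable G"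
  shows "noise \<in> borel_measurable G"
proof -
  note [measurable] = visits_measurable[OF X] life_measurable[OF X] x
  have [measurable]: "(\<lambda>\<omega>. drift (x \<omega>)) \<in> borel_measurable G"
    by (rule measurable_compose[OF x]) (intro borel_measurable_continuous_onI continuous_drift)
  show ?thesis unfolding noise_def by measurable
qed

lemma noise_M[measurable]: "noise \<in> borel_measurable M"
  by (rule noise_measurable) measurable

lemma continuous_F:
  fixes h :: "real^'m \<Rightarrow> real"
  shows "continuous_on UNIV h \<Longrightarrow> (\<lambda>\<omega>. h (x \<omega>)) \<in> borel_measurable F"
  by (rule measurable_compose[OF x_F]) (rule borel_measurable_continuous_onI)

lemma integrable_continuous_mult:
  fixes h :: "real^'m \<Rightarrow> real"
  assumes Z: "integrable M Z" and h: "continuous_on UNIV h"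
  shows "integrable M (\<lambda>\<omega>. Z \<omega> * h (x \<omega>))"
proof -
  obtain B where B: "\<And>y. y \<in> prob_simplex \<Longrightarrow> norm (h y) \<le> B" using continuous_bounded_simplex[OF h] by blast
  have "AE \<omega> in M. \<bar>h (x \<omega>)\<bar> \<le> B" using x_simplex by eventually_elim (use B in auto)
  then show ?thesis by (rule integrable_mult_bounded[OF Z F_M[OF continuous_F[OF h]]])
qed

lemma integrable_life_dominated:
  assumes "integrable M (\<lambda>\<omega>. Z \<omega> * real (life \<omega>) ^ p)" "AE \<omega> in M. \<bar>V \<omega>\<bar> \<le> c * real (life \<omega>) ^ p"
    and [measurable]: "V \<in> borel_measurable M" "Z \<in> borel_measurable M"
  shows "integrable M (\<lambda>\<omega>. Z \<omega> * V \<omega>)"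
proof (rule Bochner_Integration.integrable_bound)
  show "integrable M (\<lambda>\<omega>. c * (Z \<omega> * real (life \<omega>) ^ p))" using assms(1) by simp
  show "AE \<omega> in M. norm (Z \<omega> * V \<omega>) \<le> norm (c * (Z \<omega> * real (life \<omega>) ^ p))"
    using assms(2)
  proof eventually_elim
    case (elim \<omega>)
    have "\<bar>Z \<omega>\<bar> * \<bar>V \<omega>\<bar> \<le> \<bar>Z \<omega>\<bar> * \<bar>c * real (life \<omega>) ^ p\<bar>"
      using elim by (intro mult_left_mono) auto
    then show ?case by (simp add: abs_mult mult_ac)
  qed
qed measurable

lemma visits_integrable: 
  assumes "integrable M (\<lambda>\<omega>. Z \<omega> * real (life \<omega>))" "Z \<in> borel_measurable M"
  shows "integrable M (\<lambda>\<omega>. Z \<omega> * visits \<omega> $ i)"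
  by (rule integrable_life_dominated[where p=1 and c=1])
    (use assms visits_nn visits_le_life in \<open>auto simp: abs_of_nonneg\<close>)

lemma visits_product_integrable: 
  assumes "integrable M (\<lambda>\<omega>. Z \<omega> * real (life \<omega>) ^ 2)" "Z \<in> borel_measurable M"
  shows "integrable M (\<lambda>\<omega>. Z \<omega> * (visits \<omega> $ i * visits \<omega> $ j))"
  by (rule integrable_life_dominated[where p=2 and c=1])
    (use assms visits_nn visits_le_life in \<open>auto simp: abs_of_nonneg power2_eq_square intro!: mult_mono\<close>)

lemma inner_noise: "g \<bullet> noise \<omega> = (\<Sum>i\<in>UNIV. visits \<omega> $ i * (g $ i - g \<bullet> x \<omega>)) - g \<bullet> drift (x \<omega>)"
proof -
  have "(\<Sum>i\<in>UNIV. visits \<omega> $ i * (g $ i - g \<bullet> x \<omega>)) = g \<bullet> visits \<omega> - real (life \<omega>) * (g \<bullet> x \<omega>)"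
    by (simp add: right_diff_distrib sum_subtractf inner_vec_def[of g "visits \<omega>"] visits_sum[symmetric]
        sum_distrib_left mult.commute)
  then show ?thesis by (simp add: noise_def inner_diff_right)
qed

text \<open>The martingale difference property. The factor \<open>Z\<close> may be unbounded, since
  it will also be the martingale itself; coefficients depending on \<open>x\<close> are absorbed
  into it coordinate by coordinate.\<close>

lemma noise_mean:
  assumes Z: "Z \<in> borel_measurable F" "integrable M Z" "integrable M (\<lambda>\<omega>. Z \<omega> * real (life \<omega>))"
  shows "(\<integral>\<omega>. Z \<omega> * (g \<bullet> noise \<omega>) \<partial>M) = 0" "integrable M (\<lambda>\<omega>. Z \<omega> * (g \<bullet> noise \<omega>))"
proof -
  have ZM[measurable]: "Z \<in> borel_measurable M" by (rule F_M[OF Z(1)])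
  define b where "b = (\<lambda>i y. g $ i - g \<bullet> y)"
  have bc: "continuous_on UNIV (b i)" for i unfolding b_def by (intro continuous_intros)
  define Z' where "Z' = (\<lambda>i \<omega>. Z \<omega> * b i (x \<omega>))"
  have Z'1: "Z' i \<in> borel_measurable F" for i unfolding Z'_def using Z(1) continuous_F[OF bc] by measurable
  have Z'2: "integrable M (Z' i)" for i unfolding Z'_def by (rule integrable_continuous_mult[OF Z(2) bc])
  have Z'3: "integrable M (\<lambda>\<omega>. Z' i \<omega> * real (life \<omega>))" for i
    using integrable_continuous_mult[OF Z(3) bc, of i] by (simp add: Z'_def mult_ac)
  have i1: "integrable M (\<lambda>\<omega>. Z' i \<omega> * visits \<omega> $ i)" for i
    by (rule visits_integrable[OF Z'3 F_M[OF Z'1]])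
  have i2: "integrable M (\<lambda>\<omega>. Z' i \<omega> * (x \<omega> v* R) $ i)" for i
    by (rule integrable_continuous_mult[OF Z'2]) (intro continuous_intros)
  have eq1: "Z \<omega> * (\<Sum>i\<in>UNIV. visits \<omega> $ i * (g $ i - g \<bullet> x \<omega>)) = (\<Sum>i\<in>UNIV. Z' i \<omega> * visits \<omega> $ i)" for \<omega>
    by (simp add: Z'_def b_def sum_distrib_left mult_ac)
  have eq2: "Z \<omega> * (g \<bullet> drift (x \<omega>)) = (\<Sum>i\<in>UNIV. Z' i \<omega> * (x \<omega> v* R) $ i)" for \<omega>
    by (simp add: Z'_def b_def inner_drift sum_distrib_left mult_ac)
  have eq: "Z \<omega> * (g \<bullet> noise \<omega>) = (\<Sum>i\<in>UNIV. Z' i \<omega> * visits \<omega> $ i) - (\<Sum>i\<in>UNIV. Z' i \<omega> * (x \<omega> v* R) $ i)" for \<omega>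
    unfolding inner_noise right_diff_distrib[of "Z \<omega>"] eq1 eq2 by (rule refl)
  show "integrable M (\<lambda>\<omega>. Z \<omega> * (g \<bullet> noise \<omega>))"
    unfolding eq using i1 i2 by (intro Bochner_Integration.integrable_diff Bochner_Integration.integrable_sum)
  show "(\<integral>\<omega>. Z \<omega> * (g \<bullet> noise \<omega>) \<partial>M) = 0"
    unfolding eq using i1 i2
    by (subst Bochner_Integration.integral_diff)
      (auto simp: Bochner_Integration.integral_sum visits_mean[OF Z'1 Z'2 Z'3])
qed

text \<open>The visit counts give the square of noise plus drift. Solving for the square of the
  noise leaves a cross term, which vanishes by \<open>noise_mean\<close> with the drift absorbed
  into the test factor.\<close>

lemma noise_variance:
  assumes Z: "Z \<in> borel_measurable F" "integrable M Z" "integrable M (\<lambda>\<omega>. Z \<omega> * real (life \<omega>) ^ 2)"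
  shows "(\<integral>\<omega>. Z \<omega> * (g \<bullet> noise \<omega>)\<^sup>2 \<partial>M) = (\<integral>\<omega>. Z \<omega> * noise_var g (x \<omega>) \<partial>M)"
    "integrable M (\<lambda>\<omega>. Z \<omega> * (g \<bullet> noise \<omega>)\<^sup>2)"
proof -
  have ZM[measurable]: "Z \<in> borel_measurable M" by (rule F_M[OF Z(1)])
  have Z1: "integrable M (\<lambda>\<omega>. Z \<omega> * real (life \<omega>))"
  proof (rule Bochner_Integration.integrable_bound[OF Z(3)])
    have "real n \<le> (real n)\<^sup>2" for n by (cases n) (auto simp: power2_eq_square)
    then show "AE \<omega> in M. norm (Z \<omega> * real (life \<omega>)) \<le> norm (Z \<omega> * real (life \<omega>) ^ 2)"
      by (auto simp: abs_mult intro!: mult_left_mono)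
  qed measurable
  define b where "b = (\<lambda>i y. g $ i - g \<bullet> y)"
  have bc: "continuous_on UNIV (b i)" for i unfolding b_def by (intro continuous_intros)
  define D where "D = (\<lambda>y. g \<bullet> drift y)"
  have Dc: "continuous_on UNIV D" unfolding D_def by (intro continuous_intros continuous_drift)
  define Z2 where "Z2 = (\<lambda>i j \<omega>. Z \<omega> * (b i (x \<omega>) * b j (x \<omega>)))"
  have bbc: "continuous_on UNIV (\<lambda>y. b i y * b j y)" for i j by (intro continuous_intros bc)
  have Z21: "Z2 i j \<in> borel_measurable F" for i j unfolding Z2_def using Z(1) continuous_F[OF bbc] by measurable
  have Z22: "integrable M (Z2 i j)" for i j unfolding Z2_def by (rule integrable_continuous_mult[OF Z(2) bbc])
  have Z23: "integrable M (\<lambda>\<omega>. Z2 i j \<omega> * real (life \<omega>) ^ 2)" for i j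
    using integrable_continuous_mult[OF Z(3) bbc, of i j] by (simp add: Z2_def mult_ac)
  have i1: "integrable M (\<lambda>\<omega>. Z2 i j \<omega> * (visits \<omega> $ i * visits \<omega> $ j))" for i j
    by (rule visits_product_integrable[OF Z23 F_M[OF Z21]])
  have i2: "integrable M (\<lambda>\<omega>. Z2 i j \<omega> * (\<Sum>m\<in>UNIV. x \<omega> $ m * visits_cov m i j))" for i j
    by (rule integrable_continuous_mult[OF Z22]) (intro continuous_intros)
  define ZD where "ZD = (\<lambda>\<omega>. Z \<omega> * D (x \<omega>))"
  have ZD1: "ZD \<in> borel_measurable F" unfolding ZD_def using Z(1) continuous_F[OF Dc] by measurable
  have ZD2: "integrable M ZD" unfolding ZD_def by (rule integrable_continuous_mult[OF Z(2) Dc])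
  have ZD3: "integrable M (\<lambda>\<omega>. ZD \<omega> * real (life \<omega>))"
    using integrable_continuous_mult[OF Z1 Dc] by (simp add: ZD_def mult_ac)
  note nm = noise_mean[OF ZD1 ZD2 ZD3, of g]
  have i3: "integrable M (\<lambda>\<omega>. ZD \<omega> * D (x \<omega>))" by (rule integrable_continuous_mult[OF ZD2 Dc])
  have sq: "(g \<bullet> noise \<omega>)\<^sup>2 = (\<Sum>i\<in>UNIV. \<Sum>j\<in>UNIV. (b i (x \<omega>) * b j (x \<omega>)) * (visits \<omega> $ i * visits \<omega> $ j))
      - 2 * (D (x \<omega>) * (g \<bullet> noise \<omega>)) - D (x \<omega>) * D (x \<omega>)" for \<omega>
  proof -
    have "g \<bullet> noise \<omega> + D (x \<omega>) = (\<Sum>i\<in>UNIV. b i (x \<omega>) * visits \<omega> $ i)"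
      by (simp add: inner_noise D_def b_def mult.commute)
    then have "(g \<bullet> noise \<omega> + D (x \<omega>)) * (g \<bullet> noise \<omega> + D (x \<omega>))
      = (\<Sum>i\<in>UNIV. \<Sum>j\<in>UNIV. (b i (x \<omega>) * b j (x \<omega>)) * (visits \<omega> $ i * visits \<omega> $ j))"
      by (simp only: sum_product mult_ac)
    then show ?thesis by (simp add: power2_eq_square algebra_simps)
  qed
  have eq: "Z \<omega> * (g \<bullet> noise \<omega>)\<^sup>2 = (\<Sum>i\<in>UNIV. \<Sum>j\<in>UNIV. Z2 i j \<omega> * (visits \<omega> $ i * visits \<omega> $ j))
      - 2 * (ZD \<omega> * (g \<bullet> noise \<omega>)) - ZD \<omega> * D (x \<omega>)" for \<omega>
    unfolding sq Z2_def ZD_def by (simp add: right_diff_distrib sum_distrib_left mult_ac)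
  have eqv: "Z \<omega> * noise_var g (x \<omega>) = (\<Sum>i\<in>UNIV. \<Sum>j\<in>UNIV. Z2 i j \<omega> * (\<Sum>m\<in>UNIV. x \<omega> $ m * visits_cov m i j))
      - ZD \<omega> * D (x \<omega>)" for \<omega>
    unfolding noise_var_def Z2_def ZD_def b_def D_def
    by (simp add: right_diff_distrib sum_distrib_left power2_eq_square mult_ac)
  show "integrable M (\<lambda>\<omega>. Z \<omega> * (g \<bullet> noise \<omega>)\<^sup>2)"
    unfolding eq
    by (intro Bochner_Integration.integrable_diff Bochner_Integration.integrable_sum integrable_mult_right i1 i3 nm(2))
  have "(\<integral>\<omega>. Z \<omega> * (g \<bullet> noise \<omega>)\<^sup>2 \<partial>M)
     = (\<Sum>i\<in>UNIV. \<Sum>j\<in>UNIV. (\<integral>\<omega>. Z2 i j \<omega> * (visits \<omega> $ i * visits \<omega> $ j) \<partial>M)) - 2 * 0 - (\<integral>\<omega>. ZD \<omega> * D (x \<omega>) \<partial>M)"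
    unfolding eq using i1 i3 nm
    by (simp add: Bochner_Integration.integral_diff Bochner_Integration.integrable_diff
        Bochner_Integration.integral_sum Bochner_Integration.integrable_sum)
  also have "\<dots> = (\<integral>\<omega>. Z \<omega> * noise_var g (x \<omega>) \<partial>M)"
    unfolding eqv visits_second_moment[OF Z21 Z22 Z23] using i2 i3
    by (simp add: Bochner_Integration.integral_diff Bochner_Integration.integral_sum Bochner_Integration.integrable_sum)
  finally show "(\<integral>\<omega>. Z \<omega> * (g \<bullet> noise \<omega>)\<^sup>2 \<partial>M) = (\<integral>\<omega>. Z \<omega> * noise_var g (x \<omega>) \<partial>M)" .
qed

text \<open>The coefficients of the visit counts need not be continuous off the simplex, where
  \<open>w \<bullet> x\<close> may vanish; their integrability comes from the almost sure bound
  \<open>lyap_deriv_bound\<close>.\<close>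

lemma lyap_deriv_mean:
  "(\<integral>\<omega>. lyap_deriv (x \<omega>) (visits \<omega> - real (life \<omega>) *\<^sub>R x \<omega>) \<partial>M) = (\<integral>\<omega>. lyap_deriv (x \<omega>) (drift (x \<omega>)) \<partial>M)"
  "integrable M (\<lambda>\<omega>. lyap_deriv (x \<omega>) (visits \<omega> - real (life \<omega>) *\<^sub>R x \<omega>))"
  "integrable M (\<lambda>\<omega>. lyap_deriv (x \<omega>) (drift (x \<omega>)))"
proof -
  define L where "L = (\<lambda>i \<omega>. lyap_deriv (x \<omega>) (axis i 1))"
  have L1: "L i \<in> borel_measurable F" for i unfolding L_def by measurable
  have LM[measurable]: "L i \<in> borel_measurable M" for i by (rule F_M[OF L1])
  have Lb: "AE \<omega> in M. \<bar>L i \<omega>\<bar> \<le> lyap_deriv_bound" for i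
    using x_simplex
  proof eventually_elim
    case (elim \<omega>)
    show ?case using lyap_deriv_le[OF elim, of "axis i 1"] by (simp add: L_def)
  qed
  have L2: "integrable M (L i)" for i by (rule integrable_const_bound[where B=lyap_deriv_bound]) (use Lb in auto)
  have L3: "integrable M (\<lambda>\<omega>. L i \<omega> * real (life \<omega>))" for i
    using integrable_mult_bounded[OF life_integrable(1) LM Lb] by (simp add: mult.commute)
  have i1: "integrable M (\<lambda>\<omega>. L i \<omega> * visits \<omega> $ i)" for i by (rule visits_integrable[OF L3 LM])
  have i2: "integrable M (\<lambda>\<omega>. L i \<omega> * (x \<omega> v* R) $ i)" for i
    by (rule integrable_continuous_mult[OF L2]) (intro continuous_intros)
  have [measurable]: "(\<lambda>\<omega>. drift (x \<omega>)) \<in> borel_measurable M"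
    by (rule measurable_compose[OF x_M]) (intro borel_measurable_continuous_onI continuous_drift)
  have m1: "(\<lambda>\<omega>. lyap_deriv (x \<omega>) (visits \<omega> - real (life \<omega>) *\<^sub>R x \<omega>)) \<in> borel_measurable M"
    unfolding lyap_deriv_def wform_def lyap_def by measurable
  have m2: "(\<lambda>\<omega>. lyap_deriv (x \<omega>) (drift (x \<omega>))) \<in> borel_measurable M"
    unfolding lyap_deriv_def wform_def lyap_def by measurable
  have e1: "AE \<omega> in M. lyap_deriv (x \<omega>) (visits \<omega> - real (life \<omega>) *\<^sub>R x \<omega>) = (\<Sum>i\<in>UNIV. L i \<omega> * visits \<omega> $ i)"
    using x_simplex by eventually_elim (simp add: lyap_deriv_displacement L_def mult.commute)
  have e2: "AE \<omega> in M. lyap_deriv (x \<omega>) (drift (x \<omega>)) = (\<Sum>i\<in>UNIV. L i \<omega> * (x \<omega> v* R) $ i)"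
    using x_simplex by eventually_elim (simp add: drift_def lyap_deriv_displacement L_def mult.commute)
  have I1: "integrable M (\<lambda>\<omega>. \<Sum>i\<in>UNIV. L i \<omega> * visits \<omega> $ i)" using i1 by (rule Bochner_Integration.integrable_sum)
  have I2: "integrable M (\<lambda>\<omega>. \<Sum>i\<in>UNIV. L i \<omega> * (x \<omega> v* R) $ i)" using i2 by (rule Bochner_Integration.integrable_sum)
  show "integrable M (\<lambda>\<omega>. lyap_deriv (x \<omega>) (visits \<omega> - real (life \<omega>) *\<^sub>R x \<omega>))"
    using I1 by (subst integrable_cong_AE[OF m1 _ e1]) auto
  show "integrable M (\<lambda>\<omega>. lyap_deriv (x \<omega>) (drift (x \<omega>)))"
    using I2 by (subst integrable_cong_AE[OF m2 _ e2]) auto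
  have "(\<integral>\<omega>. lyap_deriv (x \<omega>) (visits \<omega> - real (life \<omega>) *\<^sub>R x \<omega>) \<partial>M) = (\<Sum>i\<in>UNIV. \<integral>\<omega>. L i \<omega> * visits \<omega> $ i \<partial>M)"
    unfolding integral_cong_AE[OF m1 borel_measurable_integrable[OF I1] e1]
    by (rule Bochner_Integration.integral_sum[OF i1])
  also have "\<dots> = (\<Sum>i\<in>UNIV. \<integral>\<omega>. L i \<omega> * (x \<omega> v* R) $ i \<partial>M)"
    by (simp add: visits_mean[OF L1 L2 L3])
  also have "\<dots> = (\<integral>\<omega>. lyap_deriv (x \<omega>) (drift (x \<omega>)) \<partial>M)"
    unfolding integral_cong_AE[OF m2 borel_measurable_integrable[OF I2] e2]
    by (rule Bochner_Integration.integral_sum[OF i2, symmetric])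
  finally show "(\<integral>\<omega>. lyap_deriv (x \<omega>) (visits \<omega> - real (life \<omega>) *\<^sub>R x \<omega>) \<partial>M) = (\<integral>\<omega>. lyap_deriv (x \<omega>) (drift (x \<omega>)) \<partial>M)" .
qed

end


section \<open>Convergence of the iterates\<close>

locale projected_process = perron_chain P T idx Q w qsd l
  for P :: "real^'s::finite^'s" and T and idx :: "'m::finite \<Rightarrow> 's" and Q w qsd l +
  fixes \<epsilon> :: "nat \<Rightarrow> real" and \<mu>\<^sub>0 :: "real^'m" and M :: "'w measure"
    and X :: "nat \<Rightarrow> nat \<Rightarrow> 'w \<Rightarrow> 's" and \<mu> :: "nat \<Rightarrow> 'w \<Rightarrow> real^'m" and \<alpha> a b :: real
  assumes algorithm: "projection_algorithm P T idx \<epsilon> \<mu>\<^sub>0 M X \<mu>"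
    and initial: "\<mu>\<^sub>0 \<in> prob_simplex"
    and \<epsilon>_pos: "\<And>n. 0 < \<epsilon> n" and \<epsilon>_decseq: "decseq \<epsilon>"
    and \<alpha>: "1 / 2 < \<alpha>" "\<alpha> < 1" and a: "0 < a" and b: "0 < b"
    and \<epsilon>_lower: "\<And>n. a * (real n + 1) powr - \<alpha> \<le> \<epsilon> n"
    and \<epsilon>_upper: "\<And>n. \<epsilon> n \<le> b * (real n + 1) powr - \<alpha>"
begin

abbreviation "history \<equiv> past M X \<mu>"

sublocale prob_space M using algorithm by (simp add: projection_algorithm_def)

lemma X_meas[measurable]: "X (Suc n) k \<in> M \<rightarrow>\<^sub>M count_space UNIV"
  and \<mu>_meas[measurable]: "\<mu> n \<in> borel_measurable M"
  using algorithm by (auto simp: projection_algorithm_def)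

lemma closest_simplex: "closest_point prob_simplex (y :: real^'m) \<in> prob_simplex"
  using axis_in_simplex by (intro closest_point_in_set compact_imp_closed[OF compact_prob_simplex]) blast

lemma \<mu>_simplex: "AE \<omega> in M. \<mu> n \<omega> \<in> prob_simplex"
proof (cases n)
  case 0
  have "AE \<omega> in M. \<mu> 0 \<omega> = \<mu>\<^sub>0" using algorithm by (simp add: projection_algorithm_def)
  then show ?thesis unfolding 0 by eventually_elim (simp add: initial)
next
  case (Suc k)
  have "AE \<omega> in M. \<mu> (Suc k) \<omega> = projection_step T idx (\<epsilon> k) (\<lambda>j. X (Suc k) j \<omega>) (\<mu> k \<omega>)"
    using algorithm by (simp add: projection_algorithm_def)
  then show ?thesis unfolding Suc
    by eventually_elim (simp add: projection_step_def closest_simplex)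
qed

definition history_gen :: "nat \<Rightarrow> 'w set set" where
  "history_gen n = {X j k -` {x} \<inter> space M | j k x. 1 \<le> j \<and> j \<le> n} \<union>
      {\<mu> j -` B \<inter> space M | j B. j \<le> n \<and> B \<in> sets borel}"

lemma history_gen_sets: "history_gen n \<subseteq> sets M"
proof
  fix A assume "A \<in> history_gen n"
  then consider j k x where "A = X j k -` {x} \<inter> space M" "1 \<le> j" | j B where "A = \<mu> j -` B \<inter> space M" "B \<in> sets borel"
    unfolding history_gen_def by blast
  then show "A \<in> sets M"
  proof cases
    case 1
    then obtain i where "j = Suc i" by (cases j) auto
    then show ?thesis using 1 measurable_sets[OF X_meas[of i k], of "{x}"] by simp
  next
    case 2 then show ?thesis using measurable_sets[OF \<mu>_meas[of j]] by simp
  qed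
qed

lemma history_eq: "history n = sigma (space M) (history_gen n)"
  by (simp add: past_def history_gen_def)

lemma history_gen_Pow: "history_gen n \<subseteq> Pow (space M)"
  using history_gen_sets sets.sets_into_space by blast

lemma space_history: "space (history n) = space M"
  unfolding history_eq using history_gen_Pow by (rule space_measure_of)

lemma sets_history: "sets (history n) = sigma_sets (space M) (history_gen n)"
  unfolding history_eq using history_gen_Pow by (rule sets_measure_of)

lemma history_subalgebra: "subalgebra M (history n)"
  unfolding subalgebra_def space_history sets_history
  using sets.sigma_sets_subset[OF history_gen_sets] by auto

lemma \<mu>_history: "j \<le> n \<Longrightarrow> \<mu> j \<in> borel_measurable (history n)"
  by (rule measurableI) (auto simp: space_history sets_history history_gen_def intro!: sigma_sets.Basic)

text \<open>The generators contain preimages of single states; finiteness of the state type extends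
  this to all sets of states.\<close>

lemma X_history: "j < n \<Longrightarrow> X (Suc j) k \<in> history n \<rightarrow>\<^sub>M count_space UNIV"
proof (subst measurable_count_space_eq2_countable, intro conjI ballI)
  fix x assume "j < n"
  then have "X (Suc j) k -` {x} \<inter> space M \<in> history_gen n"
    unfolding history_gen_def by (intro UnI1 CollectI exI[of _ "Suc j"] exI[of _ k] exI[of _ x]) simp
  then show "X (Suc j) k -` {x} \<inter> space (history n) \<in> sets (history n)"
    unfolding space_history sets_history by (rule sigma_sets.Basic)
qed simp_all

sublocale run: conditional_run P T idx Q w qsd l M "history n" "\<mu> n" "X (Suc n)" for n
proof unfold_locales
  show "subalgebra M (history n)" by (rule history_subalgebra)
  show "\<mu> n \<in> borel_measurable (history n)" by (rule \<mu>_history) simp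
  show "AE \<omega> in M. \<mu> n \<omega> \<in> prob_simplex" by (rule \<mu>_simplex)
  show "X (Suc n) k \<in> M \<rightarrow>\<^sub>M count_space UNIV" for k by measurable
  show "AE \<omega> in M. real_cond_exp M (history n) (indicator {\<omega>\<in>space M. \<forall>j\<le>k. X (Suc n) j \<omega> = s j}) \<omega> =
      path_prob P (extend_distribution idx (\<mu> n \<omega>)) k s" for k s
    using algorithm by (simp add: projection_algorithm_def)
qed

abbreviation \<tau> :: "nat \<Rightarrow> 'w \<Rightarrow> real" where "\<tau> n \<omega> \<equiv> real (run.life n \<omega>)"
abbreviation N where "N n \<omega> \<equiv> run.visits n \<omega>"
abbreviation \<xi> where "\<xi> n \<omega> \<equiv> run.noise n \<omega>"
abbreviation \<delta> where "\<delta> n \<omega> \<equiv> \<mu> n \<omega> - qsd"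

text \<open>A short run leads to a point already in the simplex, which the projection leaves fixed.
  For other runs only membership in the simplex is recorded.\<close>

lemma \<mu>_step:
  "AE \<omega> in M. \<mu> (Suc n) \<omega> \<in> prob_simplex \<and> \<mu> n \<omega> \<in> prob_simplex \<and>
     (\<epsilon> n * \<tau> n \<omega> \<le> 1 \<longrightarrow> \<mu> (Suc n) \<omega> = \<mu> n \<omega> + \<epsilon> n *\<^sub>R (N n \<omega> - \<tau> n \<omega> *\<^sub>R \<mu> n \<omega>))"
proof -
  have "AE \<omega> in M. \<mu> (Suc n) \<omega> = projection_step T idx (\<epsilon> n) (\<lambda>j. X (Suc n) j \<omega>) (\<mu> n \<omega>)"
    using algorithm by (simp add: projection_algorithm_def)
  with \<mu>_simplex[of n] show ?thesis
  proof eventually_elim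
    case (elim \<omega>)
    define z where "z = \<mu> n \<omega> + \<epsilon> n *\<^sub>R (N n \<omega> - \<tau> n \<omega> *\<^sub>R \<mu> n \<omega>)"
    have "(\<Sum>k<run.life n \<omega>. (\<chi> i. of_bool (X (Suc n) k \<omega> = idx i)) - \<mu> n \<omega>) = N n \<omega> - \<tau> n \<omega> *\<^sub>R \<mu> n \<omega>"
      by (simp add: vec_eq_iff run.visits_def sum_subtractf sum_constant_scaleR del: sum_constant)
    then have eq: "\<mu> (Suc n) \<omega> = closest_point prob_simplex z"
      using elim(2) by (simp add: projection_step_def run.life_def z_def)
    have "z \<in> prob_simplex" if "\<epsilon> n * \<tau> n \<omega> \<le> 1"
      using short_run_stays_in_simplex[OF elim(1), of "N n \<omega>" "\<epsilon> n"] run.visits_nn that \<epsilon>_pos[of n]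
      by (simp add: run.visits_sum z_def less_imp_le)
    then show ?case using elim(1) eq closest_simplex closest_point_self by (auto simp: z_def[symmetric])
  qed
qed

section \<open>Mean-square rate and convergence of the averages\<close>

lemma lyap_\<mu>_integrable: "integrable M (\<lambda>\<omega>. lyap (\<mu> n \<omega>))"
proof (rule integrable_const_bound[where B=lyap_bound])
  show "AE \<omega> in M. norm (lyap (\<mu> n \<omega>)) \<le> lyap_bound"
    using \<mu>_simplex[of n] by eventually_elim (simp add: lyap_nn lyap_le)
qed measurable

text \<open>In the mean of \<open>lyap_step\<close> the first-order term becomes the derivative
  along the drift, where \<open>lyap_drift\<close> applies; the bound on the second moment of the
  run length does not depend on \<open>n\<close>.\<close>

lemma lyap_mean_step:
  "(\<integral>\<omega>. lyap (\<mu> (Suc n) \<omega>) \<partial>M) - 1 \<le> (1 - 2 * gap * \<epsilon> n) * ((\<integral>\<omega>. lyap (\<mu> n \<omega>) \<partial>M) - 1)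
     + lyap_step_bound * run.moment_const * (\<epsilon> n)\<^sup>2"
proof -
  define L where "L = (\<lambda>\<omega>. lyap_deriv (\<mu> n \<omega>) (N n \<omega> - \<tau> n \<omega> *\<^sub>R \<mu> n \<omega>))"
  have Lint: "integrable M L" unfolding L_def by (rule run.lyap_deriv_mean)
  have "(\<integral>\<omega>. lyap (\<mu> (Suc n) \<omega>) \<partial>M) \<le> (\<integral>\<omega>. lyap (\<mu> n \<omega>) + \<epsilon> n * L \<omega> + lyap_step_bound * (\<epsilon> n)\<^sup>2 * (\<tau> n \<omega>)\<^sup>2 \<partial>M)"
  proof (rule integral_mono_AE[OF lyap_\<mu>_integrable])
    show "integrable M (\<lambda>\<omega>. lyap (\<mu> n \<omega>) + \<epsilon> n * L \<omega> + lyap_step_bound * (\<epsilon> n)\<^sup>2 * (\<tau> n \<omega>)\<^sup>2)"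
      by (intro Bochner_Integration.integrable_add integrable_mult_right lyap_\<mu>_integrable Lint run.life_integrable)
    show "AE \<omega> in M. lyap (\<mu> (Suc n) \<omega>) \<le> lyap (\<mu> n \<omega>) + \<epsilon> n * L \<omega> + lyap_step_bound * (\<epsilon> n)\<^sup>2 * (\<tau> n \<omega>)\<^sup>2"
      using \<mu>_step[of n]
    proof eventually_elim
      case (elim \<omega>)
      then show ?case
        using lyap_step[of "\<mu> n \<omega>" "\<mu> (Suc n) \<omega>" "N n \<omega>" "\<epsilon> n"] run.visits_nn \<epsilon>_pos[of n]
        by (simp add: run.visits_sum L_def)
    qed
  qed
  also have "\<dots> = (\<integral>\<omega>. lyap (\<mu> n \<omega>) \<partial>M) + \<epsilon> n * (\<integral>\<omega>. L \<omega> \<partial>M) + lyap_step_bound * (\<epsilon> n)\<^sup>2 * (\<integral>\<omega>. (\<tau> n \<omega>)\<^sup>2 \<partial>M)"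
    using lyap_\<mu>_integrable[of n] Lint run.life_integrable(2)[of n] by simp
  also have "\<dots> \<le> (\<integral>\<omega>. lyap (\<mu> n \<omega>) \<partial>M) + \<epsilon> n * (- (2 * gap) * ((\<integral>\<omega>. lyap (\<mu> n \<omega>) \<partial>M) - 1))
      + lyap_step_bound * (\<epsilon> n)\<^sup>2 * run.moment_const"
  proof (intro add_mono mult_left_mono order_refl)
    have "(\<integral>\<omega>. L \<omega> \<partial>M) = (\<integral>\<omega>. lyap_deriv (\<mu> n \<omega>) (drift (\<mu> n \<omega>)) \<partial>M)"
      unfolding L_def by (rule run.lyap_deriv_mean)
    also have "\<dots> \<le> (\<integral>\<omega>. - (2 * gap) * (lyap (\<mu> n \<omega>) - 1) \<partial>M)"
    proof (rule integral_mono_AE)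
      show "AE \<omega> in M. lyap_deriv (\<mu> n \<omega>) (drift (\<mu> n \<omega>)) \<le> - (2 * gap) * (lyap (\<mu> n \<omega>) - 1)"
        using \<mu>_simplex[of n] by eventually_elim (rule lyap_drift)
      show "integrable M (\<lambda>\<omega>. lyap_deriv (\<mu> n \<omega>) (drift (\<mu> n \<omega>)))" by (rule run.lyap_deriv_mean)
      show "integrable M (\<lambda>\<omega>. - (2 * gap) * (lyap (\<mu> n \<omega>) - 1))"
        using lyap_\<mu>_integrable[of n] by simp
    qed
    also have "\<dots> = - (2 * gap) * ((\<integral>\<omega>. lyap (\<mu> n \<omega>) \<partial>M) - 1)"
      using lyap_\<mu>_integrable[of n] by (simp add: prob_space)
    finally show "(\<integral>\<omega>. L \<omega> \<partial>M) \<le> - (2 * gap) * ((\<integral>\<omega>. lyap (\<mu> n \<omega>) \<partial>M) - 1)" .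
    show "(\<integral>\<omega>. (\<tau> n \<omega>)\<^sup>2 \<partial>M) \<le> run.moment_const" by (rule run.life_sq_mean)
    show "0 \<le> \<epsilon> n" using \<epsilon>_pos[of n] by simp
    show "0 \<le> lyap_step_bound * (\<epsilon> n)\<^sup>2" using lyap_step_bound_nn by simp
  qed
  finally show ?thesis by (simp add: algebra_simps)
qed

lemma \<delta>_sq_integrable: "integrable M (\<lambda>\<omega>. (norm (\<delta> n \<omega>))\<^sup>2)"
  and \<delta>_integrable: "integrable M (\<lambda>\<omega>. norm (\<delta> n \<omega>))"
proof -
  have *: "AE \<omega> in M. norm (\<delta> n \<omega>) \<le> 2"
    using \<mu>_simplex[of n]
  proof eventually_elim
    case (elim \<omega>)
    show ?case using norm_triangle_ineq4[of "\<mu> n \<omega>" qsd] simplex_norm_le1[OF elim] simplex_norm_le1[OF qsd_simplex] by simp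
  qed
  show "integrable M (\<lambda>\<omega>. norm (\<delta> n \<omega>))"
    by (rule integrable_const_bound[where B=2]) (use * in auto)
  have "AE \<omega> in M. norm ((norm (\<delta> n \<omega>))\<^sup>2) \<le> 2\<^sup>2"
    using *
  proof eventually_elim
    case (elim \<omega>)
    show ?case using power_mono[OF elim norm_ge_zero, of 2] by simp
  qed
  then show "integrable M (\<lambda>\<omega>. (norm (\<delta> n \<omega>))\<^sup>2)"
    by (rule integrable_const_bound) measurable
qed

text \<open>The mean excess of \<open>lyap\<close> obeys the recursion of
  \<open>powr_decay_recursion\<close>. The lower bound on the steps drives the contraction and
  converts the result back into a multiple of \<open>\<epsilon> n\<close>; the upper bound controls
  the quadratic term.\<close>

lemma \<delta>_sq_decay: "\<exists>K>0. \<forall>n. (\<integral>\<omega>. (norm (\<delta> n \<omega>))\<^sup>2 \<partial>M) \<le> K * \<epsilon> n"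
proof -
  define e where "e = (\<lambda>n. (\<integral>\<omega>. lyap (\<mu> n \<omega>) \<partial>M) - 1)"
  define C where "C = \<bar>lyap_step_bound * run.moment_const\<bar> * b\<^sup>2"
  define y where "y = (\<lambda>n. (real n + 1) powr - \<alpha>)"
  have e0: "0 \<le> e n" for n
  proof -
    have "(\<integral>\<omega>. 1 \<partial>M) \<le> (\<integral>\<omega>. lyap (\<mu> n \<omega>) \<partial>M)"
    proof (rule integral_mono_AE[OF _ lyap_\<mu>_integrable])
      show "AE \<omega> in M. 1 \<le> lyap (\<mu> n \<omega>)" using \<mu>_simplex[of n] by eventually_elim (rule lyap_ge1)
    qed simp
    then show ?thesis by (simp add: e_def prob_space)
  qed
  have "e (Suc n) \<le> (1 - 2 * gap * a * y n) * e n + C * (y n)\<^sup>2" for n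
  proof -
    have "e (Suc n) \<le> (1 - 2 * gap * \<epsilon> n) * e n + lyap_step_bound * run.moment_const * (\<epsilon> n)\<^sup>2"
      unfolding e_def by (rule lyap_mean_step)
    also have "\<dots> \<le> (1 - 2 * gap * (a * y n)) * e n + \<bar>lyap_step_bound * run.moment_const\<bar> * (b * y n)\<^sup>2"
    proof (intro add_mono mult_right_mono e0 mult_mono power_mono)
      show "1 - 2 * gap * \<epsilon> n \<le> 1 - 2 * gap * (a * y n)"
        using \<epsilon>_lower[of n] gap_pos by (simp add: y_def)
    qed (use \<epsilon>_upper[of n] \<epsilon>_pos[of n] in \<open>auto simp: y_def\<close>)
    finally show ?thesis by (simp add: C_def power_mult_distrib mult_ac)
  qed
  then have "\<exists>K. 0 \<le> K \<and> (\<forall>n. e n \<le> K * (real n + 1) powr - \<alpha>)"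
    using \<alpha> gap_pos a e0 by (intro powr_decay_recursion[of \<alpha> "2 * gap * a" C]) (auto simp: C_def y_def)
  then obtain K where K: "0 \<le> K" "\<And>n. e n \<le> K * y n" by (auto simp: y_def)
  obtain C' where C': "0 < C'" "\<And>x. x \<in> prob_simplex \<Longrightarrow> (norm (x - qsd))\<^sup>2 \<le> C' * (lyap x - 1)"
    using lyap_dist by blast
  \<comment> \<open>The added 1 makes the constant positive even when \<open>K = 0\<close>.\<close>
  have "(\<integral>\<omega>. (norm (\<delta> n \<omega>))\<^sup>2 \<partial>M) \<le> (C' * K / a + 1) * \<epsilon> n" for n
  proof -
    have "(\<integral>\<omega>. (norm (\<delta> n \<omega>))\<^sup>2 \<partial>M) \<le> (\<integral>\<omega>. C' * (lyap (\<mu> n \<omega>) - 1) \<partial>M)"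
    proof (rule integral_mono_AE[OF \<delta>_sq_integrable])
      show "AE \<omega> in M. (norm (\<delta> n \<omega>))\<^sup>2 \<le> C' * (lyap (\<mu> n \<omega>) - 1)"
        using \<mu>_simplex[of n] by eventually_elim (rule C')
    qed (use lyap_\<mu>_integrable[of n] in simp)
    also have "\<dots> = C' * e n" using lyap_\<mu>_integrable[of n] by (simp add: e_def prob_space)
    also have "\<dots> \<le> C' * (K * y n)" using K(2) C'(1) by (intro mult_left_mono) auto
    also have "\<dots> \<le> C' * (K * (\<epsilon> n / a))"
      using \<epsilon>_lower[of n] a C'(1) K(1) by (intro mult_left_mono) (auto simp: y_def field_simps)
    also have "\<dots> \<le> (C' * K / a + 1) * \<epsilon> n" using \<epsilon>_pos[of n] by (simp add: algebra_simps)
    finally show ?thesis .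
  qed
  moreover have "0 < C' * K / a + 1" using C'(1) K(1) a by (simp add: add_nonneg_pos)
  ultimately show ?thesis by blast
qed

lemma \<delta>_decay: "\<exists>K>0. \<forall>n. (\<integral>\<omega>. norm (\<delta> n \<omega>) \<partial>M) \<le> K * sqrt (\<epsilon> n)"
proof -
  obtain K where K: "0 < K" "\<And>n. (\<integral>\<omega>. (norm (\<delta> n \<omega>))\<^sup>2 \<partial>M) \<le> K * \<epsilon> n" using \<delta>_sq_decay by blast
  have "(\<integral>\<omega>. norm (\<delta> n \<omega>) \<partial>M) \<le> sqrt K * sqrt (\<epsilon> n)" for n
  proof -
    \<comment> \<open>Cauchy-Schwarz through the arithmetic-geometric mean inequality; this
      \<open>c\<close> is the parameter that balances the two terms.\<close>
    define c where "c = sqrt (K * \<epsilon> n)"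
    have c: "0 < c" "c\<^sup>2 = K * \<epsilon> n" using K(1) \<epsilon>_pos[of n] by (auto simp: c_def)
    have am: "t \<le> (t\<^sup>2 / c + c) / 2" for t :: real
    proof -
      have "0 \<le> (t - c)\<^sup>2 / c" using c by simp
      also have "\<dots> = t\<^sup>2 / c + c - 2 * t" using c(1) by (simp add: power2_eq_square field_simps)
      finally show ?thesis by simp
    qed
    have "(\<integral>\<omega>. norm (\<delta> n \<omega>) \<partial>M) \<le> (\<integral>\<omega>. ((norm (\<delta> n \<omega>))\<^sup>2 / c + c) / 2 \<partial>M)"
      using \<delta>_sq_integrable[of n] by (intro integral_mono \<delta>_integrable am) auto
    also have "\<dots> = ((\<integral>\<omega>. (norm (\<delta> n \<omega>))\<^sup>2 \<partial>M) / c + c) / 2"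
      using \<delta>_sq_integrable[of n] by (simp add: prob_space)
    also have "\<dots> \<le> (c\<^sup>2 / c + c) / 2"
      using K(2)[of n] c by (intro divide_right_mono add_mono) auto
    also have "\<dots> = c" using c(1) by (simp add: power2_eq_square)
    finally show ?thesis by (simp add: c_def real_sqrt_mult)
  qed
  then show ?thesis using K(1) by (intro exI[of _ "sqrt K"]) auto
qed

lemma averaged_eq:
  assumes "0 < n"
  shows "averaged_iterates \<mu> n \<omega> - qsd = (1 / real n) *\<^sub>R (\<Sum>k<n. \<delta> (Suc k) \<omega>)"
proof -
  have "(\<Sum>k=1..n. \<mu> k \<omega>) = (\<Sum>k<n. \<mu> (Suc k) \<omega>)"
    by (simp add: sum.atLeast1_atMost_eq)
  then show ?thesis
    using assms by (simp add: averaged_iterates_def sum_subtractf scaleR_diff_right sum_constant_scaleR del: sum_constant)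
qed

text \<open>Since \<open>E |\<mu> k - qsd|\<close> decays like \<open>k powr (- \<alpha> / 2)\<close>, the series of \<open>|\<mu> k - qsd| / k\<close> has finite mean.\<close>

lemma averaged_converges: "AE \<omega> in M. (\<lambda>n. averaged_iterates \<mu> n \<omega>) \<longlonglongrightarrow> qsd"
proof -
  obtain K where K: "0 < K" "\<And>n. (\<integral>\<omega>. norm (\<delta> n \<omega>) \<partial>M) \<le> K * sqrt (\<epsilon> n)" using \<delta>_decay by blast
  define f where "f = (\<lambda>k \<omega>. norm (\<delta> (Suc k) \<omega>) / real (Suc k))"
  \<comment> \<open>Half of the decay of the step sizes, times \<open>1 / (k + 1)\<close>: the
    exponent lies below -1 for any positive \<open>\<alpha>\<close>.\<close>
  define c where "c = (\<lambda>k. K * sqrt b * real (Suc k) powr (- 1 - \<alpha> / 2))"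
  have f0: "0 \<le> f k \<omega>" for k \<omega> by (simp add: f_def)
  have fint: "integrable M (f k)" for k using \<delta>_integrable[of "Suc k"] by (simp add: f_def)
  have fc: "(\<integral>\<omega>. f k \<omega> \<partial>M) \<le> c k" for k
  proof -
    have "(\<integral>\<omega>. f k \<omega> \<partial>M) \<le> K * sqrt (\<epsilon> (Suc k)) / real (Suc k)"
      unfolding f_def using K(2)[of "Suc k"] by (simp add: divide_right_mono del: of_nat_Suc)
    also have "\<dots> \<le> K * sqrt (b * real (Suc k) powr - \<alpha>) / real (Suc k)"
    proof -
      have "\<epsilon> (Suc k) \<le> \<epsilon> k" using \<epsilon>_decseq by (simp add: decseq_Suc_iff)
      also have "\<dots> \<le> b * real (Suc k) powr - \<alpha>" using \<epsilon>_upper[of k] by (simp add: add.commute)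
      finally show ?thesis using K(1) by (intro divide_right_mono mult_left_mono) auto
    qed
    also have "\<dots> = c k"
    proof -
      define t where "t = real (Suc k)"
      have t: "0 < t" by (simp add: t_def)
      have 1: "sqrt (t powr - \<alpha>) = t powr (- \<alpha> / 2)"
        using powr_half_sqrt[of "t powr - \<alpha>"] powr_powr[of t "- \<alpha>" "1 / 2"] by simp
      have "t powr (- 1) = 1 / t" using t by (simp add: powr_minus_divide)
      with 1 have "sqrt (t powr - \<alpha>) / t = t powr (- \<alpha> / 2) * t powr (- 1)" by simp
      also have "\<dots> = t powr (- 1 - \<alpha> / 2)" by (simp only: powr_add[symmetric]) (simp add: algebra_simps)
      finally have 2: "sqrt (t powr - \<alpha>) / t = t powr (- 1 - \<alpha> / 2)" .
      have "K * sqrt (b * t powr - \<alpha>) / t = K * sqrt b * (sqrt (t powr - \<alpha>) / t)"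
        by (simp add: real_sqrt_mult)
      then show ?thesis unfolding 2 by (simp add: c_def t_def[symmetric] del: of_nat_Suc)
    qed
    finally show ?thesis .
  qed
  have csum: "summable c"
  proof -
    have "summable (\<lambda>n. real n powr (- 1 - \<alpha> / 2))" using \<alpha> by (subst summable_real_powr_iff) auto
    then have "summable (\<lambda>n. real (Suc n) powr (- 1 - \<alpha> / 2))" by (subst summable_Suc_iff)
    then show ?thesis unfolding c_def by (rule summable_mult)
  qed
  have c0: "0 \<le> c k" for k unfolding c_def using K(1) b by simp
  have "(\<integral>\<^sup>+\<omega>. (\<Sum>k. ennreal (f k \<omega>)) \<partial>M) = (\<Sum>k. \<integral>\<^sup>+\<omega>. ennreal (f k \<omega>) \<partial>M)"
    by (rule nn_integral_suminf) (use fint in measurable)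
  also have "\<dots> \<le> (\<Sum>k. ennreal (c k))"
  proof (intro suminf_le summableI)
    fix k
    have "(\<integral>\<^sup>+\<omega>. ennreal (f k \<omega>) \<partial>M) = ennreal (\<integral>\<omega>. f k \<omega> \<partial>M)"
      by (rule nn_integral_eq_integral[OF fint]) (simp add: f0)
    then show "(\<integral>\<^sup>+\<omega>. ennreal (f k \<omega>) \<partial>M) \<le> ennreal (c k)" using fc by (simp add: ennreal_leI)
  qed
  also have "\<dots> = ennreal (\<Sum>k. c k)" by (rule suminf_ennreal2[OF c0 csum])
  finally have "(\<integral>\<^sup>+\<omega>. (\<Sum>k. ennreal (f k \<omega>)) \<partial>M) \<noteq> \<infinity>" by (auto simp: top_unique)
  then have "AE \<omega> in M. (\<Sum>k. ennreal (f k \<omega>)) \<noteq> \<infinity>"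
    using fint by (intro nn_integral_PInf_AE) auto
  then show ?thesis
  proof eventually_elim
    case (elim \<omega>)
    have "summable (\<lambda>k. f k \<omega>)" by (rule summable_suminf_not_top) (use elim f0 in auto)
    moreover have gt: "filterlim (\<lambda>n. real (Suc n)) at_top sequentially" by real_asymp
    \<comment> \<open>The weight \<open>Suc n\<close> is positive at \<open>n = 0\<close>; the
      factor 2 below passes from it back to \<open>n\<close>.\<close>
    ultimately have lim: "(\<lambda>n. (\<Sum>k<n. norm (\<delta> (Suc k) \<omega>)) / real (Suc n)) \<longlonglongrightarrow> 0"
      by (intro kronecker_nonneg[OF _ _ _ gt]) (auto simp: f_def mono_def)
    have "(\<lambda>n. averaged_iterates \<mu> n \<omega> - qsd) \<longlonglongrightarrow> 0"
    proof (rule Lim_null_comparison)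
      show "(\<lambda>n. 2 * ((\<Sum>k<n. norm (\<delta> (Suc k) \<omega>)) / real (Suc n))) \<longlonglongrightarrow> 0"
        using tendsto_mult_left[OF lim, of 2] by simp
      show "\<forall>\<^sub>F n in sequentially. norm (averaged_iterates \<mu> n \<omega> - qsd) \<le> 2 * ((\<Sum>k<n. norm (\<delta> (Suc k) \<omega>)) / real (Suc n))"
        using eventually_gt_at_top[of 0]
      proof eventually_elim
        case (elim n)
        have "norm (averaged_iterates \<mu> n \<omega> - qsd) = (1 / real n) * norm (\<Sum>k<n. \<delta> (Suc k) \<omega>)"
          using elim by (simp add: averaged_eq)
        also have "\<dots> \<le> (2 / real (Suc n)) * (\<Sum>k<n. norm (\<delta> (Suc k) \<omega>))"
          using elim by (intro mult_mono norm_sum) (auto simp: field_simps)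
        finally show ?case by simp
      qed
    qed
    then show ?case by (simp add: LIM_zero_iff)
  qed
qed

end


section \<open>The central limit theorem\<close>

text \<open>A quadratic form sees only the symmetric part of \<open>B\<close>, so averaging over
  both orders of the arguments gives a symmetric matrix with the same form.\<close>

lemma quadratic_form_matrix:
  fixes B :: "real^'m::finite \<Rightarrow> real^'m \<Rightarrow> real"
  assumes B: "bilinear B"
  shows "\<exists>V :: real^'m^'m. transpose V = V \<and> (\<forall>t. t \<bullet> (V *v t) = B t t)"
proof (intro exI conjI allI)
  define e where "e = (\<lambda>i. axis i 1 :: real^'m)"
  define V :: "real^'m^'m" where "V = (\<chi> i j. (B (e i) (e j) + B (e j) (e i)) / 2)"
  show "transpose V = V" by (simp add: V_def transpose_def vec_eq_iff add.commute)
  fix t :: "real^'m"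
  have t: "t = (\<Sum>i\<in>UNIV. t $ i *\<^sub>R e i)"
    using basis_expansion[of t] by (simp add: e_def scalar_mult_eq_scaleR)
  have "B t t = (\<Sum>i\<in>UNIV. \<Sum>j\<in>UNIV. B (t $ i *\<^sub>R e i) (t $ j *\<^sub>R e j))"
    by (subst (1 2) t) (simp add: bilinear_sum[OF B] sum.cartesian_product)
  also have "\<dots> = (\<Sum>i\<in>UNIV. \<Sum>j\<in>UNIV. t $ i * t $ j * B (e i) (e j))"
    by (intro sum.cong refl, subst bilinear_lmul[OF B], subst bilinear_rmul[OF B]) simp
  finally have 1: "B t t = (\<Sum>i\<in>UNIV. \<Sum>j\<in>UNIV. t $ i * t $ j * B (e i) (e j))" .
  have 2: "(\<Sum>i\<in>UNIV. \<Sum>j\<in>UNIV. t $ i * t $ j * B (e j) (e i)) = B t t"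
    unfolding 1 by (subst sum.swap) (simp add: mult_ac)
  have "t \<bullet> (V *v t) = (\<Sum>i\<in>UNIV. \<Sum>j\<in>UNIV. (t $ i * t $ j * B (e i) (e j)) / 2 + (t $ i * t $ j * B (e j) (e i)) / 2)"
    by (simp add: inner_vec_def matrix_vector_nth V_def sum_distrib_left algebra_simps add_divide_distrib)
  also have "\<dots> = B t t / 2 + B t t / 2"
    by (simp add: sum.distrib sum_divide_distrib[symmetric] 1[symmetric] 2)
  finally show "t \<bullet> (V *v t) = B t t" by simp
qed

section \<open>The martingale of accumulated noise and its Gaussian limit\<close>

context projected_process
begin

lemma \<delta>_tendsto: "(\<lambda>n. \<integral>\<omega>. norm (\<delta> n \<omega>) \<partial>M) \<longlonglongrightarrow> 0"
proof -
  obtain K where K: "0 < K" "\<And>n. (\<integral>\<omega>. norm (\<delta> n \<omega>) \<partial>M) \<le> K * sqrt (\<epsilon> n)" using \<delta>_decay by blast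
  have "(\<lambda>n. b * (real n + 1) powr - \<alpha>) \<longlonglongrightarrow> 0" using \<alpha> by real_asymp
  then have "\<epsilon> \<longlonglongrightarrow> 0"
    by (rule tendsto_sandwich[OF _ _ tendsto_const, rotated 2])
      (auto intro!: always_eventually less_imp_le[OF \<epsilon>_pos] \<epsilon>_upper)
  then have "(\<lambda>n. K * sqrt (\<epsilon> n)) \<longlonglongrightarrow> K * sqrt 0" by (intro tendsto_intros)
  then have lim: "(\<lambda>n. K * sqrt (\<epsilon> n)) \<longlonglongrightarrow> 0" by simp
  show ?thesis
    by (rule tendsto_sandwich[OF _ _ tendsto_const lim]) (auto intro!: always_eventually K)
qed

text \<open>Near \<open>qsd\<close> continuity makes the difference small; at distance at least
  \<open>c\<close> boundedness lets \<open>2 * B / c\<close> times the distance dominate it. Hence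
  convergence in mean of the iterates suffices.\<close>

lemma continuous_mean_tendsto:
  fixes h :: "real^'m \<Rightarrow> real"
  assumes h: "continuous_on UNIV h"
  shows "(\<lambda>n. \<integral>\<omega>. \<bar>h (\<mu> n \<omega>) - h qsd\<bar> \<partial>M) \<longlonglongrightarrow> 0"
proof (rule LIMSEQ_I)
  fix r :: real assume r: "0 < r"
  obtain B where B: "\<And>y. y \<in> prob_simplex \<Longrightarrow> \<bar>h y\<bar> \<le> B" using continuous_bounded_simplex[OF h] by auto
  have B0: "0 \<le> B" using B[OF qsd_simplex] by simp
  have "isCont h qsd" using h by (simp add: continuous_on_eq_continuous_at)
  then obtain c where c: "0 < c" "\<And>y. dist y qsd < c \<Longrightarrow> dist (h y) (h qsd) < r / 4"
    using r unfolding continuous_at_eps_delta by (metis divide_pos_pos zero_less_numeral)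
  have pt: "\<bar>h y - h qsd\<bar> \<le> r / 4 + 2 * B / c * norm (y - qsd)" if y: "y \<in> prob_simplex" for y
  proof (cases "norm (y - qsd) < c")
    case True
    have "0 \<le> 2 * B / c * norm (y - qsd)" using B0 c(1) by simp
    then show ?thesis using c(2)[of y] True by (simp add: dist_norm)
  next
    case False
    have "\<bar>h y - h qsd\<bar> \<le> 2 * B" using B[OF y] B[OF qsd_simplex] by linarith
    also have "\<dots> = 2 * B / c * c" using c(1) by simp
    also have "\<dots> \<le> 2 * B / c * norm (y - qsd)" using False B0 c(1) by (intro mult_left_mono) auto
    finally show ?thesis using r by linarith
  qed
  have hm[measurable]: "h \<in> borel_measurable borel" by (rule borel_measurable_continuous_onI[OF h])
  have hint: "integrable M (\<lambda>\<omega>. h (\<mu> n \<omega>))" for n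
    using run.integrable_continuous_mult[of "\<lambda>_. 1", OF _ h] by simp
  have le: "(\<integral>\<omega>. \<bar>h (\<mu> n \<omega>) - h qsd\<bar> \<partial>M) \<le> r / 4 + 2 * B / c * (\<integral>\<omega>. norm (\<delta> n \<omega>) \<partial>M)" for n
  proof -
    have "(\<integral>\<omega>. \<bar>h (\<mu> n \<omega>) - h qsd\<bar> \<partial>M) \<le> (\<integral>\<omega>. r / 4 + 2 * B / c * norm (\<delta> n \<omega>) \<partial>M)"
    proof (rule integral_mono_AE)
      show "AE \<omega> in M. \<bar>h (\<mu> n \<omega>) - h qsd\<bar> \<le> r / 4 + 2 * B / c * norm (\<delta> n \<omega>)"
        using \<mu>_simplex[of n] by eventually_elim (rule pt)
    qed (use hint \<delta>_integrable in simp_all)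
    also have "\<dots> = r / 4 + 2 * B / c * (\<integral>\<omega>. norm (\<delta> n \<omega>) \<partial>M)"
      using \<delta>_integrable[of n] by (subst Bochner_Integration.integral_add) (simp_all add: prob_space)
    finally show ?thesis .
  qed
  have "(\<lambda>n. r / 4 + 2 * B / c * (\<integral>\<omega>. norm (\<delta> n \<omega>) \<partial>M)) \<longlonglongrightarrow> r / 4 + 2 * B / c * 0"
    by (intro tendsto_intros \<delta>_tendsto)
  then have "\<forall>\<^sub>F n in sequentially. r / 4 + 2 * B / c * (\<integral>\<omega>. norm (\<delta> n \<omega>) \<partial>M) < r"
    by (rule order_tendstoD(2)) (use r in simp)
  then have "\<forall>\<^sub>F n in sequentially. norm ((\<integral>\<omega>. \<bar>h (\<mu> n \<omega>) - h qsd\<bar> \<partial>M) - 0) < r"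
  proof eventually_elim
    case (elim n)
    have "0 \<le> (\<integral>\<omega>. \<bar>h (\<mu> n \<omega>) - h qsd\<bar> \<partial>M)" by (rule integral_nonneg_AE) simp
    then show ?case using le[of n] elim by simp
  qed
  then show "\<exists>no. \<forall>n\<ge>no. norm ((\<integral>\<omega>. \<bar>h (\<mu> n \<omega>) - h qsd\<bar> \<partial>M) - 0) < r"
    unfolding eventually_sequentially .
qed

definition mart :: "real^'m \<Rightarrow> nat \<Rightarrow> 'w \<Rightarrow> real" where
  "mart g n \<omega> = (\<Sum>k<n. g \<bullet> \<xi> k \<omega>)"

lemma noise_history: "k < n \<Longrightarrow> \<xi> k \<in> borel_measurable (history n)"
  by (rule run.noise_measurable) (auto intro: X_history \<mu>_history)

lemma mart_history: "mart g n \<in> borel_measurable (history n)"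
proof -
  have "(\<lambda>\<omega>. g \<bullet> \<xi> k \<omega>) \<in> borel_measurable (history n)" if "k < n" for k
    using noise_history[OF that] by measurable
  then show ?thesis unfolding mart_def[abs_def] by (intro borel_measurable_sum) auto
qed

lemma mart_meas[measurable]: "mart g n \<in> borel_measurable M"
  by (rule run.F_M[OF mart_history])

lemma noise_norm: "\<exists>C>0. \<forall>n. AE \<omega> in M. norm (\<xi> n \<omega>) \<le> C * (\<tau> n \<omega> + 1)"
proof -
  obtain D where D: "\<And>y. y \<in> prob_simplex \<Longrightarrow> norm (drift y) \<le> D"
    using continuous_bounded_simplex[OF continuous_drift] by blast
  have D0: "0 \<le> D" using D[OF qsd_simplex] norm_ge_zero order_trans by blast
  have "AE \<omega> in M. norm (\<xi> n \<omega>) \<le> (2 + D) * (\<tau> n \<omega> + 1)" for n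
    using \<mu>_simplex[of n]
  proof eventually_elim
    case (elim \<omega>)
    have "norm (\<xi> n \<omega>) \<le> norm (N n \<omega> - \<tau> n \<omega> *\<^sub>R \<mu> n \<omega>) + norm (drift (\<mu> n \<omega>))"
      unfolding run.noise_def by (rule norm_triangle_ineq4)
    also have "\<dots> \<le> 2 * \<tau> n \<omega> + D"
      using visits_norm_le[OF elim, of "N n \<omega>"] D[OF elim] run.visits_nn by (simp add: run.visits_sum add_mono)
    also have "\<dots> \<le> (2 + D) * (\<tau> n \<omega> + 1)" using D0 by (simp add: algebra_simps)
    finally show ?case .
  qed
  then show ?thesis using D0 by (intro exI[of _ "2 + D"]) auto
qed

text \<open>A bound uniform in \<open>n\<close> for the moment that controls the Taylor remainder of
  the cosine.\<close>

lemma noise_cubic: "\<exists>C\<ge>0. \<forall>n. integrable M (\<lambda>\<omega>. \<bar>g \<bullet> \<xi> n \<omega>\<bar> ^ 3) \<and> (\<integral>\<omega>. \<bar>g \<bullet> \<xi> n \<omega>\<bar> ^ 3 \<partial>M) \<le> C"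
proof -
  obtain C where C: "0 < C" "\<And>n. AE \<omega> in M. norm (\<xi> n \<omega>) \<le> C * (\<tau> n \<omega> + 1)" using noise_norm by blast
  define A where "A = (norm g * C) ^ 3"
  have A: "0 \<le> A" using C(1) by (simp add: A_def)
  have cube: "(real k + 1) ^ 3 \<le> 8 * real k ^ 3 + 1" for k :: nat
  proof (cases "k = 0")
    case False
    then have "(real k + 1) ^ 3 \<le> (2 * real k) ^ 3" by (intro power_mono) auto
    then show ?thesis by (simp add: power_mult_distrib)
  qed simp
  have bnd: "AE \<omega> in M. \<bar>g \<bullet> \<xi> n \<omega>\<bar> ^ 3 \<le> A * (8 * \<tau> n \<omega> ^ 3 + 1)" for n
    using C(2)[of n]
  proof eventually_elim
    case (elim \<omega>)
    have "\<bar>g \<bullet> \<xi> n \<omega>\<bar> \<le> norm g * (C * (\<tau> n \<omega> + 1))"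
      using Cauchy_Schwarz_ineq2[of g "\<xi> n \<omega>"] elim by (meson mult_left_mono norm_ge_zero order_trans)
    then have "\<bar>g \<bullet> \<xi> n \<omega>\<bar> ^ 3 \<le> (norm g * (C * (\<tau> n \<omega> + 1))) ^ 3" by (intro power_mono) auto
    also have "\<dots> = A * (\<tau> n \<omega> + 1) ^ 3" by (simp add: A_def power_mult_distrib mult_ac)
    also have "\<dots> \<le> A * (8 * \<tau> n \<omega> ^ 3 + 1)" by (intro mult_left_mono cube A)
    finally show ?case .
  qed
  have int: "integrable M (\<lambda>\<omega>. A * (8 * \<tau> n \<omega> ^ 3 + 1))" for n
    using run.life_moment(1)[of n] by simp
  have I: "integrable M (\<lambda>\<omega>. \<bar>g \<bullet> \<xi> n \<omega>\<bar> ^ 3)" for n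
    by (rule Bochner_Integration.integrable_bound[OF int[of n]]) (use bnd[of n] A in auto)
  have "(\<integral>\<omega>. \<bar>g \<bullet> \<xi> n \<omega>\<bar> ^ 3 \<partial>M) \<le> A * (8 * run.moment_const + 1)" for n
  proof -
    have "(\<integral>\<omega>. \<bar>g \<bullet> \<xi> n \<omega>\<bar> ^ 3 \<partial>M) \<le> (\<integral>\<omega>. A * (8 * \<tau> n \<omega> ^ 3 + 1) \<partial>M)"
      by (rule integral_mono_AE[OF I int bnd])
    also have "\<dots> = A * (8 * (\<integral>\<omega>. \<tau> n \<omega> ^ 3 \<partial>M) + 1)" using run.life_moment(1)[of n] by (simp add: prob_space)
    also have "\<dots> \<le> A * (8 * run.moment_const + 1)"
      using run.life_moment(2)[of n] A by (intro mult_left_mono add_mono) auto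
    finally show ?thesis .
  qed
  then have "(\<integral>\<omega>. \<bar>g \<bullet> \<xi> n \<omega>\<bar> ^ 3 \<partial>M) \<le> \<bar>A * (8 * run.moment_const + 1)\<bar>" for n
    using abs_ge_self order_trans by blast
  then show ?thesis using I by (intro exI[of _ "\<bar>A * (8 * run.moment_const + 1)\<bar>"]) auto
qed

lemma noise_sq: "integrable M (\<lambda>\<omega>. (g \<bullet> \<xi> n \<omega>)\<^sup>2)" "(\<integral>\<omega>. (g \<bullet> \<xi> n \<omega>)\<^sup>2 \<partial>M) = (\<integral>\<omega>. noise_var g (\<mu> n \<omega>) \<partial>M)"
proof -
  have one: "(\<lambda>_. 1 :: real) \<in> borel_measurable (history n)" "integrable M (\<lambda>_. 1 :: real)" by simp_all
  have "integrable M (\<lambda>\<omega>. 1 * (\<tau> n \<omega>)\<^sup>2)" using run.life_integrable(2)[of n] by (simp only: mult_1)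
  note nv = run.noise_variance[OF one this, of g]
  show "integrable M (\<lambda>\<omega>. (g \<bullet> \<xi> n \<omega>)\<^sup>2)" "(\<integral>\<omega>. (g \<bullet> \<xi> n \<omega>)\<^sup>2 \<partial>M) = (\<integral>\<omega>. noise_var g (\<mu> n \<omega>) \<partial>M)"
    using nv by (simp_all only: mult_1)
qed

text \<open>The sign is not visible in the formula. It is inherited from the second moments of the
  actual noise along the iterates, which converge to \<open>noise_var g qsd\<close>.\<close>

lemma noise_var_nonneg: "0 \<le> noise_var g qsd"
proof (rule LIMSEQ_le_const)
  have "(\<lambda>n. \<integral>\<omega>. noise_var g (\<mu> n \<omega>) - noise_var g qsd \<partial>M) \<longlonglongrightarrow> 0"
    by (rule Lim_null_comparison[OF _ continuous_mean_tendsto[OF continuous_noise_var, of g]])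
      (auto intro!: always_eventually integral_abs_bound)
  moreover have "(\<integral>\<omega>. noise_var g (\<mu> n \<omega>) - noise_var g qsd \<partial>M) = (\<integral>\<omega>. noise_var g (\<mu> n \<omega>) \<partial>M) - noise_var g qsd" for n
    using run.integrable_continuous_mult[where Z="\<lambda>_. 1" and n=n, OF _ continuous_noise_var[of _ g]]
    by (simp add: prob_space)
  ultimately show "(\<lambda>n. \<integral>\<omega>. noise_var g (\<mu> n \<omega>) \<partial>M) \<longlonglongrightarrow> noise_var g qsd"
    by (simp add: LIM_zero_iff)
  show "\<exists>N. \<forall>n\<ge>N. 0 \<le> (\<integral>\<omega>. noise_var g (\<mu> n \<omega>) \<partial>M)"
    by (simp flip: noise_sq(2))
qed

text \<open>Orthogonality of martingale increments. Integrability is carried through the induction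
  because \<open>noise_mean\<close> for the cross term asks that the martingale times the next run
  length be integrable.\<close>

lemma mart_sq: "integrable M (\<lambda>\<omega>. (mart g n \<omega>)\<^sup>2) \<and> (\<integral>\<omega>. (mart g n \<omega>)\<^sup>2 \<partial>M) = (\<Sum>k<n. \<integral>\<omega>. (g \<bullet> \<xi> k \<omega>)\<^sup>2 \<partial>M)"
proof (induction n)
  case 0
  then show ?case by (simp add: mart_def)
next
  case (Suc n)
  have I2: "integrable M (\<lambda>\<omega>. (mart g n \<omega>)\<^sup>2)" using Suc by simp
  have I1: "integrable M (mart g n)"
  proof (rule Bochner_Integration.integrable_bound)
    show "integrable M (\<lambda>\<omega>. (mart g n \<omega>)\<^sup>2 + 1)" using I2 by simp
    have "\<bar>t\<bar> \<le> t\<^sup>2 + 1" for t :: real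
      using zero_le_power2[of "\<bar>t\<bar> - 1"] zero_le_power2[of t] by (simp add: power2_diff)
    then show "AE \<omega> in M. norm (mart g n \<omega>) \<le> norm ((mart g n \<omega>)\<^sup>2 + 1)" by auto
  qed measurable
  have I3: "integrable M (\<lambda>\<omega>. mart g n \<omega> * \<tau> n \<omega>)"
  proof (rule Bochner_Integration.integrable_bound)
    show "integrable M (\<lambda>\<omega>. (mart g n \<omega>)\<^sup>2 + (\<tau> n \<omega>)\<^sup>2)" using I2 run.life_integrable(2)[of n] by simp
    have "\<bar>s * t\<bar> \<le> s\<^sup>2 + t\<^sup>2" for s t :: real
    proof -
      have 1: "2 * (\<bar>s\<bar> * \<bar>t\<bar>) \<le> s\<^sup>2 + t\<^sup>2"
        using zero_le_power2[of "\<bar>s\<bar> - \<bar>t\<bar>"] by (simp add: power2_diff mult.assoc)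
      have 2: "0 \<le> \<bar>s\<bar> * \<bar>t\<bar>" by simp
      show ?thesis unfolding abs_mult using 1 2 by linarith
    qed
    then show "AE \<omega> in M. norm (mart g n \<omega> * \<tau> n \<omega>) \<le> norm ((mart g n \<omega>)\<^sup>2 + (\<tau> n \<omega>)\<^sup>2)" by auto
  qed measurable
  note nm = run.noise_mean[OF mart_history I1 I3, of g]
  have eq: "(mart g (Suc n) \<omega>)\<^sup>2 = (mart g n \<omega>)\<^sup>2 + 2 * (mart g n \<omega> * (g \<bullet> \<xi> n \<omega>)) + (g \<bullet> \<xi> n \<omega>)\<^sup>2" for \<omega>
    by (simp add: mart_def power2_sum)
  show ?case unfolding eq using Suc nm noise_sq(1)[of g n] by simp
qed

lemma noise_sq_bound: "\<exists>C. \<forall>n. (\<integral>\<omega>. (g \<bullet> \<xi> n \<omega>)\<^sup>2 \<partial>M) \<le> C"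
proof -
  obtain C where C: "\<And>n. integrable M (\<lambda>\<omega>. \<bar>g \<bullet> \<xi> n \<omega>\<bar> ^ 3)" "\<And>n. (\<integral>\<omega>. \<bar>g \<bullet> \<xi> n \<omega>\<bar> ^ 3 \<partial>M) \<le> C"
    using noise_cubic[of g] by blast
  have t: "t\<^sup>2 \<le> \<bar>t\<bar> ^ 3 + 1" for t :: real
  proof (cases "\<bar>t\<bar> \<le> 1")
    case True then show ?thesis using power_le_one[of "\<bar>t\<bar>" 2] by (simp add: add_increasing)
  next
    case False then show ?thesis using power_increasing[of 2 3 "\<bar>t\<bar>"] by simp
  qed
  have "(\<integral>\<omega>. (g \<bullet> \<xi> n \<omega>)\<^sup>2 \<partial>M) \<le> C + 1" for n
  proof -
    have "(\<integral>\<omega>. (g \<bullet> \<xi> n \<omega>)\<^sup>2 \<partial>M) \<le> (\<integral>\<omega>. \<bar>g \<bullet> \<xi> n \<omega>\<bar> ^ 3 + 1 \<partial>M)"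
      using C(1) t by (intro integral_mono noise_sq) auto
    also have "\<dots> \<le> C + 1" using C(1)[of n] C(2)[of n] by (simp add: prob_space)
    finally show ?thesis .
  qed
  then show ?thesis by blast
qed

text \<open>The second moment controls the first through
  \<open>\<bar>t\<bar> \<le> t\<^sup>2 + 1\<close>; the result supplies tightness in the final
  limit.\<close>

lemma mart_abs_bound: "\<exists>C. \<forall>n>0. (\<integral>\<omega>. \<bar>mart g n \<omega> / sqrt (real n)\<bar> \<partial>M) \<le> C \<and> integrable M (\<lambda>\<omega>. \<bar>mart g n \<omega> / sqrt (real n)\<bar>)"
proof -
  obtain C where C: "\<And>n. (\<integral>\<omega>. (g \<bullet> \<xi> n \<omega>)\<^sup>2 \<partial>M) \<le> C" using noise_sq_bound[of g] by blast
  have t: "\<bar>t\<bar> \<le> t\<^sup>2 + 1" for t :: real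
    using zero_le_power2[of "\<bar>t\<bar> - 1"] zero_le_power2[of t] by (simp add: power2_diff)
  have t': "norm \<bar>u\<bar> \<le> norm (u\<^sup>2 + 1)" for u :: real
    using t[of u] unfolding real_norm_def abs_abs by linarith
  have "(\<integral>\<omega>. \<bar>mart g n \<omega> / sqrt (real n)\<bar> \<partial>M) \<le> C + 1 \<and> integrable M (\<lambda>\<omega>. \<bar>mart g n \<omega> / sqrt (real n)\<bar>)" if n: "0 < n" for n
  proof -
    have I: "integrable M (\<lambda>\<omega>. (mart g n \<omega> / sqrt (real n))\<^sup>2 + 1)"
      using mart_sq[of g n] by (simp add: power_divide)
    have J: "integrable M (\<lambda>\<omega>. \<bar>mart g n \<omega> / sqrt (real n)\<bar>)"
    proof (rule Bochner_Integration.integrable_bound[OF I])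
      show "AE \<omega> in M. norm \<bar>mart g n \<omega> / sqrt (real n)\<bar> \<le> norm ((mart g n \<omega> / sqrt (real n))\<^sup>2 + 1)"
        by (intro AE_I2 t')
    qed measurable
    have "(\<integral>\<omega>. \<bar>mart g n \<omega> / sqrt (real n)\<bar> \<partial>M) \<le> (\<integral>\<omega>. (mart g n \<omega> / sqrt (real n))\<^sup>2 + 1 \<partial>M)"
      by (intro integral_mono I J t)
    also have "\<dots> = (\<Sum>k<n. \<integral>\<omega>. (g \<bullet> \<xi> k \<omega>)\<^sup>2 \<partial>M) / real n + 1"
      using mart_sq[of g n] by (simp add: power_divide prob_space)
    also have "\<dots> \<le> (\<Sum>k<n. C) / real n + 1" by (intro add_mono divide_right_mono sum_mono C) auto
    also have "\<dots> = C + 1" using n by simp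
    finally show ?thesis using J by simp
  qed
  then show ?thesis by blast
qed

text \<open>One step multiplies \<open>E (cos (h * mart g n + \<beta>))\<close> by \<open>1 - h\<^sup>2 * noise_var g qsd / 2\<close> up to small errors;
  taking cosines with an arbitrary phase avoids complex numbers.\<close>

lemma mart_cos_step:
  fixes h :: real
  assumes C: "integrable M (\<lambda>\<omega>. \<bar>g \<bullet> \<xi> n \<omega>\<bar> ^ 3)" "(\<integral>\<omega>. \<bar>g \<bullet> \<xi> n \<omega>\<bar> ^ 3 \<partial>M) \<le> C" and h: "0 \<le> h"
  shows "\<bar>(\<integral>\<omega>. cos (h * mart g (Suc n) \<omega> + \<beta>) \<partial>M) - (1 - h\<^sup>2 * noise_var g qsd / 2) * (\<integral>\<omega>. cos (h * mart g n \<omega> + \<beta>) \<partial>M)\<bar>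
    \<le> h ^ 3 * C + h\<^sup>2 / 2 * (\<integral>\<omega>. \<bar>noise_var g (\<mu> n \<omega>) - noise_var g qsd\<bar> \<partial>M)"
proof -
  define D where "D = (\<lambda>\<omega>. g \<bullet> \<xi> n \<omega>)"
  define A where "A = (\<lambda>\<omega>. h * mart g n \<omega> + \<beta>)"
  define v where "v = noise_var g"
  have AF: "A \<in> borel_measurable (history n)" unfolding A_def using mart_history[of g n] by measurable
  have cF: "(\<lambda>\<omega>. cos (A \<omega>)) \<in> borel_measurable (history n)" "(\<lambda>\<omega>. sin (A \<omega>)) \<in> borel_measurable (history n)"
    using AF by measurable
  have [measurable]: "A \<in> borel_measurable M" by (rule run.F_M[OF AF])
  have [measurable]: "D \<in> borel_measurable M" unfolding D_def by measurable
  have ci: "integrable M (\<lambda>\<omega>. cos (A \<omega>))" "integrable M (\<lambda>\<omega>. sin (A \<omega>))"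
    by (rule integrable_const_bound[where B=1]; simp)+
  have ct: "integrable M (\<lambda>\<omega>. sin (A \<omega>) * \<tau> n \<omega>)" "integrable M (\<lambda>\<omega>. cos (A \<omega>) * (\<tau> n \<omega>)\<^sup>2)"
    using integrable_mult_bounded[OF run.life_integrable(1)[of n], of "\<lambda>\<omega>. sin (A \<omega>)" 1]
      integrable_mult_bounded[OF run.life_integrable(2)[of n], of "\<lambda>\<omega>. cos (A \<omega>)" 1]
    by (simp_all add: mult.commute)
  note nm = run.noise_mean[OF cF(2) ci(2) ct(1), of g, folded D_def]
  note nv = run.noise_variance[OF cF(1) ci(1) ct(2), of g, folded D_def v_def]
  have D2: "(\<integral>\<omega>. sin (A \<omega>) * D \<omega> \<partial>M) = 0" "integrable M (\<lambda>\<omega>. sin (A \<omega>) * D \<omega>)"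
    using nm unfolding D_def by auto
  have V2: "(\<integral>\<omega>. cos (A \<omega>) * (D \<omega>)\<^sup>2 \<partial>M) = (\<integral>\<omega>. cos (A \<omega>) * v (\<mu> n \<omega>) \<partial>M)" "integrable M (\<lambda>\<omega>. cos (A \<omega>) * (D \<omega>)\<^sup>2)"
    using nv unfolding D_def by auto
  have vi: "integrable M (\<lambda>\<omega>. cos (A \<omega>) * v (\<mu> n \<omega>))"
    unfolding v_def by (rule run.integrable_continuous_mult[OF ci(1) continuous_noise_var])
  have vi1: "integrable M (\<lambda>\<omega>. v (\<mu> n \<omega>))"
    unfolding v_def using run.integrable_continuous_mult[where Z="\<lambda>_. 1" and n=n, OF _ continuous_noise_var[of _ g]] by simp
  define c where "c = (\<integral>\<omega>. cos (A \<omega>) \<partial>M)"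
  \<comment> \<open>The second-order Taylor polynomial of the cosine around \<open>A\<close>; the
    term linear in \<open>D\<close> has mean 0.\<close>
  define T where "T = (\<lambda>\<omega>. cos (A \<omega>) - h * (sin (A \<omega>) * D \<omega>) - h\<^sup>2 / 2 * (cos (A \<omega>) * (D \<omega>)\<^sup>2))"
  have Ti: "integrable M T" unfolding T_def using ci(1) D2(2) V2(2) by simp
  have TI: "(\<integral>\<omega>. T \<omega> \<partial>M) = c - h\<^sup>2 / 2 * (\<integral>\<omega>. cos (A \<omega>) * v (\<mu> n \<omega>) \<partial>M)"
    unfolding T_def c_def using ci(1) D2 V2 by simp
  have s: "h * mart g (Suc n) \<omega> + \<beta> = A \<omega> + h * D \<omega>" for \<omega>
    by (simp add: mart_def A_def D_def algebra_simps)
  have ci': "integrable M (\<lambda>\<omega>. cos (A \<omega> + h * D \<omega>))" by (rule integrable_const_bound[where B=1]) simp_all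
  have "\<bar>(\<integral>\<omega>. cos (A \<omega> + h * D \<omega>) \<partial>M) - (\<integral>\<omega>. T \<omega> \<partial>M)\<bar> = \<bar>\<integral>\<omega>. cos (A \<omega> + h * D \<omega>) - T \<omega> \<partial>M\<bar>"
    using ci' Ti by simp
  also have "\<dots> \<le> (\<integral>\<omega>. \<bar>cos (A \<omega> + h * D \<omega>) - T \<omega>\<bar> \<partial>M)" by (rule integral_abs_bound)
  also have "\<dots> \<le> (\<integral>\<omega>. h ^ 3 * \<bar>D \<omega>\<bar> ^ 3 \<partial>M)"
  proof (rule integral_mono)
    show "\<bar>cos (A \<omega> + h * D \<omega>) - T \<omega>\<bar> \<le> h ^ 3 * \<bar>D \<omega>\<bar> ^ 3" for \<omega>
      using cos_taylor2[of "A \<omega>" "h * D \<omega>"] h by (simp add: T_def abs_mult power_mult_distrib mult_ac)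
    show "integrable M (\<lambda>\<omega>. h ^ 3 * \<bar>D \<omega>\<bar> ^ 3)" using C(1) by (simp add: D_def)
  qed (use ci' Ti in simp)
  also have "\<dots> \<le> h ^ 3 * C" using C h by (simp add: D_def mult_left_mono)
  finally have 1: "\<bar>(\<integral>\<omega>. cos (A \<omega> + h * D \<omega>) \<partial>M) - (\<integral>\<omega>. T \<omega> \<partial>M)\<bar> \<le> h ^ 3 * C" .
  have "\<bar>(\<integral>\<omega>. cos (A \<omega>) * v (\<mu> n \<omega>) \<partial>M) - v qsd * c\<bar> = \<bar>\<integral>\<omega>. cos (A \<omega>) * v (\<mu> n \<omega>) - v qsd * cos (A \<omega>) \<partial>M\<bar>"
    unfolding c_def using vi ci(1) by simp
  also have "\<dots> \<le> (\<integral>\<omega>. \<bar>cos (A \<omega>) * v (\<mu> n \<omega>) - v qsd * cos (A \<omega>)\<bar> \<partial>M)" by (rule integral_abs_bound)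
  also have "\<dots> \<le> (\<integral>\<omega>. \<bar>v (\<mu> n \<omega>) - v qsd\<bar> \<partial>M)"
  proof (rule integral_mono)
    fix \<omega>
    have "\<bar>cos (A \<omega>) * v (\<mu> n \<omega>) - v qsd * cos (A \<omega>)\<bar> = \<bar>cos (A \<omega>)\<bar> * \<bar>v (\<mu> n \<omega>) - v qsd\<bar>"
      by (simp add: abs_mult[symmetric] algebra_simps)
    also have "\<dots> \<le> 1 * \<bar>v (\<mu> n \<omega>) - v qsd\<bar>" by (intro mult_right_mono abs_cos_le_one) simp
    finally show "\<bar>cos (A \<omega>) * v (\<mu> n \<omega>) - v qsd * cos (A \<omega>)\<bar> \<le> \<bar>v (\<mu> n \<omega>) - v qsd\<bar>" by simp
  qed (use vi ci(1) vi1 in simp_all)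
  finally have 2: "\<bar>(\<integral>\<omega>. cos (A \<omega>) * v (\<mu> n \<omega>) \<partial>M) - v qsd * c\<bar> \<le> (\<integral>\<omega>. \<bar>v (\<mu> n \<omega>) - v qsd\<bar> \<partial>M)" .
  have "\<bar>(\<integral>\<omega>. T \<omega> \<partial>M) - (1 - h\<^sup>2 * v qsd / 2) * c\<bar> = h\<^sup>2 / 2 * \<bar>(\<integral>\<omega>. cos (A \<omega>) * v (\<mu> n \<omega>) \<partial>M) - v qsd * c\<bar>"
  proof -
    have "(\<integral>\<omega>. T \<omega> \<partial>M) - (1 - h\<^sup>2 * v qsd / 2) * c = - (h\<^sup>2 / 2 * ((\<integral>\<omega>. cos (A \<omega>) * v (\<mu> n \<omega>) \<partial>M) - v qsd * c))"
      unfolding TI by (simp add: algebra_simps)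
    then show ?thesis by (simp add: abs_mult)
  qed
  also have "\<dots> \<le> h\<^sup>2 / 2 * (\<integral>\<omega>. \<bar>v (\<mu> n \<omega>) - v qsd\<bar> \<partial>M)" using 2 by (intro mult_left_mono) auto
  finally have 3: "\<bar>(\<integral>\<omega>. T \<omega> \<partial>M) - (1 - h\<^sup>2 * v qsd / 2) * c\<bar>
      \<le> h\<^sup>2 / 2 * (\<integral>\<omega>. \<bar>v (\<mu> n \<omega>) - v qsd\<bar> \<partial>M)" .
  have c: "(\<integral>\<omega>. cos (h * mart g n \<omega> + \<beta>) \<partial>M) = c" by (simp add: c_def A_def)
  show ?thesis using 1 3 unfolding s c v_def[symmetric] by linarith
qed

text \<open>For each \<open>n\<close> the one-step estimate is iterated with the fixed scale
  \<open>h = 1 / sqrt n\<close>, so the factor is constant and its \<open>n\<close>-th power tends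
  to an exponential. The accumulated errors are \<open>n * h ^ 3 * C\<close> and a Cesaro mean of
  \<open>r\<close>.\<close>

lemma mart_cos_tendsto:
  "(\<lambda>n. \<integral>\<omega>. cos (mart g n \<omega> / sqrt (real n) + \<beta>) \<partial>M) \<longlonglongrightarrow> exp (- noise_var g qsd / 2) * cos \<beta>"
proof -
  obtain C where C: "0 \<le> C" "\<And>n. integrable M (\<lambda>\<omega>. \<bar>g \<bullet> \<xi> n \<omega>\<bar> ^ 3)" "\<And>n. (\<integral>\<omega>. \<bar>g \<bullet> \<xi> n \<omega>\<bar> ^ 3 \<partial>M) \<le> C"
    using noise_cubic[of g] by blast
  define v where "v = noise_var g qsd"
  have v: "0 \<le> v" unfolding v_def by (rule noise_var_nonneg)
  define r where "r = (\<lambda>n. \<integral>\<omega>. \<bar>noise_var g (\<mu> n \<omega>) - noise_var g qsd\<bar> \<partial>M)"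
  have r0: "0 \<le> r n" for n unfolding r_def by (rule integral_nonneg_AE) simp
  have rlim: "r \<longlonglongrightarrow> 0" unfolding r_def by (rule continuous_mean_tendsto[OF continuous_noise_var])
  have main: "\<bar>(\<integral>\<omega>. cos (mart g n \<omega> / sqrt (real n) + \<beta>) \<partial>M) - (1 - v / 2 / real n) ^ n * cos \<beta>\<bar>
      \<le> C / sqrt (real n) + (\<Sum>k<n. r k) / real n" if n: "0 < n" "v / 2 \<le> real n" for n
  proof -
    define h where "h = 1 / sqrt (real n)"
    have h: "0 \<le> h" "h\<^sup>2 = 1 / real n" using n by (auto simp: h_def power_divide)
    define \<rho> where "\<rho> = 1 - h\<^sup>2 * v / 2"
    \<comment> \<open>A factor in \<open>[0, 1]\<close> does not amplify errors already made; this
      is where \<open>v / 2 \<le> real n\<close> enters.\<close>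
    have \<rho>: "0 \<le> \<rho>" "\<rho> \<le> 1" using v n by (auto simp: \<rho>_def h field_simps)
    define c where "c = (\<lambda>k. \<integral>\<omega>. cos (h * mart g k \<omega> + \<beta>) \<partial>M)"
    have step: "\<bar>c (Suc k) - \<rho> * c k\<bar> \<le> h ^ 3 * C + h\<^sup>2 / 2 * r k" for k
      unfolding c_def \<rho>_def v_def r_def by (rule mart_cos_step[OF C(2,3) h(1)])
    have "\<bar>c k - \<rho> ^ k * cos \<beta>\<bar> \<le> (\<Sum>j<k. h ^ 3 * C + h\<^sup>2 / 2 * r j)" for k
    proof (induction k)
      case 0
      then show ?case by (simp add: c_def mart_def prob_space)
    next
      case (Suc k)
      have "\<bar>c (Suc k) - \<rho> ^ Suc k * cos \<beta>\<bar> \<le> \<bar>c (Suc k) - \<rho> * c k\<bar> + \<bar>\<rho> * (c k - \<rho> ^ k * cos \<beta>)\<bar>"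
        using abs_triangle_ineq[of "c (Suc k) - \<rho> * c k" "\<rho> * (c k - \<rho> ^ k * cos \<beta>)"] by (simp add: algebra_simps)
      also have "\<bar>\<rho> * (c k - \<rho> ^ k * cos \<beta>)\<bar> \<le> 1 * \<bar>c k - \<rho> ^ k * cos \<beta>\<bar>"
        unfolding abs_mult using \<rho> by (intro mult_right_mono) auto
      finally show ?case using step[of k] Suc by simp
    qed
    from this[of n] have "\<bar>c n - \<rho> ^ n * cos \<beta>\<bar> \<le> real n * h ^ 3 * C + h\<^sup>2 / 2 * (\<Sum>k<n. r k)"
      by (simp add: sum.distrib sum_distrib_left)
    also have "real n * h ^ 3 * C = C / sqrt (real n)"
    proof -
      have "real n * h ^ 3 = real n * h\<^sup>2 * h" by (simp add: power3_eq_cube power2_eq_square)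
      also have "\<dots> = h" using n by (simp add: h)
      finally show ?thesis by (simp add: h_def)
    qed
    also have "h\<^sup>2 / 2 * (\<Sum>k<n. r k) \<le> (\<Sum>k<n. r k) / real n"
    proof -
      have "0 \<le> (\<Sum>k<n. r k) / real n" using r0 by (simp add: sum_nonneg)
      then show ?thesis by (simp add: h)
    qed
    finally have "\<bar>c n - \<rho> ^ n * cos \<beta>\<bar> \<le> C / sqrt (real n) + (\<Sum>k<n. r k) / real n" by simp
    moreover have "c n = (\<integral>\<omega>. cos (mart g n \<omega> / sqrt (real n) + \<beta>) \<partial>M)" by (simp add: c_def h_def)
    moreover have "\<rho> = 1 - v / 2 / real n" by (simp add: \<rho>_def h(2) mult.commute)
    ultimately show ?thesis by simp
  qed
  have "(\<lambda>n. (1 + (- v / 2) / real n) ^ n) \<longlonglongrightarrow> exp (- v / 2)" by (rule tendsto_exp_limit_sequentially)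
  moreover have "1 + (- v / 2) / real n = 1 - v / 2 / real n" for n by simp
  ultimately have "(\<lambda>n. (1 - v / 2 / real n) ^ n) \<longlonglongrightarrow> exp (- v / 2)" by (simp only:)
  from tendsto_mult_right[OF this, of "cos \<beta>"]
  have lim: "(\<lambda>n. (1 - v / 2 / real n) ^ n * cos \<beta>) \<longlonglongrightarrow> exp (- v / 2) * cos \<beta>"
    .
  have "(\<lambda>n. (\<integral>\<omega>. cos (mart g n \<omega> / sqrt (real n) + \<beta>) \<partial>M) - (1 - v / 2 / real n) ^ n * cos \<beta>) \<longlonglongrightarrow> 0"
  proof (rule Lim_null_comparison)
    have "(\<lambda>n. C / sqrt (real n)) \<longlonglongrightarrow> 0" by real_asymp
    from tendsto_add[OF this cesaro_tendsto_0[OF rlim]]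
    show "(\<lambda>n. C / sqrt (real n) + (\<Sum>k<n. r k) / real n) \<longlonglongrightarrow> 0" by simp
    have "\<forall>\<^sub>F n in sequentially. v / 2 \<le> real n"
      using filterlim_real_sequentially unfolding filterlim_at_top by blast
    then show "\<forall>\<^sub>F n in sequentially. norm ((\<integral>\<omega>. cos (mart g n \<omega> / sqrt (real n) + \<beta>) \<partial>M) - (1 - v / 2 / real n) ^ n * cos \<beta>)
        \<le> C / sqrt (real n) + (\<Sum>k<n. r k) / real n"
      using eventually_gt_at_top[of 0] by eventually_elim (use main in simp)
  qed
  from tendsto_add[OF this lim] show ?thesis by (simp add: v_def)
qed

end


section \<open>Reduction of the averaged error to the martingale\<close>

context projected_process
begin

text \<open>What the recursion divided by \<open>\<epsilon> k\<close> leaves beside its linear part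
  and the noise: the quadratic term of the drift and, after long runs, the effect of the
  projection.\<close>

definition residual :: "nat \<Rightarrow> 'w \<Rightarrow> real^'m" where
  "residual k \<omega> = jacobian (\<delta> k \<omega>) - (1 / \<epsilon> k) *\<^sub>R (\<delta> (Suc k) \<omega> - \<delta> k \<omega>) + \<xi> k \<omega>"

lemma residual_meas[measurable]: "residual k \<in> borel_measurable M"
proof -
  have "jacobian \<in> borel_measurable borel"
    by (intro borel_measurable_continuous_onI linear_continuous_on linear_conv_bounded_linear[THEN iffD1] linear_jacobian)
  from measurable_compose[OF _ this, of "\<lambda>\<omega>. \<delta> k \<omega>"]
  have [measurable]: "(\<lambda>\<omega>. jacobian (\<delta> k \<omega>)) \<in> borel_measurable M" by measurable
  show ?thesis unfolding residual_def[abs_def] by measurable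
qed

lemma residual_bound: "\<exists>C\<ge>0. \<forall>k. integrable M (\<lambda>\<omega>. norm (residual k \<omega>)) \<and> (\<integral>\<omega>. norm (residual k \<omega>) \<partial>M) \<le> C * \<epsilon> k"
proof -
  define c where "c = (\<Sum>i\<in>UNIV. \<Sum>j\<in>UNIV. R $ j $ i)"
  have c: "0 \<le> c" unfolding c_def using R_pos by (intro sum_nonneg) (auto simp: less_imp_le)
  have s_le: "\<bar>\<Sum>i\<in>UNIV. (d v* R) $ i\<bar> \<le> c * norm d" for d
  proof -
    have "\<bar>\<Sum>i\<in>UNIV. (d v* R) $ i\<bar> \<le> (\<Sum>i\<in>UNIV. \<bar>(d v* R) $ i\<bar>)" by (rule sum_abs)
    also have "\<dots> \<le> (\<Sum>i\<in>UNIV. \<Sum>j\<in>UNIV. \<bar>d $ j * R $ j $ i\<bar>)" unfolding vector_matrix_nth by (intro sum_mono sum_abs)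
    also have "\<dots> \<le> (\<Sum>i\<in>UNIV. \<Sum>j\<in>UNIV. norm d * R $ j $ i)"
      using R_pos by (intro sum_mono) (auto simp: abs_mult less_imp_le intro!: mult_mono component_le_norm_cart)
    finally show ?thesis by (simp add: c_def sum_distrib_left mult.commute)
  qed
  have pt: "AE \<omega> in M. norm (residual k \<omega>) \<le> c * (norm (\<delta> k \<omega>))\<^sup>2 + 4 * \<epsilon> k * (\<tau> k \<omega>)\<^sup>2" for k
    using \<mu>_step[of k]
  proof eventually_elim
    case (elim \<omega>)
    define s where "s = (\<Sum>i\<in>UNIV. (\<delta> k \<omega> v* R) $ i)"
    define D where "D = N k \<omega> - \<tau> k \<omega> *\<^sub>R \<mu> k \<omega>"
    have e: "0 < \<epsilon> k" by (rule \<epsilon>_pos)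
    have x: "\<mu> k \<omega> \<in> prob_simplex" "\<mu> (Suc k) \<omega> \<in> prob_simplex" using elim by auto
    have eq: "residual k \<omega> = s *\<^sub>R \<delta> k \<omega> + (D - (1 / \<epsilon> k) *\<^sub>R (\<mu> (Suc k) \<omega> - \<mu> k \<omega>))"
      unfolding residual_def run.noise_def using drift_expansion[OF x(1)] by (simp add: s_def D_def algebra_simps)
    have "norm (s *\<^sub>R \<delta> k \<omega>) = \<bar>s\<bar> * norm (\<delta> k \<omega>)" by simp
    also have "\<dots> \<le> (c * norm (\<delta> k \<omega>)) * norm (\<delta> k \<omega>)" unfolding s_def by (intro mult_right_mono s_le) simp
    finally have 1: "norm (s *\<^sub>R \<delta> k \<omega>) \<le> c * (norm (\<delta> k \<omega>))\<^sup>2" by (simp add: power2_eq_square mult.assoc)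
    have 2: "norm (D - (1 / \<epsilon> k) *\<^sub>R (\<mu> (Suc k) \<omega> - \<mu> k \<omega>)) \<le> 4 * \<epsilon> k * (\<tau> k \<omega>)\<^sup>2"
    proof (cases "\<epsilon> k * \<tau> k \<omega> \<le> 1")
      case True
      then have "\<mu> (Suc k) \<omega> - \<mu> k \<omega> = \<epsilon> k *\<^sub>R D" using elim by (simp add: D_def)
      then have "D - (1 / \<epsilon> k) *\<^sub>R (\<mu> (Suc k) \<omega> - \<mu> k \<omega>) = 0" using e by simp
      then show ?thesis using e by simp
    next
      case False
      then have one: "1 \<le> \<epsilon> k * \<tau> k \<omega>" by simp
      \<comment> \<open>On a long run \<open>1 \<le> \<epsilon> k * \<tau> k \<omega>\<close>, so
        both the run length and \<open>1 / \<epsilon> k\<close> are at most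
        \<open>\<epsilon> k\<close> times the squared run length.\<close>
      have t: "\<tau> k \<omega> \<le> \<epsilon> k * (\<tau> k \<omega>)\<^sup>2"
        using mult_right_mono[OF one, of "\<tau> k \<omega>"] by (simp add: power2_eq_square mult.assoc)
      have "1 / \<epsilon> k \<le> \<tau> k \<omega>" using one e by (simp add: field_simps)
      then have i: "1 / \<epsilon> k \<le> \<epsilon> k * (\<tau> k \<omega>)\<^sup>2" using t by linarith
      have "norm (D - (1 / \<epsilon> k) *\<^sub>R (\<mu> (Suc k) \<omega> - \<mu> k \<omega>)) \<le> norm D + norm ((1 / \<epsilon> k) *\<^sub>R (\<mu> (Suc k) \<omega> - \<mu> k \<omega>))"
        by (rule norm_triangle_ineq4)
      also have "\<dots> \<le> 2 * \<tau> k \<omega> + (1 / \<epsilon> k) * 2"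
      proof (rule add_mono)
        show "norm D \<le> 2 * \<tau> k \<omega>"
          using visits_norm_le[OF x(1), of "N k \<omega>"] run.visits_nn by (simp add: run.visits_sum D_def)
        have "norm (\<mu> (Suc k) \<omega> - \<mu> k \<omega>) \<le> 2"
          using norm_triangle_ineq4[of "\<mu> (Suc k) \<omega>" "\<mu> k \<omega>"] simplex_norm_le1[OF x(1)] simplex_norm_le1[OF x(2)] by simp
        then show "norm ((1 / \<epsilon> k) *\<^sub>R (\<mu> (Suc k) \<omega> - \<mu> k \<omega>)) \<le> (1 / \<epsilon> k) * 2"
          using e by (simp add: divide_right_mono)
      qed
      finally show ?thesis using t i by linarith
    qed
    show ?case unfolding eq using norm_triangle_ineq[of "s *\<^sub>R \<delta> k \<omega>"] 1 2 by (meson add_mono order_trans)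
  qed
  obtain K where K: "0 < K" "\<And>n. (\<integral>\<omega>. (norm (\<delta> n \<omega>))\<^sup>2 \<partial>M) \<le> K * \<epsilon> n" using \<delta>_sq_decay by blast
  define C where "C = c * K + 4 * \<bar>run.moment_const\<bar>"
  have int: "integrable M (\<lambda>\<omega>. c * (norm (\<delta> k \<omega>))\<^sup>2 + 4 * \<epsilon> k * (\<tau> k \<omega>)\<^sup>2)" for k
    using \<delta>_sq_integrable[of k] run.life_integrable(2)[of k] by simp
  have I: "integrable M (\<lambda>\<omega>. norm (residual k \<omega>))" for k
    by (rule Bochner_Integration.integrable_bound[OF int[of k]]) (use pt[of k] in auto)
  have "(\<integral>\<omega>. norm (residual k \<omega>) \<partial>M) \<le> C * \<epsilon> k" for k
  proof -
    have "(\<integral>\<omega>. norm (residual k \<omega>) \<partial>M) \<le> (\<integral>\<omega>. c * (norm (\<delta> k \<omega>))\<^sup>2 + 4 * \<epsilon> k * (\<tau> k \<omega>)\<^sup>2 \<partial>M)"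
      by (rule integral_mono_AE[OF I int pt])
    also have "\<dots> = c * (\<integral>\<omega>. (norm (\<delta> k \<omega>))\<^sup>2 \<partial>M) + 4 * \<epsilon> k * (\<integral>\<omega>. (\<tau> k \<omega>)\<^sup>2 \<partial>M)"
      using \<delta>_sq_integrable[of k] run.life_integrable(2)[of k] by simp
    also have "\<dots> \<le> c * (K * \<epsilon> k) + 4 * \<epsilon> k * \<bar>run.moment_const\<bar>"
      using run.life_sq_mean[of k] c \<epsilon>_pos[of k] K(2)[of k]
      by (intro add_mono mult_left_mono) (auto intro: order_trans[OF _ abs_ge_self])
    finally show ?thesis by (simp add: C_def algebra_simps)
  qed
  moreover have "0 \<le> C" unfolding C_def using c K(1) by simp
  ultimately show ?thesis using I by blast
qed

definition rescaled_increments :: "nat \<Rightarrow> 'w \<Rightarrow> real^'m" where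
  "rescaled_increments n \<omega> = (\<Sum>k<n. (1 / \<epsilon> k) *\<^sub>R (\<delta> (Suc k) \<omega> - \<delta> k \<omega>))"

text \<open>Only monotonicity of the step sizes enters: with \<open>r k = sqrt (1 / \<epsilon> k)\<close> and
  \<open>E |\<delta> k| \<le> K / r k\<close>, the sum from the summation by parts telescopes because
  \<open>(r (k+1)\<^sup>2 - r k\<^sup>2) / r (k+1) \<le> 2 (r (k+1) - r k)\<close>.\<close>

lemma rescaled_increments_bound:
  "\<exists>C\<ge>0. \<forall>n. integrable M (\<lambda>\<omega>. norm (rescaled_increments n \<omega>)) \<and>
     (\<integral>\<omega>. norm (rescaled_increments n \<omega>) \<partial>M) \<le> C * sqrt (1 / \<epsilon> n)"
proof -
  obtain K where K: "0 < K" "\<And>n. (\<integral>\<omega>. norm (\<delta> n \<omega>) \<partial>M) \<le> K * sqrt (\<epsilon> n)" using \<delta>_decay by blast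
  define s where "s = (\<lambda>k. sqrt (1 / \<epsilon> k))"
  have s: "0 < s k" "1 / \<epsilon> k = s k * s k" "sqrt (\<epsilon> k) = 1 / s k" for k
    using \<epsilon>_pos[of k] by (auto simp: s_def real_sqrt_divide)
  have s_mono: "s k \<le> s (Suc k)" for k
    using \<epsilon>_decseq \<epsilon>_pos[of "Suc k"] \<epsilon>_pos[of k] unfolding s_def
    by (intro real_sqrt_le_mono divide_left_mono) (auto simp: decseq_Suc_iff)
  define B where "B = (\<lambda>n \<omega>. s n * s n * norm (\<delta> n \<omega>) + s 0 * s 0 * norm (\<delta> 0 \<omega>)
      + (\<Sum>k<n. (s (Suc k) * s (Suc k) - s k * s k) * norm (\<delta> (Suc k) \<omega>)))"
  have pos: "0 \<le> s (Suc k) * s (Suc k) - s k * s k" for k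
    using s_mono[of k] s(1)[of k] by (simp add: mult_mono)
  have pt: "norm (rescaled_increments n \<omega>) \<le> B n \<omega>" for n \<omega>
  proof -
    have "rescaled_increments n \<omega> = (s n * s n) *\<^sub>R \<delta> n \<omega> - (s 0 * s 0) *\<^sub>R \<delta> 0 \<omega>
        - (\<Sum>k<n. (s (Suc k) * s (Suc k) - s k * s k) *\<^sub>R \<delta> (Suc k) \<omega>)"
      unfolding rescaled_increments_def s(2) by (rule summation_by_parts)
    also have "norm \<dots> \<le> norm ((s n * s n) *\<^sub>R \<delta> n \<omega>) + norm ((s 0 * s 0) *\<^sub>R \<delta> 0 \<omega>)
        + norm (\<Sum>k<n. (s (Suc k) * s (Suc k) - s k * s k) *\<^sub>R \<delta> (Suc k) \<omega>)"
      by (intro order_trans[OF norm_triangle_ineq4] add_mono norm_triangle_ineq4 order_refl)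
    also have "norm (\<Sum>k<n. (s (Suc k) * s (Suc k) - s k * s k) *\<^sub>R \<delta> (Suc k) \<omega>)
       \<le> (\<Sum>k<n. (s (Suc k) * s (Suc k) - s k * s k) * norm (\<delta> (Suc k) \<omega>))"
      using pos by (intro order_trans[OF norm_sum] sum_mono) simp
    finally show ?thesis by (simp add: B_def)
  qed
  have Bi: "integrable M (B n)" for n unfolding B_def
    by (intro Bochner_Integration.integrable_add integrable_mult_right \<delta>_integrable Bochner_Integration.integrable_sum)
  have rm: "rescaled_increments n \<in> borel_measurable M" for n
    unfolding rescaled_increments_def[abs_def] by measurable
  have I: "integrable M (\<lambda>\<omega>. norm (rescaled_increments n \<omega>))" for n
  proof (rule Bochner_Integration.integrable_bound[OF Bi[of n]])
    show "AE \<omega> in M. norm (norm (rescaled_increments n \<omega>)) \<le> norm (B n \<omega>)"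
      using order_trans[OF pt abs_ge_self] by simp
  qed (use rm in measurable)
  have "(\<integral>\<omega>. norm (rescaled_increments n \<omega>) \<partial>M) \<le> 3 * K * s n" for n
  proof -
    have "(\<integral>\<omega>. norm (rescaled_increments n \<omega>) \<partial>M) \<le> (\<integral>\<omega>. B n \<omega> \<partial>M)"
      by (rule integral_mono[OF I Bi pt])
    also have "\<dots> = s n * s n * (\<integral>\<omega>. norm (\<delta> n \<omega>) \<partial>M) + s 0 * s 0 * (\<integral>\<omega>. norm (\<delta> 0 \<omega>) \<partial>M)
      + (\<Sum>k<n. (s (Suc k) * s (Suc k) - s k * s k) * (\<integral>\<omega>. norm (\<delta> (Suc k) \<omega>) \<partial>M))"
      unfolding B_def using \<delta>_integrable
      by (simp add: Bochner_Integration.integral_add Bochner_Integration.integral_sum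
          Bochner_Integration.integrable_sum Bochner_Integration.integrable_add)
    also have "\<dots> \<le> s n * s n * (K * (1 / s n)) + s 0 * s 0 * (K * (1 / s 0))
      + (\<Sum>k<n. (s (Suc k) * s (Suc k) - s k * s k) * (K * (1 / s (Suc k))))"
      using K(2) pos unfolding s(3) by (intro add_mono mult_left_mono sum_mono) auto
    also have "\<dots> \<le> K * s n + K * s 0 + (\<Sum>k<n. 2 * K * (s (Suc k) - s k))"
    proof (intro add_mono sum_mono)
      show "s n * s n * (K * (1 / s n)) \<le> K * s n" "s 0 * s 0 * (K * (1 / s 0)) \<le> K * s 0"
        using s(1)[of n] s(1)[of 0] by simp_all
      fix k
      have "(s (Suc k) * s (Suc k) - s k * s k) = (s (Suc k) - s k) * (s (Suc k) + s k)" by (simp add: algebra_simps)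
      also have "\<dots> \<le> (s (Suc k) - s k) * (2 * s (Suc k))"
        using s_mono[of k] by (intro mult_left_mono) auto
      finally have "(s (Suc k) * s (Suc k) - s k * s k) * (K * (1 / s (Suc k))) \<le> (s (Suc k) - s k) * (2 * s (Suc k)) * (K * (1 / s (Suc k)))"
        using K(1) s(1)[of "Suc k"] by (intro mult_right_mono) (auto simp: less_imp_le)
      also have "\<dots> = 2 * K * (s (Suc k) - s k)" using s(1)[of "Suc k"] by simp
      finally show "(s (Suc k) * s (Suc k) - s k * s k) * (K * (1 / s (Suc k))) \<le> 2 * K * (s (Suc k) - s k)" .
    qed
    also have "(\<Sum>k<n. 2 * K * (s (Suc k) - s k)) = 2 * K * (s n - s 0)"
      by (simp only: sum_distrib_left[symmetric] sum_lessThan_telescope)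
    also have "K * s n + K * s 0 + 2 * K * (s n - s 0) \<le> 3 * K * s n"
      using K(1) s(1)[of 0] by (simp add: algebra_simps)
    finally show ?thesis .
  qed
  then show ?thesis using I K(1) by (intro exI[of _ "3 * K"]) (auto simp: s_def)
qed

definition scaled_error :: "nat \<Rightarrow> 'w \<Rightarrow> real^'m" where
  "scaled_error n \<omega> = sqrt (real n) *\<^sub>R (averaged_iterates \<mu> n \<omega> - qsd)"

lemma scaled_error_eq: "0 < n \<Longrightarrow> scaled_error n \<omega> = (1 / sqrt (real n)) *\<^sub>R (\<Sum>k<n. \<delta> (Suc k) \<omega>)"
  unfolding scaled_error_def averaged_eq by (simp add: real_div_sqrt divide_simps)

lemma scaled_error_meas[measurable]: "scaled_error n \<in> borel_measurable M"
  unfolding scaled_error_def[abs_def] averaged_iterates_def[abs_def] by measurable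

lemma scaled_error_integrable: "integrable M (\<lambda>\<omega>. norm (scaled_error n \<omega>))"
proof (cases "n = 0")
  case True then show ?thesis by (simp add: scaled_error_def)
next
  case False
  show ?thesis
  proof (rule Bochner_Integration.integrable_bound)
    show "integrable M (\<lambda>\<omega>. (1 / sqrt (real n)) * (\<Sum>k<n. norm (\<delta> (Suc k) \<omega>)))"
      by (intro integrable_mult_right Bochner_Integration.integrable_sum \<delta>_integrable)
    have le: "norm (scaled_error n \<omega>) \<le> (1 / sqrt (real n)) * (\<Sum>k<n. norm (\<delta> (Suc k) \<omega>))" for \<omega>
      using False by (simp add: scaled_error_eq divide_right_mono norm_sum)
    show "AE \<omega> in M. norm (norm (scaled_error n \<omega>)) \<le> norm ((1 / sqrt (real n)) * (\<Sum>k<n. norm (\<delta> (Suc k) \<omega>)))"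
      unfolding real_norm_def abs_norm_cancel by (intro AE_I2 order_trans[OF le abs_ge_self])
  qed measurable
qed

text \<open>The left inverse \<open>G\<close> solves the summed recursion for the sum of the errors,
  with minus \<open>G\<close> of the noise as main term. Testing with \<open>t\<close> moves
  \<open>G\<close> to its adjoint, whence the direction \<open>- adjoint G t\<close>;
  \<open>W\<close> collects everything else.\<close>

lemma martingale_approximation:
  assumes G: "linear G" "\<And>d. G (jacobian d) = d"
  shows "(\<lambda>n. \<integral>\<omega>. \<bar>t \<bullet> scaled_error n \<omega> - mart (- adjoint G t) n \<omega> / sqrt (real n)\<bar> \<partial>M) \<longlonglongrightarrow> 0"
    (is "(\<lambda>n. ?I n) \<longlonglongrightarrow> 0")
proof -
  obtain K where K: "0 < K" "\<And>n. (\<integral>\<omega>. norm (\<delta> n \<omega>) \<partial>M) \<le> K * sqrt (\<epsilon> n)" using \<delta>_decay by blast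
  obtain C1 where C1: "0 \<le> C1" "\<And>k. integrable M (\<lambda>\<omega>. norm (residual k \<omega>))" "\<And>k. (\<integral>\<omega>. norm (residual k \<omega>) \<partial>M) \<le> C1 * \<epsilon> k"
    using residual_bound by blast
  obtain C2 where C2: "0 \<le> C2" "\<And>n. integrable M (\<lambda>\<omega>. norm (rescaled_increments n \<omega>))"
      "\<And>n. (\<integral>\<omega>. norm (rescaled_increments n \<omega>) \<partial>M) \<le> C2 * sqrt (1 / \<epsilon> n)"
    using rescaled_increments_bound by blast
  have "bounded_linear G" using G(1) by (simp add: linear_conv_bounded_linear)
  then obtain L where L: "0 \<le> L" "\<And>z. norm (G z) \<le> norm z * L"
    using bounded_linear.nonneg_bounded by blast
  define W where "W = (\<lambda>n \<omega>. norm t * (L * (norm (rescaled_increments n \<omega>) + (\<Sum>k<n. norm (residual k \<omega>)))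
      + norm (\<delta> n \<omega>) + norm (\<delta> 0 \<omega>)))"
  have Wi: "integrable M (W n)" for n unfolding W_def
    by (intro integrable_mult_right Bochner_Integration.integrable_add Bochner_Integration.integrable_sum C1 C2 \<delta>_integrable)
  have W0: "0 \<le> W n \<omega>" for n \<omega>
    unfolding W_def using L(1) by (intro mult_nonneg_nonneg add_nonneg_nonneg sum_nonneg norm_ge_zero)
  have sumJ: "(\<Sum>k<n. \<delta> k \<omega>) = G (rescaled_increments n \<omega>) - (\<Sum>k<n. G (\<xi> k \<omega>)) + G (\<Sum>k<n. residual k \<omega>)" for n \<omega>
  proof -
    have "jacobian (\<delta> k \<omega>) = (1 / \<epsilon> k) *\<^sub>R (\<delta> (Suc k) \<omega> - \<delta> k \<omega>) - \<xi> k \<omega> + residual k \<omega>" for k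
      by (simp add: residual_def)
    then have "(\<Sum>k<n. jacobian (\<delta> k \<omega>)) = rescaled_increments n \<omega> - (\<Sum>k<n. \<xi> k \<omega>) + (\<Sum>k<n. residual k \<omega>)"
      by (simp only: sum.distrib sum_subtractf rescaled_increments_def)
    then have "G (\<Sum>k<n. jacobian (\<delta> k \<omega>)) = G (rescaled_increments n \<omega>) - (\<Sum>k<n. G (\<xi> k \<omega>)) + G (\<Sum>k<n. residual k \<omega>)"
      by (simp only: linear_add[OF G(1)] linear_diff[OF G(1)] linear_sum[OF G(1)])
    then show ?thesis by (simp only: linear_sum[OF G(1)] G(2))
  qed
  have martG: "mart (- adjoint G t) n \<omega> = - (t \<bullet> (\<Sum>k<n. G (\<xi> k \<omega>)))" for n \<omega>
  proof -
    have "adjoint G t \<bullet> z = t \<bullet> G z" for z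
      using adjoint_works[OF G(1), of z t] by (simp add: inner_commute)
    then show ?thesis by (simp add: mart_def inner_sum_right sum_negf)
  qed
  have pt: "\<bar>t \<bullet> scaled_error n \<omega> - mart (- adjoint G t) n \<omega> / sqrt (real n)\<bar> \<le> W n \<omega> / sqrt (real n)" if n: "0 < n" for n \<omega>
  proof -
    \<comment> \<open>The average runs over the indices 1 to \<open>n\<close>, the summed recursion
      over 0 to \<open>n - 1\<close>; the two end terms stay bounded.\<close>
    have shift: "(\<Sum>k<n. \<delta> (Suc k) \<omega>) = (\<Sum>k<n. \<delta> k \<omega>) + (\<delta> n \<omega> - \<delta> 0 \<omega>)"
      using sum_lessThan_telescope[of "\<lambda>k. \<delta> k \<omega>" n] by (simp add: sum_subtractf algebra_simps)
    define U where "U = G (rescaled_increments n \<omega>) + G (\<Sum>k<n. residual k \<omega>) + \<delta> n \<omega> - \<delta> 0 \<omega>"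
    have "t \<bullet> scaled_error n \<omega> = (1 / sqrt (real n)) * (t \<bullet> U - t \<bullet> (\<Sum>k<n. G (\<xi> k \<omega>)))"
      unfolding scaled_error_eq[OF n] shift sumJ U_def
      by (simp add: inner_add_right inner_diff_right algebra_simps)
    then have eq: "t \<bullet> scaled_error n \<omega> - mart (- adjoint G t) n \<omega> / sqrt (real n) = t \<bullet> U / sqrt (real n)"
      by (simp add: martG diff_divide_distrib)
    have "norm U \<le> L * (norm (rescaled_increments n \<omega>) + (\<Sum>k<n. norm (residual k \<omega>))) + norm (\<delta> n \<omega>) + norm (\<delta> 0 \<omega>)"
    proof -
      have "norm (G (\<Sum>k<n. residual k \<omega>)) \<le> (\<Sum>k<n. norm (residual k \<omega>)) * L"
        using L(2)[of "\<Sum>k<n. residual k \<omega>"] L(1) norm_sum[of "\<lambda>k. residual k \<omega>" "{..<n}"]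
        by (meson mult_right_mono order_trans)
      then have "norm (G (rescaled_increments n \<omega>)) + norm (G (\<Sum>k<n. residual k \<omega>)) \<le> L * (norm (rescaled_increments n \<omega>) + (\<Sum>k<n. norm (residual k \<omega>)))"
        using L(2)[of "rescaled_increments n \<omega>"] by (simp add: algebra_simps)
      moreover have "norm U \<le> norm (G (rescaled_increments n \<omega>)) + norm (G (\<Sum>k<n. residual k \<omega>)) + norm (\<delta> n \<omega>) + norm (\<delta> 0 \<omega>)"
        unfolding U_def
        by (intro order_trans[OF norm_triangle_ineq4] order_trans[OF norm_triangle_ineq] add_mono order_refl)
      ultimately show ?thesis by linarith
    qed
    then have "\<bar>t \<bullet> U\<bar> \<le> W n \<omega>"
      unfolding W_def using Cauchy_Schwarz_ineq2[of t U] by (meson mult_left_mono norm_ge_zero order_trans)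
    then show ?thesis unfolding eq by (simp add: divide_right_mono)
  qed
  define w where "w = (\<lambda>n. norm t * (L * (C2 * (sqrt (1 / \<epsilon> n) / sqrt (real n)) + C1 * ((\<Sum>k<n. \<epsilon> k) / sqrt (real n)))
      + K * (2 * sqrt (\<epsilon> 0) / sqrt (real n))))"
  have le: "?I n \<le> w n" if n: "0 < n" for n
  proof -
    have m[measurable]: "(\<lambda>\<omega>. \<bar>t \<bullet> scaled_error n \<omega> - mart (- adjoint G t) n \<omega> / sqrt (real n)\<bar>) \<in> borel_measurable M"
      by measurable
    have "integrable M (\<lambda>\<omega>. W n \<omega> / sqrt (real n))" using Wi[of n] by simp
    then have "?I n \<le> (\<integral>\<omega>. W n \<omega> / sqrt (real n) \<partial>M)"
      by (rule integral_mono'[OF _ pt[OF n]]) (use W0 in simp)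
    also have "\<dots> = (\<integral>\<omega>. W n \<omega> \<partial>M) / sqrt (real n)" by simp
    also have "(\<integral>\<omega>. W n \<omega> \<partial>M) = norm t * (L * ((\<integral>\<omega>. norm (rescaled_increments n \<omega>) \<partial>M) + (\<Sum>k<n. \<integral>\<omega>. norm (residual k \<omega>) \<partial>M))
      + (\<integral>\<omega>. norm (\<delta> n \<omega>) \<partial>M) + (\<integral>\<omega>. norm (\<delta> 0 \<omega>) \<partial>M))"
      unfolding W_def using C1(2) C2(2) \<delta>_integrable
      by (simp add: Bochner_Integration.integral_add Bochner_Integration.integral_sum
          Bochner_Integration.integrable_sum Bochner_Integration.integrable_add)
    also have "\<dots> \<le> norm t * (L * (C2 * sqrt (1 / \<epsilon> n) + (\<Sum>k<n. C1 * \<epsilon> k)) + K * sqrt (\<epsilon> 0) + K * sqrt (\<epsilon> 0))"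
    proof (intro mult_left_mono add_mono sum_mono C1 C2 K L norm_ge_zero)
      have "\<epsilon> n \<le> \<epsilon> 0" using \<epsilon>_decseq by (simp add: decseqD)
      then have "K * sqrt (\<epsilon> n) \<le> K * sqrt (\<epsilon> 0)" using K(1) by simp
      then show "(\<integral>\<omega>. norm (\<delta> n \<omega>) \<partial>M) \<le> K * sqrt (\<epsilon> 0)" using K(2)[of n] by linarith
    qed
    also have "norm t * (L * (C2 * sqrt (1 / \<epsilon> n) + (\<Sum>k<n. C1 * \<epsilon> k)) + K * sqrt (\<epsilon> 0) + K * sqrt (\<epsilon> 0)) / sqrt (real n) = w n"
      unfolding w_def sum_distrib_left[symmetric] by (simp add: add_divide_distrib distrib_left)
    finally show ?thesis using n by (simp add: divide_right_mono)
  qed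
  \<comment> \<open>The quotient is at most of order
    \<open>n powr ((\<alpha> - 1) / 2)\<close>.\<close>
  have l1: "(\<lambda>n. sqrt (1 / \<epsilon> n) / sqrt (real n)) \<longlonglongrightarrow> 0"
  proof (rule Lim_null_comparison)
    show "(\<lambda>n. sqrt ((real n + 1) powr \<alpha> / a) / sqrt (real n)) \<longlonglongrightarrow> 0"
      using \<alpha> a by real_asymp
    have "1 / \<epsilon> n \<le> (real n + 1) powr \<alpha> / a" for n
    proof -
      have "1 / \<epsilon> n \<le> 1 / (a * (real n + 1) powr - \<alpha>)"
        using \<epsilon>_lower[of n] \<epsilon>_pos[of n] a by (intro divide_left_mono) auto
      then show ?thesis by (simp add: powr_minus field_simps)
    qed
    then show "\<forall>\<^sub>F n in sequentially. norm (sqrt (1 / \<epsilon> n) / sqrt (real n)) \<le> sqrt ((real n + 1) powr \<alpha> / a) / sqrt (real n)"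
      using \<epsilon>_pos by (intro always_eventually allI) (simp add: divide_right_mono less_imp_le)
  qed
  \<comment> \<open>Kronecker's lemma with weights of order \<open>sqrt n\<close>: the series has
    terms of order \<open>n powr (- \<alpha> - 1 / 2)\<close>, with exponent below -1.\<close>
  have l2: "(\<lambda>n. (\<Sum>k<n. \<epsilon> k) / sqrt (real n)) \<longlonglongrightarrow> 0"
  proof (rule Lim_null_comparison)
    have "summable (\<lambda>n. real n powr (- \<alpha> - 1 / 2))" using \<alpha> by (subst summable_real_powr_iff) auto
    then have "summable (\<lambda>n. real (Suc n) powr (- \<alpha> - 1 / 2))" by (subst summable_Suc_iff)
    then have "summable (\<lambda>n. b * real (Suc n) powr (- \<alpha> - 1 / 2))" by (rule summable_mult)
    then have "summable (\<lambda>n. \<epsilon> n / sqrt (real (Suc n)))"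
    proof (rule summable_comparison_test'[of _ 0])
      fix n
      have "\<epsilon> n / sqrt (real (Suc n)) \<le> b * real (Suc n) powr - \<alpha> / sqrt (real (Suc n))"
        using \<epsilon>_upper[of n] by (intro divide_right_mono) (auto simp: add.commute)
      also have "\<dots> = b * real (Suc n) powr (- \<alpha> - 1 / 2)"
        by (simp add: powr_diff powr_half_sqrt del: of_nat_Suc)
      finally show "norm (\<epsilon> n / sqrt (real (Suc n))) \<le> b * real (Suc n) powr (- \<alpha> - 1 / 2)"
        using \<epsilon>_pos[of n] by simp
    qed
    moreover have "filterlim (\<lambda>n. sqrt (real (Suc n))) at_top sequentially" by real_asymp
    ultimately have "(\<lambda>n. (\<Sum>k<n. \<epsilon> k) / sqrt (real (Suc n))) \<longlonglongrightarrow> 0"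
      using \<epsilon>_pos by (intro kronecker_nonneg) (auto simp: mono_def less_imp_le simp del: of_nat_Suc)
    from tendsto_mult_left[OF this, of 2] show "(\<lambda>n. 2 * ((\<Sum>k<n. \<epsilon> k) / sqrt (real (Suc n)))) \<longlonglongrightarrow> 0" by simp
    show "\<forall>\<^sub>F n in sequentially. norm ((\<Sum>k<n. \<epsilon> k) / sqrt (real n)) \<le> 2 * ((\<Sum>k<n. \<epsilon> k) / sqrt (real (Suc n)))"
      using eventually_gt_at_top[of 0]
    proof eventually_elim
      case (elim n)
      have S: "0 \<le> (\<Sum>k<n. \<epsilon> k)" using \<epsilon>_pos by (simp add: sum_nonneg less_imp_le)
      have "sqrt (real (Suc n)) \<le> sqrt (2\<^sup>2 * real n)" using elim by (intro real_sqrt_le_mono) auto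
      also have "\<dots> = 2 * sqrt (real n)" by (simp add: real_sqrt_mult)
      finally have "1 / sqrt (real n) \<le> 2 / sqrt (real (Suc n))" using elim by (simp add: field_simps)
      from mult_left_mono[OF this S] show ?case using S by (simp add: mult.commute)
    qed
  qed
  have l3: "(\<lambda>n. 2 * sqrt (\<epsilon> 0) / sqrt (real n)) \<longlonglongrightarrow> 0" by real_asymp
  have "w \<longlonglongrightarrow> norm t * (L * (C2 * 0 + C1 * 0) + K * 0)"
    unfolding w_def by (intro tendsto_intros l1 l2 l3)
  then have wlim: "w \<longlonglongrightarrow> 0" by simp
  show ?thesis
  proof (rule Lim_null_comparison[OF _ wlim])
    show "\<forall>\<^sub>F n in sequentially. norm (?I n) \<le> w n"
      using eventually_gt_at_top[of 0]
    proof eventually_elim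
      case (elim n)
      have "0 \<le> ?I n" by (rule integral_nonneg_AE) simp
      then show ?case using le[OF elim] by simp
    qed
  qed
qed

section \<open>The limiting covariance and the limit law\<close>

lemma drift_qsd: "drift qsd = 0"
  by (simp add: drift_def qsd_R qsd_sum flip: sum_distrib_left)

text \<open>At \<open>qsd\<close> the drift term of \<open>noise_var\<close> drops out, leaving a
  quadratic form in the centred coefficients \<open>\<beta>\<close>, which are linear in
  \<open>t\<close>. Nonnegativity comes from \<open>noise_var_nonneg\<close>.\<close>

lemma limit_covariance:
  fixes G :: "real^'m \<Rightarrow> real^'m"
  assumes G: "linear G"
  shows "\<exists>V. covariance_matrix V \<and> (\<forall>t. t \<bullet> (V *v t) = noise_var (- adjoint G t) qsd)"
proof -
  have adj: "linear (adjoint G)" by (rule adjoint_linear[OF G])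
  define \<beta> where "\<beta> = (\<lambda>s i. (- adjoint G s) $ i - (- adjoint G s) \<bullet> qsd)"
  define \<kappa> where "\<kappa> = (\<lambda>i j. \<Sum>m\<in>UNIV. qsd $ m * visits_cov m i j)"
  define B where "B = (\<lambda>s t. \<Sum>i\<in>UNIV. \<Sum>j\<in>UNIV. \<beta> s i * \<beta> t j * \<kappa> i j)"
  have b1: "\<beta> (s + t) i = \<beta> s i + \<beta> t i" and b2: "\<beta> (c *\<^sub>R s) i = c * \<beta> s i" for s t i c
    by (simp_all add: \<beta>_def linear_add[OF adj] linear_cmul[OF adj] inner_diff_left inner_add_left algebra_simps)
  have "bilinear B"
    unfolding bilinear_def B_def
    by (intro conjI allI linearI) (simp_all add: b1 b2 sum.distrib sum_distrib_left algebra_simps)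
  from quadratic_form_matrix[OF this] obtain V :: "real^'m^'m"
    where V: "transpose V = V" "\<And>t. t \<bullet> (V *v t) = B t t" by blast
  have "B t t = noise_var (- adjoint G t) qsd" for t
    by (simp add: B_def noise_var_def \<beta>_def \<kappa>_def drift_qsd)
  then show ?thesis using V noise_var_nonneg by (intro exI[of _ V]) (simp add: covariance_matrix_def)
qed

text \<open>The matrix \<open>V\<close> and its Gaussian law are fixed before any limit is taken.
  Each direction \<open>t\<close> is then treated through its own scalar martingale, while the
  coordinate directions together bound the mean of the norm.\<close>

lemma scaled_error_converges:
  "\<exists>V N. multivariate_normal N 0 V \<and> converges_in_distribution M scaled_error N"
proof -
  obtain G where G: "linear G" "G \<circ> jacobian = id"
    using linear_injective_left_inverse[OF linear_jacobian jacobian_inj] by blast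
  have GJ: "G (jacobian d) = d" for d using G(2) by (metis comp_apply id_apply)
  obtain V where V: "covariance_matrix V" "\<And>t. t \<bullet> (V *v t) = noise_var (- adjoint G t) qsd"
    using limit_covariance[OF G(1)] by blast
  obtain L where L: "multivariate_normal L 0 V" using multivariate_normal_exists[OF V(1)] by blast
  define A where "A = (\<lambda>t n \<omega>. mart (- adjoint G t) n \<omega> / sqrt (real n))"
  define I where "I = (\<lambda>t n. \<integral>\<omega>. \<bar>t \<bullet> scaled_error n \<omega> - A t n \<omega>\<bar> \<partial>M)"
  have Ilim: "I t \<longlonglongrightarrow> 0" for t unfolding I_def A_def by (rule martingale_approximation[OF G(1) GJ])
  have Am[measurable]: "A t n \<in> borel_measurable M" for t n unfolding A_def[abs_def] by measurable
  have ti: "integrable M (\<lambda>\<omega>. t \<bullet> scaled_error n \<omega>)" for t n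
    by (rule Bochner_Integration.integrable_bound[OF integrable_mult_right[OF scaled_error_integrable, of "norm t"]])
      (auto intro: Cauchy_Schwarz_ineq2)
  have Ai: "integrable M (A t n)" for t n
  proof (cases "n = 0")
    case True then show ?thesis by (simp add: A_def mart_def)
  next
    case False
    obtain C where "\<And>n. 0 < n \<Longrightarrow> integrable M (\<lambda>\<omega>. \<bar>mart (- adjoint G t) n \<omega> / sqrt (real n)\<bar>)"
      using mart_abs_bound[of "- adjoint G t"] by blast
    then show ?thesis using False unfolding A_def by (subst integrable_abs_iff[symmetric]) auto
  qed
  have bound: "\<exists>C. \<forall>n. (\<integral>\<omega>. \<bar>t \<bullet> scaled_error n \<omega>\<bar> \<partial>M) \<le> C" for t
  proof -
    obtain C where C: "\<And>n. 0 < n \<Longrightarrow> (\<integral>\<omega>. \<bar>A t n \<omega>\<bar> \<partial>M) \<le> C"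
      using mart_abs_bound[of "- adjoint G t"] unfolding A_def by blast
    have "Bseq (I t)" by (intro convergent_imp_Bseq convergentI[OF Ilim])
    then obtain C' where C': "\<And>n. norm (I t n) \<le> C'" unfolding Bseq_def by blast
    have C'0: "0 \<le> C'" using C'[of 0] norm_ge_zero order_trans by blast
    have "(\<integral>\<omega>. \<bar>t \<bullet> scaled_error n \<omega>\<bar> \<partial>M) \<le> C' + \<bar>C\<bar>" for n
    proof (cases "n = 0")
      case True then show ?thesis using C'0 by (simp add: scaled_error_def)
    next
      case False
      have "(\<integral>\<omega>. \<bar>t \<bullet> scaled_error n \<omega>\<bar> \<partial>M) \<le> (\<integral>\<omega>. \<bar>t \<bullet> scaled_error n \<omega> - A t n \<omega>\<bar> + \<bar>A t n \<omega>\<bar> \<partial>M)"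
        using ti[of t n] Ai[of t n] by (intro integral_mono) auto
      also have "\<dots> = I t n + (\<integral>\<omega>. \<bar>A t n \<omega>\<bar> \<partial>M)"
        unfolding I_def using ti[of t n] Ai[of t n] by (intro Bochner_Integration.integral_add) auto
      also have "\<dots> \<le> C' + \<bar>C\<bar>" using C'[of n] C[of n] False by simp
      finally show ?thesis .
    qed
    then show ?thesis by blast
  qed
  obtain B where B: "\<And>t n. (\<integral>\<omega>. \<bar>t \<bullet> scaled_error n \<omega>\<bar> \<partial>M) \<le> B t" using bound by metis
  have nb: "(\<integral>\<omega>. norm (scaled_error n \<omega>) \<partial>M) \<le> (\<Sum>i\<in>UNIV. B (axis i 1))" for n
  proof -
    have "(\<integral>\<omega>. norm (scaled_error n \<omega>) \<partial>M) \<le> (\<integral>\<omega>. (\<Sum>i\<in>UNIV. \<bar>axis i 1 \<bullet> scaled_error n \<omega>\<bar>) \<partial>M)"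
    proof (rule integral_mono[OF scaled_error_integrable])
      show "integrable M (\<lambda>\<omega>. \<Sum>i\<in>UNIV. \<bar>axis i 1 \<bullet> scaled_error n \<omega>\<bar>)"
        using ti by (intro Bochner_Integration.integrable_sum integrable_abs)
      show "norm (scaled_error n \<omega>) \<le> (\<Sum>i\<in>UNIV. \<bar>axis i 1 \<bullet> scaled_error n \<omega>\<bar>)" for \<omega>
        using norm_le_l1_cart[of "scaled_error n \<omega>"] by (simp add: inner_axis')
    qed
    also have "\<dots> = (\<Sum>i\<in>UNIV. \<integral>\<omega>. \<bar>axis i 1 \<bullet> scaled_error n \<omega>\<bar> \<partial>M)"
      using ti by (intro Bochner_Integration.integral_sum integrable_abs)
    also have "\<dots> \<le> (\<Sum>i\<in>UNIV. B (axis i 1))" by (intro sum_mono B)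
    finally show ?thesis .
  qed
  have conv: "(\<lambda>n. \<integral>\<omega>. cos (t \<bullet> scaled_error n \<omega> + c) \<partial>M) \<longlonglongrightarrow> (\<integral>x. cos (t \<bullet> x + c) \<partial>L)" for t c
  proof -
    have m: "(\<lambda>n. \<integral>\<omega>. cos (A t n \<omega> + c) \<partial>M) \<longlonglongrightarrow> exp (- (t \<bullet> (V *v t)) / 2) * cos c"
      unfolding A_def V(2) by (rule mart_cos_tendsto)
    have d: "(\<lambda>n. (\<integral>\<omega>. cos (t \<bullet> scaled_error n \<omega> + c) \<partial>M) - (\<integral>\<omega>. cos (A t n \<omega> + c) \<partial>M)) \<longlonglongrightarrow> 0"
    proof (rule Lim_null_comparison[OF _ Ilim[of t]], intro always_eventually allI)
      fix n
      have i: "integrable M (\<lambda>\<omega>. cos (t \<bullet> scaled_error n \<omega> + c))" "integrable M (\<lambda>\<omega>. cos (A t n \<omega> + c))"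
        by (rule integrable_const_bound[where B=1]; simp)+
      \<comment> \<open>The cosine is 1-Lipschitz, so closeness in mean to the normalised martingale
        passes to the expectations.\<close>
      have lip: "\<bar>cos u - cos v\<bar> \<le> \<bar>u - v\<bar>" for u v :: real
      proof -
        have "\<bar>cos u - cos v\<bar> = 2 * \<bar>sin ((u + v) / 2)\<bar> * \<bar>sin ((v - u) / 2)\<bar>"
          by (simp add: cos_diff_cos abs_mult)
        also have "\<dots> \<le> 2 * 1 * \<bar>(v - u) / 2\<bar>"
          by (intro mult_mono abs_sin_le_one abs_sin_x_le_abs_x) auto
        finally show ?thesis by (simp add: abs_minus_commute)
      qed
      have "norm ((\<integral>\<omega>. cos (t \<bullet> scaled_error n \<omega> + c) \<partial>M) - (\<integral>\<omega>. cos (A t n \<omega> + c) \<partial>M))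
          = \<bar>\<integral>\<omega>. cos (t \<bullet> scaled_error n \<omega> + c) - cos (A t n \<omega> + c) \<partial>M\<bar>" using i by simp
      also have "\<dots> \<le> (\<integral>\<omega>. \<bar>cos (t \<bullet> scaled_error n \<omega> + c) - cos (A t n \<omega> + c)\<bar> \<partial>M)" by (rule integral_abs_bound)
      also have "\<dots> \<le> I t n"
        unfolding I_def
      proof (rule integral_mono)
        show "\<bar>cos (t \<bullet> scaled_error n \<omega> + c) - cos (A t n \<omega> + c)\<bar> \<le> \<bar>t \<bullet> scaled_error n \<omega> - A t n \<omega>\<bar>" for \<omega>
          using lip[of "t \<bullet> scaled_error n \<omega> + c" "A t n \<omega> + c"] by simp
      qed (use i ti[of t n] Ai[of t n] in auto)
      finally show "norm ((\<integral>\<omega>. cos (t \<bullet> scaled_error n \<omega> + c) \<partial>M) - (\<integral>\<omega>. cos (A t n \<omega> + c) \<partial>M)) \<le> I t n" .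
    qed
    from tendsto_add[OF d m] show ?thesis by (simp add: multivariate_normal_cos[OF L])
  qed
  have "prob_space L" "sets L = sets borel" using L by (auto simp: multivariate_normal_def)
  then have "converges_in_distribution M scaled_error L"
    by (intro converges_in_distribution_cos[OF prob_space_axioms scaled_error_meas _ _ scaled_error_integrable nb conv])
  then show ?thesis using L by blast
qed

end

theorem theorem5:
  fixes P :: "real^'s::finite^'s" and T :: "'s set" and idx :: "'m::finite \<Rightarrow> 's"
    and Q :: "real^'m^'m" and \<mu>\<^sub>0 :: "real^'m"
  assumes "irreducible_absorbing_chain P T idx"
    and "Q = restrict_matrix P idx"
    and "\<mu>\<^sub>0 \<in> prob_simplex"
  shows "(\<exists>!\<mu>. quasi_stationary Q \<mu>) \<and>
    (\<forall>\<mu> \<epsilon> (M :: 'w measure) X \<mu>s.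
       quasi_stationary Q \<mu> \<and> admissible_steps \<epsilon> \<and>
       projection_algorithm P T idx \<epsilon> \<mu>\<^sub>0 M X \<mu>s \<longrightarrow>
         (AE \<omega> in M. (\<lambda>n. averaged_iterates \<mu>s n \<omega>) \<longlonglongrightarrow> \<mu>) \<and>
         (\<exists>V N. multivariate_normal N 0 V \<and>
            converges_in_distribution M
              (\<lambda>n \<omega>. sqrt (real n) *\<^sub>R (averaged_iterates \<mu>s n \<omega> - \<mu>)) N))"
proof -
  obtain w qsd l where "perron_chain P T idx (restrict_matrix P idx) w qsd l"
    using perron_chain_exists[OF assms(1)] by blast
  then interpret perron_chain P T idx Q w qsd l by (simp add: assms(2))
  have main: "(AE \<omega> in M. (\<lambda>n. averaged_iterates \<mu>s n \<omega>) \<longlonglongrightarrow> qsd) \<and>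
      (\<exists>V N. multivariate_normal N 0 V \<and>
        converges_in_distribution M (\<lambda>n \<omega>. sqrt (real n) *\<^sub>R (averaged_iterates \<mu>s n \<omega> - qsd)) N)"
    if steps: "admissible_steps \<epsilon>" and alg: "projection_algorithm P T idx \<epsilon> \<mu>\<^sub>0 M X \<mu>s"
    for \<epsilon> and M :: "'w measure" and X \<mu>s
  proof -
    obtain \<alpha> a b where ab: "1 / 2 < \<alpha>" "\<alpha> < 1" "0 < a" "0 < b"
      "\<And>n. a * (real n + 1) powr - \<alpha> \<le> \<epsilon> n" "\<And>n. \<epsilon> n \<le> b * (real n + 1) powr - \<alpha>"
      using admissible_steps_bounds[OF steps] by blast
    interpret projected_process P T idx Q w qsd l \<epsilon> \<mu>\<^sub>0 M X \<mu>s \<alpha> a b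
      using alg assms(3) steps ab by unfold_locales (auto simp: admissible_steps_def)
    show ?thesis
      using averaged_converges scaled_error_converges unfolding scaled_error_def[abs_def] by blast
  qed
  show ?thesis
  proof (rule conjI)
    show "\<exists>!\<mu>. quasi_stationary Q \<mu>"
      using quasi_stationary_qsd quasi_stationary_unique by (rule ex1I)
  \<comment> \<open>The limit was shown for \<open>qsd\<close>; uniqueness identifies any given
    quasi-stationary distribution with it.\<close>
  qed (use main quasi_stationary_unique in blast)
qed

end
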